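(* The function $G:\,]0,\infty[\times\mathbb{R}\to\mathbb{R}$ is locally Lipschitz. Consequently, for every $\eta_0>0$ and $\eta_1\in\mathbb{R}$, the Cauchy problem $\eta''=G(\eta,\eta')$, $\eta(0)=\eta_0$, $\eta'(0)=\eta_1$ has a unique solution locally in time.
   Context: Let $\Omega\subset\mathbb{R}^2$ be a bounded open set with regular boundary and $0\in\Omega$. Let $h_0\in C^1(\bar\Omega)$ with $h_0\ge 0$ and $\min_{\Omega}h_0=h_0(0)=0$. Let $F>0$. Let $K=\{\varphi\in H^1_0(\Omega):\varphi\ge 0\}$. For $\beta>0$, $\gamma\in\mathbb{R}$, let $q\in K$ be the unique solution of the variational inequality $\int_\Omega (h_0+\beta)^3\nabla q\cdot\nabla(\varphi-q)\,dx\ge \int_\Omega h_0\,\frac{\partial}{\partial x_1}(\varphi-q)\,dx-\gamma\int_\Omega(\varphi-q)\,dx$ for all $\varphi\in K$, and define $G(\beta,\gamma)=\int_\Omega q\,dx-F$. *)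

theory Defs
  imports "HOL-Analysis.Analysis"
begin

type_synonym pt = "real \<times> real"

definition rot2 :: "real \<Rightarrow> pt \<Rightarrow> pt" where
  "rot2 \<theta> y = (cos \<theta> * fst y + sin \<theta> * snd y, - sin \<theta> * fst y + cos \<theta> * snd y)"

definition C1_boundary :: "pt set \<Rightarrow> bool" where
  "C1_boundary \<Omega> \<longleftrightarrow> (\<forall>x\<in>frontier \<Omega>. \<exists>r>0. \<exists>\<theta>. \<exists>g::real \<Rightarrow> real.
      g C1_differentiable_on UNIV \<and>
      \<Omega> \<inter> ball x r = {y \<in> ball x r. snd (rot2 \<theta> (y - x)) > g (fst (rot2 \<theta> (y - x)))})"

definition C1_closure :: "pt set \<Rightarrow> (pt \<Rightarrow> real) \<Rightarrow> bool" where
  "C1_closure \<Omega> h \<longleftrightarrow> continuous_on (closure \<Omega>) h \<and>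
     (\<exists>d1 d2. continuous_on (closure \<Omega>) d1 \<and> continuous_on (closure \<Omega>) d2 \<and>
        (\<forall>x\<in>\<Omega>. (h has_derivative (\<lambda>v. d1 x * fst v + d2 x * snd v)) (at x)))"

coinductive smooth2 :: "(pt \<Rightarrow> real) \<Rightarrow> bool" where
  "\<lbrakk>\<forall>x. (f has_derivative (\<lambda>v. f1 x * fst v + f2 x * snd v)) (at x); smooth2 f1; smooth2 f2\<rbrakk>
    \<Longrightarrow> smooth2 f"

definition test_fun :: "pt set \<Rightarrow> (pt \<Rightarrow> real) \<Rightarrow> bool" where
  "test_fun \<Omega> \<phi> \<longleftrightarrow> smooth2 \<phi> \<and> compact (closure {x. \<phi> x \<noteq> 0}) \<and> closure {x. \<phi> x \<noteq> 0} \<subseteq> \<Omega>"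

definition pd :: "pt \<Rightarrow> (pt \<Rightarrow> real) \<Rightarrow> pt \<Rightarrow> real" where
  "pd v \<phi> x = frechet_derivative \<phi> (at x) v"

definition L2 :: "pt set \<Rightarrow> (pt \<Rightarrow> real) \<Rightarrow> bool" where
  "L2 \<Omega> u \<longleftrightarrow> u \<in> borel_measurable (lebesgue_on \<Omega>) \<and> integrable (lebesgue_on \<Omega>) (\<lambda>x. (u x)\<^sup>2)"

definition weak_deriv :: "pt set \<Rightarrow> pt \<Rightarrow> (pt \<Rightarrow> real) \<Rightarrow> (pt \<Rightarrow> real) \<Rightarrow> bool" where
  "weak_deriv \<Omega> v u w \<longleftrightarrow> (\<forall>\<phi>. test_fun \<Omega> \<phi> \<longrightarrow>
     (LINT x|lebesgue_on \<Omega>. u x * pd v \<phi> x) = - (LINT x|lebesgue_on \<Omega>. w x * \<phi> x))"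

definition e1 :: pt where "e1 = (1, 0)"
definition e2 :: pt where "e2 = (0, 1)"

definition H1 :: "pt set \<Rightarrow> (pt \<Rightarrow> real) \<Rightarrow> bool" where
  "H1 \<Omega> u \<longleftrightarrow> L2 \<Omega> u \<and> (\<exists>w1 w2. L2 \<Omega> w1 \<and> L2 \<Omega> w2 \<and> weak_deriv \<Omega> e1 u w1 \<and> weak_deriv \<Omega> e2 u w2)"

text \<open>The (a.e. unique) weak partial derivative.\<close>
definition wpd :: "pt set \<Rightarrow> pt \<Rightarrow> (pt \<Rightarrow> real) \<Rightarrow> pt \<Rightarrow> real" where
  "wpd \<Omega> v u = (SOME w. L2 \<Omega> w \<and> weak_deriv \<Omega> v u w)"

definition H10 :: "pt set \<Rightarrow> (pt \<Rightarrow> real) \<Rightarrow> bool" where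
  "H10 \<Omega> u \<longleftrightarrow> H1 \<Omega> u \<and> (\<exists>\<phi>. (\<forall>n. test_fun \<Omega> (\<phi> n)) \<and>
     (\<lambda>n. (LINT x|lebesgue_on \<Omega>. (\<phi> n x - u x)\<^sup>2 + (pd e1 (\<phi> n) x - wpd \<Omega> e1 u x)\<^sup>2
                                   + (pd e2 (\<phi> n) x - wpd \<Omega> e2 u x)\<^sup>2)) \<longlonglongrightarrow> 0)"

definition Kset :: "pt set \<Rightarrow> (pt \<Rightarrow> real) set" where
  "Kset \<Omega> = {\<phi>. H10 \<Omega> \<phi> \<and> (AE x in lebesgue_on \<Omega>. \<phi> x \<ge> 0)}"

definition VI_sol :: "pt set \<Rightarrow> (pt \<Rightarrow> real) \<Rightarrow> real \<Rightarrow> real \<Rightarrow> (pt \<Rightarrow> real) \<Rightarrow> bool" where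
  "VI_sol \<Omega> h0 \<beta> \<gamma> q \<longleftrightarrow> q \<in> Kset \<Omega> \<and> (\<forall>\<phi>\<in>Kset \<Omega>.
     (LINT x|lebesgue_on \<Omega>. (h0 x + \<beta>)^3 *
        (wpd \<Omega> e1 q x * (wpd \<Omega> e1 \<phi> x - wpd \<Omega> e1 q x) + wpd \<Omega> e2 q x * (wpd \<Omega> e2 \<phi> x - wpd \<Omega> e2 q x)))
     \<ge> (LINT x|lebesgue_on \<Omega>. h0 x * (wpd \<Omega> e1 \<phi> x - wpd \<Omega> e1 q x))
        - \<gamma> * (LINT x|lebesgue_on \<Omega>. \<phi> x - q x))"

text \<open>G(beta,gamma) = int q - F, for q the (a.e. unique) solution.\<close>
definition Gfun :: "pt set \<Rightarrow> (pt \<Rightarrow> real) \<Rightarrow> real \<Rightarrow> real \<Rightarrow> real \<Rightarrow> real" where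
  "Gfun \<Omega> h0 F \<beta> \<gamma> = (LINT x|lebesgue_on \<Omega>. (SOME q. VI_sol \<Omega> h0 \<beta> \<gamma> q) x) - F"

definition locally_lipschitz_on :: "pt set \<Rightarrow> (pt \<Rightarrow> real) \<Rightarrow> bool" where
  "locally_lipschitz_on U f \<longleftrightarrow> (\<forall>z\<in>U. \<exists>r>0. \<exists>L. L-lipschitz_on (ball z r \<inter> U) f)"

definition ode_sol :: "(real \<Rightarrow> real \<Rightarrow> real) \<Rightarrow> real \<Rightarrow> real \<Rightarrow> real \<Rightarrow> (real \<Rightarrow> real) \<Rightarrow> (real \<Rightarrow> real) \<Rightarrow> bool" where
  "ode_sol G a b T \<eta> \<eta>' \<longleftrightarrow> \<eta> 0 = a \<and> \<eta>' 0 = b \<and>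
     (\<forall>t\<in>{0..T}. \<eta> t > 0 \<and> (\<eta> has_real_derivative \<eta>' t) (at t within {0..T}) \<and>
        (\<eta>' has_real_derivative G (\<eta> t) (\<eta>' t)) (at t within {0..T}))"

end

theory Submission
  imports Defs
begin

text \<open>
  For fixed \<open>(\<beta>, \<gamma>)\<close> the solution of the variational inequality minimizes a quadratic energy over a
  closed convex cone. By Poincare's inequality the energy is coercive, so a minimizing sequence is
  Cauchy and a solution exists. Testing the inequalities for two parameter pairs against each
  other's solutions bounds the \<open>L\<^sup>2\<close> distance of the gradients by the distance of the parameters, and
  with it the difference of the two means; this is the Lipschitz bound for \<open>G\<close>, and
  the Cauchy problem is then an instance of Picard's contraction argument. As weak derivatives are
  picked by a choice operator, one also needs their uniqueness almost everywhere, which rests on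
  the existence of enough smooth compactly supported functions.
\<close>

section \<open>Square-integrable functions\<close>

text \<open>Functions are kept as functions, not as classes modulo null sets, and both
  \<open>wpd\<close> and \<open>Gfun\<close> go through \<open>SOME\<close>. Identities such as
  linearity of \<open>wpd\<close> therefore hold only almost everywhere and cannot be rewritten
  with. The remedy is to work with jets (u, D_1 u, D_2 u): there H^1_0 becomes the L^2 closure of
  the jets of test functions, a genuine linear space on which energy and load involve no choice, and
  \<open>wpd\<close> reappears only when a result is translated back. The choice in
  \<open>Gfun\<close> is harmless because the stability estimate holds for any two solutions. As h_0
  is nonnegative and vanishes at a point of \<Omega>, the weight (h_0 + \<beta>)^3 is bounded below
  by \<beta>^3 and no better. Negative powers of \<beta> enter the Lipschitz constant, so the
  argument gives bounds only locally in \<beta> > 0. The other constants are a bound H of h_0, the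
  radius R of a ball around the origin containing \<Omega>, the Poincare constant 2 R, and the L^2
  norm of the function 1, which converts L^2 bounds into bounds on means.\<close>

definition sq_integrable :: "'a measure \<Rightarrow> ('a \<Rightarrow> 'b::euclidean_space) \<Rightarrow> bool" where
  "sq_integrable M f \<longleftrightarrow> f \<in> borel_measurable M \<and> integrable M (\<lambda>x. (norm (f x))\<^sup>2)"

text \<open>Only a seminorm, since functions are not identified almost everywhere. Values in any
  Euclidean space let one theory cover scalar functions, gradients and whole jets.\<close>

definition l2norm :: "'a measure \<Rightarrow> ('a \<Rightarrow> 'b::euclidean_space) \<Rightarrow> real" where
  "l2norm M f = sqrt (LINT x|M. (norm (f x))\<^sup>2)"

lemma sq_integrable_measurable [measurable_dest]: "sq_integrable M f \<Longrightarrow> f \<in> borel_measurable M"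
  by (simp add: sq_integrable_def)

lemma l2norm_nonneg [simp]: "0 \<le> l2norm M f"
  by (simp add: l2norm_def)

lemma l2norm_power2: "(l2norm M f)\<^sup>2 = (LINT x|M. (norm (f x))\<^sup>2)"
  by (simp add: l2norm_def)

text \<open>Domination settles square integrability of components of vectors, of weighted functions
  and of bounded continuous functions, each time with an explicit constant.\<close>

lemma sq_integrable_bound:
  assumes "sq_integrable M g" "f \<in> borel_measurable M" "\<And>x. x \<in> space M \<Longrightarrow> norm (f x) \<le> K * norm (g x)" 
  shows "sq_integrable M f" and "0 \<le> K \<Longrightarrow> l2norm M f \<le> K * l2norm M g"
proof -
  have le: "(norm (f x))\<^sup>2 \<le> K\<^sup>2 * (norm (g x))\<^sup>2" if "x \<in> space M" for x
    using power_mono[OF assms(3)[OF that], of 2] by (simp add: power_mult_distrib)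
  have int: "integrable M (\<lambda>x. K\<^sup>2 * (norm (g x))\<^sup>2)"
    using assms(1) by (simp add: sq_integrable_def)
  have f: "integrable M (\<lambda>x. (norm (f x))\<^sup>2)"
    by (rule Bochner_Integration.integrable_bound[OF int])
      (use assms(2) le in \<open>auto intro!: AE_I2\<close>)
  then show "sq_integrable M f"
    using assms(2) by (simp add: sq_integrable_def)
  assume "0 \<le> K"
  have "(LINT x|M. (norm (f x))\<^sup>2) \<le> (LINT x|M. K\<^sup>2 * (norm (g x))\<^sup>2)"
    by (intro integral_mono f int le)
  then have "(l2norm M f)\<^sup>2 \<le> (K * l2norm M g)\<^sup>2"
    by (simp add: l2norm_power2 power_mult_distrib)
  then show "l2norm M f \<le> K * l2norm M g"
    using \<open>0 \<le> K\<close> by (auto dest: power2_le_imp_le)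
qed

lemma sq_integrable_inner:
  assumes "sq_integrable M f" "sq_integrable M g"
  shows "integrable M (\<lambda>x. f x \<bullet> g x)"
proof (rule Bochner_Integration.integrable_bound)
  show "integrable M (\<lambda>x. (norm (f x))\<^sup>2 + (norm (g x))\<^sup>2)"
    using assms by (simp add: sq_integrable_def)
  show "(\<lambda>x. f x \<bullet> g x) \<in> borel_measurable M"
    using assms by measurable
  have "\<bar>f x \<bullet> g x\<bar> \<le> (norm (f x))\<^sup>2 + (norm (g x))\<^sup>2" for x
  proof -
    have "\<bar>f x \<bullet> g x\<bar> \<le> norm (f x) * norm (g x)"
      by (rule Cauchy_Schwarz_ineq2)
    moreover have "2 * (norm (f x) * norm (g x)) \<le> (norm (f x))\<^sup>2 + (norm (g x))\<^sup>2"
      using sum_squares_bound[of "norm (f x)" "norm (g x)"] by simp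
    moreover have "0 \<le> norm (f x) * norm (g x)"
      by simp
    ultimately show ?thesis by linarith
  qed
  then show "AE x in M. norm (f x \<bullet> g x) \<le> norm ((norm (f x))\<^sup>2 + (norm (g x))\<^sup>2)"
    by simp
qed

lemma sq_integrable_scaleR:
  assumes "sq_integrable M f" shows "sq_integrable M (\<lambda>x. c *\<^sub>R f x)"
  by (rule sq_integrable_bound[OF assms, where K = "\<bar>c\<bar>"])
    (use assms in \<open>auto simp: sq_integrable_def\<close>)

lemma sq_integrable_add:
  assumes "sq_integrable M f" "sq_integrable M g"
  shows "sq_integrable M (\<lambda>x. f x + g x)"
proof -
  have "(norm (f x + g x))\<^sup>2 = (norm (f x))\<^sup>2 + (norm (g x))\<^sup>2 + 2 * (f x \<bullet> g x)" for x
    by (simp add: power2_norm_eq_inner inner_add inner_commute)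
  then show ?thesis
    using assms sq_integrable_inner[OF assms] by (auto simp: sq_integrable_def)
qed

lemma sq_integrable_diff:
  assumes "sq_integrable M f" "sq_integrable M g"
  shows "sq_integrable M (\<lambda>x. f x - g x)"
  using sq_integrable_add[OF assms(1) sq_integrable_scaleR[OF assms(2), of "-1"]] by simp

lemma sq_integrable_const: "finite_measure M \<Longrightarrow> sq_integrable M (\<lambda>_. c)"
  by (simp add: sq_integrable_def finite_measure.emeasure_real finite_measure.integrable_const)

lemma sq_integrable_integrable:
  fixes f :: "'a \<Rightarrow> real"
  assumes "finite_measure M" "sq_integrable M f"
  shows "integrable M f"
  using sq_integrable_inner[OF assms(2) sq_integrable_const[OF assms(1), of 1]] by simp

text \<open>The polynomial t -> ||f + t g||^2 is nonnegative, so its discriminant cannot be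
  positive.\<close>

lemma l2norm_Cauchy_Schwarz:
  assumes f: "sq_integrable M f" and g: "sq_integrable M g"
  shows "\<bar>LINT x|M. f x \<bullet> g x\<bar> \<le> l2norm M f * l2norm M g"
proof -
  define A B C where "A = (l2norm M f)\<^sup>2" and "B = (l2norm M g)\<^sup>2" and "C = (LINT x|M. f x \<bullet> g x)"
  have quad: "0 \<le> A + 2 * t * C + t\<^sup>2 * B" for t
  proof -
    have "0 \<le> (LINT x|M. (norm (f x + t *\<^sub>R g x))\<^sup>2)"
      by simp
    also have "\<dots> = (LINT x|M. (norm (f x))\<^sup>2 + 2 * t * (f x \<bullet> g x) + t\<^sup>2 * (norm (g x))\<^sup>2)"
      by (intro Bochner_Integration.integral_cong refl)
        (unfold power2_norm_eq_inner, simp add: inner_add inner_commute power2_eq_square algebra_simps)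
    also have "\<dots> = A + 2 * t * C + t\<^sup>2 * B"
      using f g sq_integrable_inner[OF f g] by (simp add: sq_integrable_def A_def B_def C_def l2norm_power2)
    finally show ?thesis .
  qed
  have "C\<^sup>2 \<le> A * B"
  proof (cases "B = 0")
    case True
    have "C = 0"
    proof (rule ccontr)
      assume "C \<noteq> 0"
      \<comment> \<open>For B = 0 the polynomial is the affine function A + 2 t C, and this t gives
        it the value -1.\<close>
      then have "2 * (- (A + 1) / (2 * C)) * C = - (A + 1)"
        by (simp add: field_simps)
      then show False
        using quad[of "- (A + 1) / (2 * C)"] True by simp
    qed
    then show ?thesis using True by simp
  next
    case False
    then have "B > 0" by (simp add: B_def)
    then show ?thesis
      using quad[of "- C / B"] by (simp add: field_simps power2_eq_square)
  qed
  then have "C\<^sup>2 \<le> (l2norm M f * l2norm M g)\<^sup>2"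
    by (simp add: A_def B_def power_mult_distrib)
  then show ?thesis
    unfolding C_def by (simp add: abs_le_square_iff[symmetric])
qed

lemma l2norm_triangle:
  assumes f: "sq_integrable M f" and g: "sq_integrable M g"
  shows "l2norm M (\<lambda>x. f x + g x) \<le> l2norm M f + l2norm M g"
proof (rule power2_le_imp_le)
  have "(l2norm M (\<lambda>x. f x + g x))\<^sup>2 = (LINT x|M. (norm (f x))\<^sup>2 + 2 * (f x \<bullet> g x) + (norm (g x))\<^sup>2)"
    unfolding l2norm_power2
    by (intro Bochner_Integration.integral_cong refl)
      (simp add: power2_norm_eq_inner inner_add inner_commute algebra_simps)
  also have "\<dots> = (l2norm M f)\<^sup>2 + 2 * (LINT x|M. f x \<bullet> g x) + (l2norm M g)\<^sup>2"
    using f g sq_integrable_inner[OF f g] by (simp add: sq_integrable_def l2norm_power2)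
  also have "\<dots> \<le> (l2norm M f + l2norm M g)\<^sup>2"
    using l2norm_Cauchy_Schwarz[OF f g] by (simp add: power2_sum)
  finally show "(l2norm M (\<lambda>x. f x + g x))\<^sup>2 \<le> (l2norm M f + l2norm M g)\<^sup>2" .
qed simp

lemma l2norm_scaleR: "l2norm M (\<lambda>x. c *\<^sub>R f x) = \<bar>c\<bar> * l2norm M f"
  by (simp add: l2norm_def power_mult_distrib real_sqrt_mult)

lemma l2norm_minus_commute: "l2norm M (\<lambda>x. f x - g x) = l2norm M (\<lambda>x. g x - f x)"
  by (simp add: l2norm_def norm_minus_commute)

lemma l2norm_cong_AE:
  assumes "f \<in> borel_measurable M" "g \<in> borel_measurable M" "AE x in M. f x = g x"
  shows "l2norm M f = l2norm M g"
  unfolding l2norm_def using assms by (intro arg_cong[where f = sqrt] integral_cong_AE) auto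

lemma l2norm_triangle_diff:
  assumes "sq_integrable M f" "sq_integrable M g" "sq_integrable M h"
  shows "l2norm M (\<lambda>x. f x - h x) \<le> l2norm M (\<lambda>x. f x - g x) + l2norm M (\<lambda>x. g x - h x)"
  using l2norm_triangle[OF sq_integrable_diff[OF assms(1,2)] sq_integrable_diff[OF assms(2,3)]] by simp

lemma l2norm_eq_0_AE:
  assumes "sq_integrable M f" "l2norm M f = 0"
  shows "AE x in M. f x = 0"
proof -
  have "(LINT x|M. (norm (f x))\<^sup>2) = 0"
    using assms(2) by (simp add: l2norm_def)
  then have "AE x in M. (norm (f x))\<^sup>2 = 0"
    using integral_nonneg_eq_0_iff_AE[of M "\<lambda>x. (norm (f x))\<^sup>2"] assms(1) by (auto simp: sq_integrable_def)
  then show ?thesis by simp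
qed

section \<open>Limits and completeness in L^2\<close>

lemma tendsto_l2_inner:
  assumes "\<And>n. sq_integrable M (s n)" "sq_integrable M f" "(\<lambda>n. l2norm M (\<lambda>x. s n x - f x)) \<longlonglongrightarrow> 0"
    and g: "sq_integrable M g"
  shows "(\<lambda>n. LINT x|M. s n x \<bullet> g x) \<longlonglongrightarrow> (LINT x|M. f x \<bullet> g x)"
proof (rule Lim_transform2)
  show "(\<lambda>_. LINT x|M. f x \<bullet> g x) \<longlonglongrightarrow> (LINT x|M. f x \<bullet> g x)"
    by simp
  have "(\<lambda>n. (LINT x|M. s n x \<bullet> g x) - (LINT x|M. f x \<bullet> g x)) \<longlonglongrightarrow> 0"
  proof (rule Lim_null_comparison)
    show "\<forall>\<^sub>F n in sequentially. norm ((LINT x|M. s n x \<bullet> g x) - (LINT x|M. f x \<bullet> g x))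
        \<le> l2norm M (\<lambda>x. s n x - f x) * l2norm M g"
      using l2norm_Cauchy_Schwarz[OF sq_integrable_diff[OF assms(1,2)] g]
      by (simp add: inner_diff sq_integrable_inner assms(1,2) g)
    show "(\<lambda>n. l2norm M (\<lambda>x. s n x - f x) * l2norm M g) \<longlonglongrightarrow> 0"
      using tendsto_mult_right[OF assms(3), of "l2norm M g"] by simp
  qed
  then show "(\<lambda>n. (LINT x|M. f x \<bullet> g x) - (LINT x|M. s n x \<bullet> g x)) \<longlonglongrightarrow> 0"
    using tendsto_minus by fastforce
qed

text \<open>On a finite measure space an L^2 Cauchy sequence is L^1 Cauchy, so a subsequence
  converges almost everywhere. Fatou's lemma along that subsequence bounds the L^2 distance between
  the candidate limit and each late member of the sequence.\<close>

lemma l2_complete: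
  fixes s :: "nat \<Rightarrow> 'a \<Rightarrow> 'b::euclidean_space"
  assumes M: "finite_measure M" and s: "\<And>n. sq_integrable M (s n)"
    and Cauchy: "\<And>e. e > 0 \<Longrightarrow> \<exists>N. \<forall>i\<ge>N. \<forall>j\<ge>N. l2norm M (\<lambda>x. s i x - s j x) < e"
  obtains g where "sq_integrable M g" "(\<lambda>n. l2norm M (\<lambda>x. s n x - g x)) \<longlonglongrightarrow> 0"
proof -
  have [measurable]: "s n \<in> borel_measurable M" for n
    using s by (simp add: sq_integrable_def)
  have sd: "sq_integrable M (\<lambda>x. s i x - s j x)" for i j
    by (intro sq_integrable_diff s)
  have int: "integrable M (s n)" for n
  proof -
    have "sq_integrable M (\<lambda>x. norm (s n x))"
      using s[of n] by (simp add: sq_integrable_def)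
    from sq_integrable_integrable[OF M this] show ?thesis
      by (subst (asm) integrable_norm_iff) auto
  qed
  have L1: "(LINT x|M. norm (s i x - s j x)) \<le> l2norm M (\<lambda>x. s i x - s j x) * l2norm M (\<lambda>_. 1::real)" for i j
  proof -
    have "sq_integrable M (\<lambda>x. norm (s i x - s j x))"
      using sd[of i j] by (simp add: sq_integrable_def)
    from l2norm_Cauchy_Schwarz[OF this sq_integrable_const[OF M, of "1::real"]]
    show ?thesis
      by (simp add: l2norm_def)
  qed
  obtain r where r: "strict_mono r" and AE_Cauchy: "AE x in M. Cauchy (\<lambda>i. s (r i) x)"
  proof (rule cauchy_L1_AE_cauchy_subseq[OF int])
    fix e :: real assume "e > 0"
    \<comment> \<open>The added 1 keeps the denominator positive even when the whole space has
      measure 0.\<close>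
    then have "e / (l2norm M (\<lambda>_. 1::real) + 1) > 0"
      by (intro divide_pos_pos add_nonneg_pos) auto
    then obtain N where N: "\<And>i j. i \<ge> N \<Longrightarrow> j \<ge> N \<Longrightarrow>
        l2norm M (\<lambda>x. s i x - s j x) < e / (l2norm M (\<lambda>_. 1::real) + 1)"
      using Cauchy by blast
    have "(LINT x|M. norm (s i x - s j x)) < e" if "i \<ge> N" "j \<ge> N" for i j
    proof -
      have "(LINT x|M. norm (s i x - s j x)) \<le> l2norm M (\<lambda>x. s i x - s j x) * (l2norm M (\<lambda>_. 1::real) + 1)"
        using L1[of i j] by (simp add: distrib_left add_increasing2)
      also have "\<dots> < e"
        using N[OF that] by (simp add: pos_less_divide_eq add_nonneg_pos)
      finally show ?thesis .
    qed
    then show "\<exists>N. \<forall>i\<ge>N. \<forall>j\<ge>N. (LINT x|M. norm (s i x - s j x)) < e"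
      by blast
  qed blast
  \<comment> \<open>On the null set without convergence \<open>lim\<close> is some arbitrary value;
    the formula still defines a measurable function.\<close>
  define g where "g x = lim (\<lambda>i. s (r i) x)" for x
  have g_meas [measurable]: "g \<in> borel_measurable M"
    unfolding g_def by measurable
  have g_lim: "AE x in M. (\<lambda>i. s (r i) x) \<longlonglongrightarrow> g x"
    using AE_Cauchy by eventually_elim (simp add: g_def Cauchy_convergent_iff convergent_LIMSEQ_iff)
  have key: "\<exists>N. \<forall>i\<ge>N. sq_integrable M (\<lambda>x. s i x - g x) \<and> l2norm M (\<lambda>x. s i x - g x) \<le> e" if "e > 0" for e
  proof -
    obtain N where N: "\<And>i j. i \<ge> N \<Longrightarrow> j \<ge> N \<Longrightarrow> l2norm M (\<lambda>x. s i x - s j x) < e"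
      using Cauchy[OF \<open>e > 0\<close>] by blast
    have "sq_integrable M (\<lambda>x. s i x - g x) \<and> l2norm M (\<lambda>x. s i x - g x) \<le> e" if "i \<ge> N" for i
    proof -
      have "(\<integral>\<^sup>+x. ennreal ((norm (s i x - g x))\<^sup>2) \<partial>M)
          = (\<integral>\<^sup>+x. liminf (\<lambda>k. ennreal ((norm (s i x - s (r k) x))\<^sup>2)) \<partial>M)"
      proof (rule nn_integral_cong_AE)
        show "AE x in M. ennreal ((norm (s i x - g x))\<^sup>2) = liminf (\<lambda>k. ennreal ((norm (s i x - s (r k) x))\<^sup>2))"
          using g_lim
        proof eventually_elim
          case (elim x)
          have "(\<lambda>k. ennreal ((norm (s i x - s (r k) x))\<^sup>2)) \<longlonglongrightarrow> ennreal ((norm (s i x - g x))\<^sup>2)"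
            by (intro tendsto_ennrealI tendsto_intros elim)
          then show ?case
            by (intro lim_imp_Liminf[symmetric]) simp_all
        qed
      qed
      also have "\<dots> \<le> liminf (\<lambda>k. \<integral>\<^sup>+x. ennreal ((norm (s i x - s (r k) x))\<^sup>2) \<partial>M)"
        by (rule nn_integral_liminf) auto
      also have "\<dots> \<le> limsup (\<lambda>k. \<integral>\<^sup>+x. ennreal ((norm (s i x - s (r k) x))\<^sup>2) \<partial>M)"
        by (rule Liminf_le_Limsup) simp
      also have "\<dots> \<le> ennreal (e\<^sup>2)"
      proof (rule Limsup_bounded)
        show "\<forall>\<^sub>F k in sequentially. (\<integral>\<^sup>+x. ennreal ((norm (s i x - s (r k) x))\<^sup>2) \<partial>M) \<le> ennreal (e\<^sup>2)"
          using eventually_ge_at_top[of N]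
        proof eventually_elim
          case (elim k)
          then have "r k \<ge> N"
            using seq_suble[OF r, of k] by linarith
          have "(\<integral>\<^sup>+x. ennreal ((norm (s i x - s (r k) x))\<^sup>2) \<partial>M) = ennreal ((l2norm M (\<lambda>x. s i x - s (r k) x))\<^sup>2)"
            using sd[of i "r k"] by (simp add: l2norm_power2 nn_integral_eq_integral sq_integrable_def)
          also have "\<dots> \<le> ennreal (e\<^sup>2)"
            using N[OF \<open>i \<ge> N\<close> \<open>r k \<ge> N\<close>] by (intro ennreal_leI power_mono) auto
          finally show ?case .
        qed
      qed
      finally have le: "(\<integral>\<^sup>+x. ennreal ((norm (s i x - g x))\<^sup>2) \<partial>M) \<le> ennreal (e\<^sup>2)" .
      have int: "integrable M (\<lambda>x. (norm (s i x - g x))\<^sup>2)"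
        by (rule integrableI_bounded)
          (use le in \<open>auto simp: le_less_trans\<close>)
      have "(l2norm M (\<lambda>x. s i x - g x))\<^sup>2 \<le> e\<^sup>2"
        using le nn_integral_eq_integral[OF int] by (simp add: l2norm_power2)
      then show ?thesis
        using int \<open>e > 0\<close> by (auto simp: sq_integrable_def dest: power2_le_imp_le)
    qed
    then show ?thesis by blast
  qed
  obtain i where "sq_integrable M (\<lambda>x. s i x - g x)"
    using key[of 1] by auto
  from sq_integrable_diff[OF s[of i] this] have "sq_integrable M g" by simp
  moreover have "(\<lambda>n. l2norm M (\<lambda>x. s n x - g x)) \<longlonglongrightarrow> 0"
  proof (rule LIMSEQ_I)
    fix e :: real assume "e > 0"
    then obtain N where "\<And>i. i \<ge> N \<Longrightarrow> l2norm M (\<lambda>x. s i x - g x) \<le> e / 2"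
      using key[of "e / 2"] by auto
    then show "\<exists>N. \<forall>n\<ge>N. norm (l2norm M (\<lambda>x. s n x - g x) - 0) < e"
      using \<open>e > 0\<close> by (intro exI[of _ N]) (force intro: le_less_trans)
  qed
  ultimately show ?thesis using that by blast
qed

text \<open>The negative part of f is at most |s n - f| wherever s n is nonnegative, so its norm is
  bounded by distances that tend to 0.\<close>

lemma AE_nonneg_l2_limit:
  fixes s :: "nat \<Rightarrow> 'a \<Rightarrow> real"
  assumes "\<And>n. sq_integrable M (s n)" "\<And>n. AE x in M. 0 \<le> s n x" and f: "sq_integrable M f"
    and lim: "(\<lambda>n. l2norm M (\<lambda>x. s n x - f x)) \<longlonglongrightarrow> 0"
  shows "AE x in M. 0 \<le> f x"
proof -
  define h where "h x = max (- f x) 0" for x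
  have h: "sq_integrable M h"
    by (rule sq_integrable_bound[OF f, where K = 1]) (use f in \<open>auto simp: h_def[abs_def] sq_integrable_def\<close>)
  have "l2norm M h \<le> l2norm M (\<lambda>x. s n x - f x)" for n
  proof -
    have sf: "sq_integrable M (\<lambda>x. s n x - f x)"
      by (intro sq_integrable_diff assms)
    have "(LINT x|M. (norm (h x))\<^sup>2) \<le> (LINT x|M. (norm (s n x - f x))\<^sup>2)"
    proof (rule integral_mono_AE)
      show "AE x in M. (norm (h x))\<^sup>2 \<le> (norm (s n x - f x))\<^sup>2"
        using assms(2)[of n] by eventually_elim (intro power_mono, auto simp: h_def)
    qed (use h sf in \<open>auto simp: sq_integrable_def\<close>)
    then show ?thesis by (simp add: l2norm_def)
  qed
  then have "l2norm M h \<le> 0"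
    using lim by (intro LIMSEQ_le_const) auto
  then have "l2norm M h = 0"
    by (simp add: antisym)
  from l2norm_eq_0_AE[OF h this] show ?thesis
    by eventually_elim (auto simp: h_def max_def split: if_splits)
qed

section \<open>Smooth bumps on boxes\<close>

text \<open>With x = 1 / t this says that exp outgrows polynomials; it is what makes every
  \<open>flat p\<close> differentiable at 0.\<close>

lemma poly_inverse_exp_tendsto_0:
  fixes p :: "real poly"
  shows "((\<lambda>t. poly p (1 / t) * exp (- 1 / t)) \<longlongrightarrow> 0) (at_right 0)"
proof -
  have "((\<lambda>x. poly p x * exp (- x)) \<longlongrightarrow> 0) at_top"
  proof -
    have "((\<lambda>x::real. \<Sum>i\<le>degree p. coeff p i * (x ^ i / exp x)) \<longlongrightarrow> (\<Sum>i\<le>degree p. coeff p i * 0)) at_top"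
      by (intro tendsto_sum tendsto_mult_left tendsto_power_div_exp_0)
    then show ?thesis
      by (simp add: poly_altdef sum_distrib_right sum_divide_distrib exp_minus field_simps)
  qed
  then have "((\<lambda>t. poly p (inverse t) * exp (- inverse t)) \<longlongrightarrow> 0) (at_right 0)"
    by (rule filterlim_compose) (rule filterlim_inverse_at_top_right)
  then show ?thesis
    by (simp add: inverse_eq_divide)
qed

text \<open>The classical exp (- 1 / t) extended by 0, times a polynomial in 1 / t. The polynomial
  factor makes the family closed under differentiation, so a single differentiability proof yields
  smoothness.\<close>

definition flat :: "real poly \<Rightarrow> real \<Rightarrow> real" where
  "flat p t = (if t > 0 then poly p (1 / t) * exp (- 1 / t) else 0)"

text \<open>With s = 1 / t, the derivative of p(s) exp(- s) in t is s^2 (p(s) - p'(s)) exp(- s),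
  which is the origin of the polynomial in the statement.\<close>

lemma flat_has_derivative:
  "(flat p has_real_derivative flat ([:0, 0, 1:] * (p - pderiv p)) t) (at t)"
proof -
  consider "t > 0" | "t = 0" | "t < 0" by linarith
  then show ?thesis
  proof cases
    case 1
    have "((\<lambda>t. poly p (1 / t) * exp (- 1 / t)) has_real_derivative
        flat ([:0, 0, 1:] * (p - pderiv p)) t) (at t)"
      using 1 by (auto simp: flat_def power2_eq_square field_simps intro!: derivative_eq_intros)
    then show ?thesis
      by (rule has_field_derivative_transform_within[where d = t]) (use 1 in \<open>auto simp: flat_def dist_real_def\<close>)
  next
    case 2
    \<comment> \<open>Dividing by t multiplies the polynomial by its variable 1 / t, so the
      difference quotient is again of the form with known limit.\<close>
    have right: "((\<lambda>h. flat p h / h) \<longlongrightarrow> 0) (at_right 0)"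
    proof (rule Lim_transform_eventually[OF poly_inverse_exp_tendsto_0[of "[:0, 1:] * p"]])
      show "\<forall>\<^sub>F t in at_right 0. poly ([:0, 1:] * p) (1 / t) * exp (- 1 / t) = flat p t / t"
        by (auto simp: eventually_at_filter flat_def)
    qed
    have left: "((\<lambda>h. flat p h / h) \<longlongrightarrow> 0) (at_left 0)"
      by (rule Lim_transform_eventually[OF tendsto_const[of 0]])
        (auto simp: eventually_at_filter flat_def)
    show ?thesis
      using filterlim_split_at[OF left right] 2 by (simp add: has_field_derivative_iff flat_def)
  next
    case 3
    have "((\<lambda>_. 0) has_real_derivative flat ([:0, 0, 1:] * (p - pderiv p)) t) (at t)"
      using 3 by (simp add: flat_def)
    then show ?thesis
      by (rule has_field_derivative_transform_within[where d = "- t"]) (use 3 in \<open>auto simp: flat_def dist_real_def\<close>)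
  qed
qed

text \<open>Closed under partial derivatives, hence a postfixed point for the coinductive \<open>smooth2\<close>.\<close>
inductive bump_algebra :: "(pt \<Rightarrow> real) \<Rightarrow> bool" where
  base: "bump_algebra (\<lambda>z. flat p (a * fst z + b * snd z + c))"
| const: "bump_algebra (\<lambda>z. c)"
| add: "bump_algebra f \<Longrightarrow> bump_algebra g \<Longrightarrow> bump_algebra (\<lambda>z. f z + g z)"
| mult: "bump_algebra f \<Longrightarrow> bump_algebra g \<Longrightarrow> bump_algebra (\<lambda>z. f z * g z)"

lemma bump_algebra_derivative:
  assumes "bump_algebra f"
  shows "\<exists>f1 f2. (\<forall>x. (f has_derivative (\<lambda>v. f1 x * fst v + f2 x * snd v)) (at x))
    \<and> bump_algebra f1 \<and> bump_algebra f2"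
  using assms
proof induction
  case (base p a b c)
  define q where "q = [:0, 0, 1:] * (p - pderiv p)"
  let ?l = "\<lambda>z::pt. a * fst z + b * snd z + c"
  have "((\<lambda>z. flat p (?l z)) has_derivative
      (\<lambda>v. (a * flat q (?l x)) * fst v + (b * flat q (?l x)) * snd v)) (at x)" for x
  proof -
    have "(?l has_derivative (\<lambda>v. a * fst v + b * snd v)) (at x)"
      by (auto intro!: derivative_eq_intros)
    from DERIV_compose_FDERIV[OF flat_has_derivative this]
    show ?thesis by (simp add: q_def algebra_simps)
  qed
  moreover have "bump_algebra (\<lambda>z. a * flat q (?l z))" "bump_algebra (\<lambda>z. b * flat q (?l z))"
    by (intro bump_algebra.intros)+
  ultimately show ?case
    by (intro exI[of _ "\<lambda>z. a * flat q (?l z)"] exI[of _ "\<lambda>z. b * flat q (?l z)"]) simp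
next
  case (const c)
  have "((\<lambda>z. c) has_derivative (\<lambda>v. 0 * fst v + 0 * snd v)) (at x)" for x :: pt
    by simp
  then show ?case
    using bump_algebra.const[of 0] by (intro exI[of _ "\<lambda>_. 0"]) simp
next
  case (add f g)
  then obtain f1 f2 g1 g2
    where d: "\<And>x. (f has_derivative (\<lambda>v. f1 x * fst v + f2 x * snd v)) (at x)"
      "\<And>x. (g has_derivative (\<lambda>v. g1 x * fst v + g2 x * snd v)) (at x)"
      and "bump_algebra f1" "bump_algebra f2" "bump_algebra g1" "bump_algebra g2"
    by blast
  then have "bump_algebra (\<lambda>z. f1 z + g1 z)" "bump_algebra (\<lambda>z. f2 z + g2 z)"
    by (auto intro: bump_algebra.intros)
  moreover have "((\<lambda>z. f z + g z) has_derivative (\<lambda>v. (f1 x + g1 x) * fst v + (f2 x + g2 x) * snd v)) (at x)" for x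
    using has_derivative_add[OF d] by (simp add: algebra_simps)
  ultimately show ?case
    by (intro exI[of _ "\<lambda>z. f1 z + g1 z"] exI[of _ "\<lambda>z. f2 z + g2 z"]) simp
next
  case (mult f g)
  then obtain f1 f2 g1 g2
    where d: "\<And>x. (f has_derivative (\<lambda>v. f1 x * fst v + f2 x * snd v)) (at x)"
      "\<And>x. (g has_derivative (\<lambda>v. g1 x * fst v + g2 x * snd v)) (at x)"
      and "bump_algebra f1" "bump_algebra f2" "bump_algebra g1" "bump_algebra g2"
    by blast
  then have "bump_algebra (\<lambda>z. f z * g1 z + f1 z * g z)" "bump_algebra (\<lambda>z. f z * g2 z + f2 z * g z)"
    using mult.hyps by (auto intro!: bump_algebra.intros)
  moreover have "((\<lambda>z. f z * g z) has_derivative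
      (\<lambda>v. (f x * g1 x + f1 x * g x) * fst v + (f x * g2 x + f2 x * g x) * snd v)) (at x)" for x
    using has_derivative_mult[OF d] by (simp add: algebra_simps)
  ultimately show ?case
    by (intro exI[of _ "\<lambda>z. f z * g1 z + f1 z * g z"] exI[of _ "\<lambda>z. f z * g2 z + f2 z * g z"]) simp
qed

lemma bump_algebra_smooth2: "bump_algebra f \<Longrightarrow> smooth2 f"
proof (coinduction arbitrary: f)
  case smooth2
  then show ?case
    using bump_algebra_derivative[of f] by blast
qed

text \<open>General test functions need not lie in \<open>bump_algebra\<close>, so this closure
  property has its own coinduction, with all combinations for the fixed coefficients a and b as
  invariant.\<close>

lemma smooth2_lincomb:
  "smooth2 f \<Longrightarrow> smooth2 g \<Longrightarrow> smooth2 (\<lambda>z. a * f z + b * g z)"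
proof (coinduction arbitrary: f g)
  case smooth2
  from \<open>smooth2 f\<close> obtain f1 f2 where f: "\<And>x. (f has_derivative (\<lambda>v. f1 x * fst v + f2 x * snd v)) (at x)"
    "smooth2 f1" "smooth2 f2"
    by (cases rule: smooth2.cases) blast
  from \<open>smooth2 g\<close> obtain g1 g2 where g: "\<And>x. (g has_derivative (\<lambda>v. g1 x * fst v + g2 x * snd v)) (at x)"
    "smooth2 g1" "smooth2 g2"
    by (cases rule: smooth2.cases) blast
  have "((\<lambda>z. a * f z + b * g z) has_derivative
      (\<lambda>v. (a * f1 x + b * g1 x) * fst v + (a * f2 x + b * g2 x) * snd v)) (at x)" for x
    using has_derivative_add[OF has_derivative_mult_right[OF f(1), of a x] has_derivative_mult_right[OF g(1), of b x]]
    by (simp add: algebra_simps)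
  moreover have "\<exists>f g. (\<lambda>z. a * f1 z + b * g1 z) = (\<lambda>z. a * f z + b * g z) \<and> smooth2 f \<and> smooth2 g"
    "\<exists>f g. (\<lambda>z. a * f2 z + b * g2 z) = (\<lambda>z. a * f z + b * g z) \<and> smooth2 f \<and> smooth2 g"
    using f(2,3) g(2,3) by blast+
  ultimately show ?case
    by (intro exI[of _ "\<lambda>z. a * f z + b * g z"] exI[of _ "\<lambda>z. a * f1 z + b * g1 z"]
        exI[of _ "\<lambda>z. a * f2 z + b * g2 z"]) simp
qed

text \<open>Replacing \<open>t\<close> by \<open>(n + 1) t\<close> raises \<open>exp (- 1 / t)\<close> to the power \<open>1 / (n + 1)\<close>, so the
  bumps below increase to the indicator of the box while staying smooth.\<close>
definition box_bump :: "nat \<Rightarrow> pt \<Rightarrow> pt \<Rightarrow> pt \<Rightarrow> real" where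
  "box_bump n a b z = flat 1 (real (Suc n) * (fst z - fst a)) * flat 1 (real (Suc n) * (fst b - fst z))
     * (flat 1 (real (Suc n) * (snd z - snd a)) * flat 1 (real (Suc n) * (snd b - snd z)))"

lemma flat_1_bounds: "0 \<le> flat 1 t" "flat 1 t \<le> 1"
  by (auto simp: flat_def)

lemma flat_1_eq_0_iff: "flat 1 t = 0 \<longleftrightarrow> t \<le> 0"
  by (auto simp: flat_def)

lemma flat_1_tendsto: "(\<lambda>n. flat 1 (real (Suc n) * t)) \<longlonglongrightarrow> indicator {0<..} t"
proof (cases "t > 0")
  case True
  have "(\<lambda>n. exp (- (1 / t) * (1 / Suc n))) \<longlonglongrightarrow> exp (- (1 / t) * 0)"
    by (intro tendsto_intros LIMSEQ_Suc[OF lim_1_over_n])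
  then show ?thesis
    using True by (simp add: flat_def mult.commute)
next
  case False
  then have "flat 1 (real (Suc n) * t) = 0" for n
    by (simp add: flat_1_eq_0_iff mult_nonneg_nonpos)
  then show ?thesis using False by simp
qed

lemma box_pt: "box a b = {z::pt. fst a < fst z \<and> fst z < fst b \<and> snd a < snd z \<and> snd z < snd b}"
  by (auto simp: box_def Basis_prod_def inner_prod_def)

lemma box_bump_eq_0_iff: "box_bump n a b z = 0 \<longleftrightarrow> z \<notin> box a b"
  by (auto simp: box_bump_def box_pt flat_1_eq_0_iff mult_le_0_iff)

lemma box_bump_bounds: "0 \<le> box_bump n a b z" "box_bump n a b z \<le> 1"
  unfolding box_bump_def by (intro mult_nonneg_nonneg mult_le_one flat_1_bounds)+

lemma box_bump_tendsto: "(\<lambda>n. box_bump n a b z) \<longlonglongrightarrow> indicator (box a b) z"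
proof -
  have "(\<lambda>n. box_bump n a b z) \<longlonglongrightarrow> indicator {0<..} (fst z - fst a) * indicator {0<..} (fst b - fst z)
      * (indicator {0<..} (snd z - snd a) * indicator {0<..} (snd b - snd z))"
    unfolding box_bump_def by (intro tendsto_mult flat_1_tendsto)
  then show ?thesis
    by (rule tendsto_eq_rhs) (auto simp: box_pt indicator_def)
qed

lemma smooth2_box_bump: "smooth2 (box_bump n a b)"
proof -
  let ?N = "real (Suc n)"
  \<comment> \<open>The vanishing and negative coefficients are spelled out so that each factor is
    literally an instance of the rule \<open>base\<close>.\<close>
  have "bump_algebra (\<lambda>z. flat 1 (?N * fst z + 0 * snd z + - (?N * fst a))
      * flat 1 ((- ?N) * fst z + 0 * snd z + ?N * fst b)
      * (flat 1 (0 * fst z + ?N * snd z + - (?N * snd a))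
        * flat 1 (0 * fst z + (- ?N) * snd z + ?N * snd b)))"
    by (intro bump_algebra.intros)
  also have "(\<lambda>z. flat 1 (?N * fst z + 0 * snd z + - (?N * fst a))
      * flat 1 ((- ?N) * fst z + 0 * snd z + ?N * fst b)
      * (flat 1 (0 * fst z + ?N * snd z + - (?N * snd a))
        * flat 1 (0 * fst z + (- ?N) * snd z + ?N * snd b))) = box_bump n a b"
    by (simp add: box_bump_def[abs_def] algebra_simps)
  finally show ?thesis
    by (rule bump_algebra_smooth2)
qed

text \<open>The closed box has to lie in \<Omega> because supports are closures, although the bump
  is nonzero exactly on the open box.\<close>

lemma test_fun_box_bump:
  assumes "cbox a b \<subseteq> \<Omega>" shows "test_fun \<Omega> (box_bump n a b)"
proof -
  have "{z. box_bump n a b z \<noteq> 0} \<subseteq> cbox a b"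
    using box_subset_cbox[of a b] by (auto simp: box_bump_eq_0_iff)
  then have *: "closure {z. box_bump n a b z \<noteq> 0} \<subseteq> cbox a b"
    by (intro closure_minimal) auto
  moreover have "compact (closure {z. box_bump n a b z \<noteq> 0})"
    using compact_cbox * by (meson bounded_cbox bounded_subset closed_closure compact_eq_bounded_closed)
  ultimately show ?thesis
    using assms smooth2_box_bump by (auto simp: test_fun_def)
qed

text \<open>Open boxes form an intersection-stable generator of the Borel sets, so Dynkin's lemma
  extends the vanishing of integrals to all Borel sets. The assumption on the total integral serves
  the complement step.\<close>

lemma integral_zero_boxes_imp_AE_0:
  fixes f :: "'a::euclidean_space \<Rightarrow> real"
  assumes f: "integrable lborel f" "(LINT x|lborel. f x) = 0"
    and box: "\<And>a b. (LINT x:box a b|lborel. f x) = 0"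
  shows "AE x in lborel. f x = 0"
proof (rule sigma_finite_measure.density_zero[OF sigma_finite_lborel f(1)])
  fix A :: "'a set" assume "A \<in> sets lborel"
  then have A: "A \<in> sigma_sets UNIV (range (\<lambda>(a, b). box a b))"
    by (simp add: borel_eq_box)
  have int: "integrable lborel (\<lambda>x. indicator B x *\<^sub>R f x)" if "B \<in> sets borel" for B
    using that by (intro integrable_mult_indicator f) simp
  have "Int_stable (range (\<lambda>(a, b). box a b :: 'a set))"
    by (auto simp: Int_stable_def box_Int_box)
  moreover have "range (\<lambda>(a, b). box a b :: 'a set) \<subseteq> Pow UNIV"
    by simp
  ultimately show "(LINT x:A|lborel. f x) = 0"
    using A
  proof (induction rule: sigma_sets_induct_disjoint)
    case (basic A)
    then show ?case using box by auto
  next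
    case empty
    then show ?case by (simp add: set_lebesgue_integral_def)
  next
    case (compl A)
    then have [measurable]: "A \<in> sets borel"
      by (simp add: borel_eq_box)
    have "(LINT x:UNIV - A|lborel. f x) = (LINT x|lborel. f x - indicator A x *\<^sub>R f x)"
      unfolding set_lebesgue_integral_def
      by (intro Bochner_Integration.integral_cong) (auto simp: indicator_def)
    also have "\<dots> = 0"
      using compl f int[of A] by (simp add: set_lebesgue_integral_def)
    finally show ?case .
  next
    case (union F)
    then have [measurable]: "\<And>i. F i \<in> sets borel"
      by (simp add: borel_eq_box subset_eq)
    have "(LINT x:(\<Union>i. F i)|lborel. f x) = (\<Sum>i. LINT x:F i|lborel. f x)"
      using union(1) int[of "\<Union>i. F i"] by (intro lebesgue_integral_countable_add)
        (auto simp: disjoint_family_on_def set_integrable_def)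
    then show ?case
      using union by simp
  qed
qed

section \<open>Test functions\<close>

text \<open>The difference quotients of f in direction v integrate to 0 because Lebesgue measure is
  translation invariant, and they converge to the derivative under a common integrable
  bound.\<close>

lemma integral_derivative_compact_support:
  fixes f :: "'a::euclidean_space \<Rightarrow> real"
  assumes D: "\<And>x. (f has_derivative f' x) (at x)" and cont: "continuous_on UNIV (\<lambda>x. f' x v)"
    and K: "compact K" "\<And>x. x \<notin> K \<Longrightarrow> f x = 0"
  shows "(LINT x|lborel. f' x v) = 0"
proof -
  have f_cont: "continuous_on UNIV f"
    using D has_derivative_continuous continuous_at_imp_continuous_on by blast
  have [measurable]: "f \<in> borel_measurable borel" "(\<lambda>x. f' x v) \<in> borel_measurable borel"
    using f_cont cont by (auto intro: borel_measurable_continuous_onI)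
  have D0: "f' x v = 0" if "x \<notin> K" for x
  proof -
    have "open (- K)"
      using K(1) by (simp add: compact_imp_closed open_Compl)
    have "((\<lambda>_. 0) has_derivative f' x) (at x)"
      by (rule has_derivative_transform_within_open[OF D \<open>open (- K)\<close>]) (use that K in auto)
    then have "f' x = (\<lambda>_. 0)"
      by (intro has_derivative_unique[OF _ has_derivative_const]) auto
    then show ?thesis by simp
  qed
  obtain B where B: "\<And>x. \<bar>f' x v\<bar> \<le> B"
  proof -
    have "bounded ((\<lambda>x. f' x v) ` K)"
      using K(1) cont by (intro compact_imp_bounded compact_continuous_image) (auto intro: continuous_on_subset)
    then obtain B where "\<And>x. x \<in> K \<Longrightarrow> \<bar>f' x v\<bar> \<le> B" "B > 0"
      by (auto simp: bounded_pos)
    then show ?thesis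
      using D0 that[of B] by (metis abs_zero less_imp_le)
  qed
  obtain R where R: "\<And>x. x \<in> K \<Longrightarrow> norm x \<le> R"
    using compact_imp_bounded[OF K(1)] by (auto simp: bounded_iff)
  have line: "((\<lambda>s. f (x + s *\<^sub>R v)) has_real_derivative f' (x + s *\<^sub>R v) v) (at s)" for x s
  proof -
    have "((\<lambda>s. x + s *\<^sub>R v) has_derivative (\<lambda>s. s *\<^sub>R v)) (at s)"
      by (auto intro!: derivative_eq_intros)
    from has_derivative_compose[OF this D]
    have "((\<lambda>s. f (x + s *\<^sub>R v)) has_derivative (\<lambda>t. f' (x + s *\<^sub>R v) (t *\<^sub>R v))) (at s)" .
    moreover have "f' (x + s *\<^sub>R v) (t *\<^sub>R v) = f' (x + s *\<^sub>R v) v * t" for t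
      using linear_cmul[OF has_derivative_linear[OF D]] by simp
    ultimately show ?thesis
      by (simp add: has_field_derivative_def)
  qed
  define h where "h n x = real (Suc n) * (f (x + (1 / real (Suc n)) *\<^sub>R v) - f x)" for n x
  \<comment> \<open>The mean value theorem bounds each quotient by B. The shift has length at most
    \<open>norm v\<close>, so outside the enlarged ball neither x nor the shifted point can lie in
    K.\<close>
  have h_bound: "\<bar>h n x\<bar> \<le> B * indicator (cball 0 (R + norm v)) x" for n x
  proof (cases "x \<in> cball 0 (R + norm v)")
    case True
    obtain s where "f (x + (1 / real (Suc n)) *\<^sub>R v) - f (x + 0 *\<^sub>R v) = (1 / real (Suc n) - 0) * f' (x + s *\<^sub>R v) v"
      using MVT2[of 0 "1 / real (Suc n)" "\<lambda>s. f (x + s *\<^sub>R v)"] line by force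
    then have "h n x = f' (x + s *\<^sub>R v) v"
      by (simp add: h_def)
    then show ?thesis
      using B True by simp
  next
    case False
    have "norm ((1 / real (Suc n)) *\<^sub>R v) \<le> 1 * norm v"
      unfolding norm_scaleR by (intro mult_right_mono) auto
    moreover have "norm x \<le> norm (x + (1 / real (Suc n)) *\<^sub>R v) + norm ((1 / real (Suc n)) *\<^sub>R v)"
      by (metis add_diff_cancel_right' norm_triangle_ineq4)
    moreover have "norm x > R + norm v"
      using False by auto
    ultimately have "norm (x + (1 / real (Suc n)) *\<^sub>R v) > R"
      by linarith
    moreover have "norm x > R"
      using \<open>norm x > R + norm v\<close> norm_ge_zero[of v] by linarith
    ultimately have "x \<notin> K" "x + (1 / real (Suc n)) *\<^sub>R v \<notin> K"
      using R by (auto simp: not_less[symmetric])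
    then show ?thesis
      using False K(2) by (simp add: h_def)
  qed
  have h_lim: "(\<lambda>n. h n x) \<longlonglongrightarrow> f' x v" for x
  proof -
    have "((\<lambda>s. (f (x + s *\<^sub>R v) - f x) / s) \<longlongrightarrow> f' x v) (at 0)"
      using line[of x 0] by (simp add: has_field_derivative_iff)
    moreover have "filterlim (\<lambda>n. 1 / real (Suc n)) (at 0) sequentially"
      by (intro filterlim_atI LIMSEQ_Suc[OF lim_1_over_n] always_eventually) simp
    ultimately have "(\<lambda>n. (f (x + (1 / real (Suc n)) *\<^sub>R v) - f x) / (1 / real (Suc n))) \<longlonglongrightarrow> f' x v"
      by (rule filterlim_compose)
    then show ?thesis
      by (simp add: h_def mult.commute)
  qed
  have f_int: "integrable lborel f"
  proof -
    have "integrable lborel (\<lambda>x. indicator K x *\<^sub>R f x)"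
      using f_cont by (intro borel_integrable_compact K) (auto intro: continuous_on_subset)
    also have "(\<lambda>x. indicator K x *\<^sub>R f x) = f"
      by (rule ext) (use K(2) in \<open>auto split: split_indicator\<close>)
    finally show ?thesis .
  qed
  have h_int: "(LINT x|lborel. h n x) = 0" for n
  proof -
    define c where "c = (1 / real (Suc n)) *\<^sub>R v"
    have "integrable (distr lborel borel ((+) c)) f"
      using f_int by (simp add: lborel_distr_plus)
    then have int: "integrable lborel (\<lambda>x. f (c + x))"
      by (subst (asm) integrable_distr_eq) auto
    have "(LINT x|distr lborel borel ((+) c). f x) = (LINT x|lborel. f (c + x))"
      by (intro integral_distr) auto
    then have "(LINT x|lborel. f (c + x)) = (LINT x|lborel. f x)"
      by (simp add: lborel_distr_plus)
    then have "(LINT x|lborel. real (Suc n) * (f (c + x) - f x)) = 0"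
      using int f_int by simp
    moreover have "h n x = real (Suc n) * (f (c + x) - f x)" for x
      unfolding h_def c_def by (subst add.commute) (rule refl)
    ultimately show ?thesis
      by (simp only:)
  qed
  have "(\<lambda>n. LINT x|lborel. h n x) \<longlonglongrightarrow> (LINT x|lborel. f' x v)"
  proof (rule integral_dominated_convergence)
    show "integrable lborel (\<lambda>x. B * indicator (cball 0 (R + norm v)) x)"
      using emeasure_bounded_finite[OF bounded_cball, of 0 "R + norm v"]
      by (intro integrable_mult_right integrable_real_indicator) auto
    show "(\<lambda>x. f' x v) \<in> borel_measurable lborel" "(\<lambda>x. h n x) \<in> borel_measurable lborel" for n
      unfolding h_def by measurable
    show "AE x in lborel. (\<lambda>n. h n x) \<longlonglongrightarrow> f' x v"
      by (rule AE_I2) (rule h_lim)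
    show "AE x in lborel. norm (h n x) \<le> B * indicator (cball 0 (R + norm v)) x" for n
      unfolding real_norm_def by (rule AE_I2) (rule h_bound)
  qed
  then show ?thesis
    by (simp add: h_int LIMSEQ_const_iff)
qed

lemma smooth2_pd:
  assumes "smooth2 \<phi>"
  shows "(\<phi> has_derivative (\<lambda>v. pd v \<phi> x)) (at x)" and "pd v \<phi> x = pd e1 \<phi> x * fst v + pd e2 \<phi> x * snd v"
    and "continuous_on S \<phi>" and "continuous_on S (pd v \<phi>)"
proof -
  obtain f1 f2 where f: "\<And>x. (\<phi> has_derivative (\<lambda>v. f1 x * fst v + f2 x * snd v)) (at x)" "smooth2 f1" "smooth2 f2"
    using assms by (cases rule: smooth2.cases) blast
  have pd_eq: "pd v \<phi> x = f1 x * fst v + f2 x * snd v" for v x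
    using frechet_derivative_at[OF f(1)[of x]] by (simp add: pd_def fun_eq_iff)
  show "(\<phi> has_derivative (\<lambda>v. pd v \<phi> x)) (at x)" "pd v \<phi> x = pd e1 \<phi> x * fst v + pd e2 \<phi> x * snd v"
    using f(1) by (simp_all add: pd_eq e1_def e2_def)
  have cont: "continuous_on S g" if "smooth2 g" for g
    using that
  proof (cases rule: smooth2.cases)
    case (1 g1 g2)
    then have "isCont g x" for x
      by (intro has_derivative_continuous) (rule spec)
    then show ?thesis
      by (intro continuous_at_imp_continuous_on ballI)
  qed
  show "continuous_on S \<phi>"
    by (rule cont[OF assms])
  show "continuous_on S (pd v \<phi>)"
    unfolding pd_eq[abs_def] by (intro continuous_intros cont f)
qed

text \<open>Packing the value and both partial derivatives into one vector turns the H^1 distance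
  into an L^2 distance; \<open>fst\<close> recovers the function and \<open>snd\<close> its
  gradient.\<close>

definition jet :: "(pt \<Rightarrow> real) \<Rightarrow> pt \<Rightarrow> real \<times> real \<times> real" where
  "jet \<phi> x = (\<phi> x, pd e1 \<phi> x, pd e2 \<phi> x)"

lemma test_fun_smooth2: "test_fun \<Omega> \<phi> \<Longrightarrow> smooth2 \<phi>"
  by (simp add: test_fun_def)

lemma test_funE:
  assumes "test_fun \<Omega> \<phi>"
  obtains K where "compact K" "K \<subseteq> \<Omega>" "\<And>x. x \<notin> K \<Longrightarrow> \<phi> x = 0" "\<And>x v. x \<notin> K \<Longrightarrow> pd v \<phi> x = 0"
proof
  let ?K = "closure {x. \<phi> x \<noteq> 0}"
  show "compact ?K" "?K \<subseteq> \<Omega>"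
    using assms by (simp_all add: test_fun_def)
  show \<phi>: "\<phi> x = 0" if "x \<notin> ?K" for x
    using that closure_subset[of "{x. \<phi> x \<noteq> 0}"] by auto
  show "pd v \<phi> x = 0" if "x \<notin> ?K" for x v
  proof -
    have "(\<phi> has_derivative (\<lambda>v. pd v \<phi> x)) (at x)"
      by (rule smooth2_pd(1)[OF test_fun_smooth2[OF assms]])
    moreover have "open (- ?K)" "x \<in> - ?K"
      using that by (simp_all only: open_Compl closed_closure Compl_iff not_False_eq_True)
    ultimately have "((\<lambda>_. 0) has_derivative (\<lambda>v. pd v \<phi> x)) (at x)"
      by (rule has_derivative_transform_within_open) (rule \<phi>, simp)
    then have "(\<lambda>v. pd v \<phi> x) = (\<lambda>_. 0)"
      by (rule has_derivative_unique[OF _ has_derivative_const])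
    then show ?thesis by (rule fun_cong)
  qed
qed

lemma pd_lincomb:
  assumes "smooth2 \<phi>" "smooth2 \<psi>"
  shows "pd v (\<lambda>x. a * \<phi> x + b * \<psi> x) x = a * pd v \<phi> x + b * pd v \<psi> x"
proof -
  have "((\<lambda>x. a * \<phi> x + b * \<psi> x) has_derivative (\<lambda>v. a * pd v \<phi> x + b * pd v \<psi> x)) (at x)"
    by (rule has_derivative_add[OF has_derivative_mult_right[OF smooth2_pd(1)[OF assms(1)]]
          has_derivative_mult_right[OF smooth2_pd(1)[OF assms(2)]]])
  from fun_cong[OF frechet_derivative_at[OF this], of v] show ?thesis
    by (simp add: pd_def)
qed

lemma jet_lincomb:
  assumes "smooth2 \<phi>" "smooth2 \<psi>"
  shows "jet (\<lambda>x. a * \<phi> x + b * \<psi> x) x = a *\<^sub>R jet \<phi> x + b *\<^sub>R jet \<psi> x"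
  using pd_lincomb[OF assms] by (simp add: jet_def)

lemma test_fun_lincomb:
  assumes "test_fun \<Omega> \<phi>" "test_fun \<Omega> \<psi>"
  shows "test_fun \<Omega> (\<lambda>x. a * \<phi> x + b * \<psi> x)"
proof -
  let ?K = "closure {x. \<phi> x \<noteq> 0} \<union> closure {x. \<psi> x \<noteq> 0}"
  have K: "compact ?K" "?K \<subseteq> \<Omega>"
    using assms by (auto simp: test_fun_def)
  have "{x. a * \<phi> x + b * \<psi> x \<noteq> 0} \<subseteq> {x. \<phi> x \<noteq> 0} \<union> {x. \<psi> x \<noteq> 0}"
    by auto
  also have "\<dots> \<subseteq> ?K"
    by (intro Un_mono closure_subset)
  finally have "{x. a * \<phi> x + b * \<psi> x \<noteq> 0} \<subseteq> ?K" .
  then have *: "closure {x. a * \<phi> x + b * \<psi> x \<noteq> 0} \<subseteq> ?K"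
    using K(1) by (intro closure_minimal) (auto simp: compact_imp_closed)
  then have "compact (closure {x. a * \<phi> x + b * \<psi> x \<noteq> 0})"
    using K(1) by (meson bounded_subset closed_closure compact_eq_bounded_closed)
  moreover have "smooth2 (\<lambda>x. a * \<phi> x + b * \<psi> x)"
    using assms by (intro smooth2_lincomb test_fun_smooth2)
  ultimately show ?thesis
    using order_trans[OF * K(2)] by (simp only: test_fun_def simp_thms)
qed

section \<open>Integrals of test functions over \<Omega>\<close>

lemma integral_lebesgue_on_eq_lborel:
  fixes f :: "'a::euclidean_space \<Rightarrow> real"
  assumes "f \<in> borel_measurable borel" "S \<in> sets lebesgue" "\<And>x. x \<notin> S \<Longrightarrow> f x = 0"
  shows "(LINT x|lebesgue_on S. f x) = (LINT x|lborel. f x)"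
proof -
  have "(LINT x|lebesgue_on S. f x) = (LINT x|lebesgue. indicator S x *\<^sub>R f x)"
    using assms(2) by (intro integral_restrict_space) auto
  also have "(\<lambda>x. indicator S x *\<^sub>R f x) = f"
    by (rule ext) (use assms(3) in \<open>auto split: split_indicator\<close>)
  finally show ?thesis
    using assms(1) by (simp add: integral_completion)
qed

lemma finite_measure_lebesgue_on: "open S \<Longrightarrow> bounded S \<Longrightarrow> finite_measure (lebesgue_on S)"
  for S :: "'a::euclidean_space set"
  using emeasure_bounded_finite[of S]
  by (intro finite_measureI) (simp add: emeasure_restrict_space less_top)

lemma sq_integrable_bounded_continuous:
  fixes f :: "'a::euclidean_space \<Rightarrow> 'b::euclidean_space"
  assumes "open S" "bounded S" "continuous_on S f" "\<And>x. x \<in> S \<Longrightarrow> norm (f x) \<le> B"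
  shows "sq_integrable (lebesgue_on S) f"
proof (rule sq_integrable_bound)
  show "f \<in> borel_measurable (lebesgue_on S)"
    using assms by (intro continuous_imp_measurable_on_sets_lebesgue) auto
  show "sq_integrable (lebesgue_on S) (\<lambda>_. 1::real)"
    using finite_measure_lebesgue_on[OF assms(1,2)] by (rule sq_integrable_const)
  show "norm (f x) \<le> B * norm (1::real)" if "x \<in> space (lebesgue_on S)" for x
    using assms(4) that by simp
qed

lemma sq_integrable_jet:
  assumes "open \<Omega>" "bounded \<Omega>" "test_fun \<Omega> \<phi>"
  shows "sq_integrable (lebesgue_on \<Omega>) (jet \<phi>)"
proof -
  obtain K where K: "compact K" "\<And>x. x \<notin> K \<Longrightarrow> \<phi> x = 0" "\<And>x v. x \<notin> K \<Longrightarrow> pd v \<phi> x = 0"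
    using test_funE[OF assms(3)] by metis
  have cont: "continuous_on S (jet \<phi>)" for S
    unfolding jet_def[abs_def] by (intro continuous_on_Pair smooth2_pd(3,4) test_fun_smooth2[OF assms(3)])
  obtain B where "\<And>x. x \<in> K \<Longrightarrow> norm (jet \<phi> x) \<le> B" "B > 0"
    using compact_imp_bounded[OF compact_continuous_image[OF cont K(1)]] by (auto simp: bounded_pos)
  then have "norm (jet \<phi> x) \<le> B" for x
    by (cases "x \<in> K") (use K in \<open>auto simp: jet_def\<close>)
  then show ?thesis
    using sq_integrable_bounded_continuous[OF assms(1,2) cont] by blast
qed

text \<open>The product of the two functions has compact support in \<Omega>, so its derivative
  integrates to 0. Thus classical derivatives of test functions are weak derivatives, from which
  those of limits are obtained.\<close>

lemma test_fun_integration_by_parts: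
  assumes "open \<Omega>" "test_fun \<Omega> \<phi>" "test_fun \<Omega> \<psi>"
    and int: "integrable (lebesgue_on \<Omega>) (\<lambda>x. \<phi> x * pd v \<psi> x)" "integrable (lebesgue_on \<Omega>) (\<lambda>x. pd v \<phi> x * \<psi> x)"
  shows "(LINT x|lebesgue_on \<Omega>. \<phi> x * pd v \<psi> x) = - (LINT x|lebesgue_on \<Omega>. pd v \<phi> x * \<psi> x)"
proof -
  obtain K where K: "compact K" "K \<subseteq> \<Omega>" "\<And>x. x \<notin> K \<Longrightarrow> \<phi> x = 0" "\<And>x v. x \<notin> K \<Longrightarrow> pd v \<phi> x = 0"
    using test_funE[OF assms(2)] by metis
  have s: "smooth2 \<phi>" "smooth2 \<psi>"
    using assms by (auto dest: test_fun_smooth2)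
  have cont: "continuous_on UNIV (\<lambda>x. \<phi> x * pd v \<psi> x + pd v \<phi> x * \<psi> x)"
    by (intro continuous_on_add continuous_on_mult smooth2_pd(3,4) s)
  have "((\<lambda>x. \<phi> x * \<psi> x) has_derivative (\<lambda>v. \<phi> x * pd v \<psi> x + pd v \<phi> x * \<psi> x)) (at x)" for x
    by (rule has_derivative_mult[OF smooth2_pd(1)[OF s(1)] smooth2_pd(1)[OF s(2)]])
  from integral_derivative_compact_support[OF this cont K(1)]
  have "(LINT x|lborel. \<phi> x * pd v \<psi> x + pd v \<phi> x * \<psi> x) = 0"
    using K(3) by simp
  also have "(LINT x|lborel. \<phi> x * pd v \<psi> x + pd v \<phi> x * \<psi> x)
      = (LINT x|lebesgue_on \<Omega>. \<phi> x * pd v \<psi> x + pd v \<phi> x * \<psi> x)"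
  proof (rule integral_lebesgue_on_eq_lborel[symmetric])
    show "\<phi> x * pd v \<psi> x + pd v \<phi> x * \<psi> x = 0" if "x \<notin> \<Omega>" for x
    proof -
      have "x \<notin> K" using that K(2) by blast
      then show ?thesis using K(3,4) by simp
    qed
  qed (use cont assms(1) in \<open>auto intro: borel_measurable_continuous_onI\<close>)
  finally show ?thesis
    using int by simp
qed

text \<open>Integrating the derivative of \<open>x\<^sub>1 \<phi>\<^sup>2\<close> avoids one-dimensional slices.\<close>
lemma test_fun_Poincare:
  assumes "open \<Omega>" "bounded \<Omega>" "test_fun \<Omega> \<phi>" and R: "\<And>x. x \<in> \<Omega> \<Longrightarrow> norm x \<le> R"
  shows "(LINT x|lebesgue_on \<Omega>. (\<phi> x)\<^sup>2) \<le> 4 * R\<^sup>2 * (LINT x|lebesgue_on \<Omega>. (pd e1 \<phi> x)\<^sup>2)"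
proof -
  obtain K where K: "compact K" "K \<subseteq> \<Omega>" "\<And>x. x \<notin> K \<Longrightarrow> \<phi> x = 0" "\<And>x v. x \<notin> K \<Longrightarrow> pd v \<phi> x = 0"
    using test_funE[OF assms(3)] by metis
  have s: "smooth2 \<phi>"
    using assms by (auto dest: test_fun_smooth2)
  let ?d = "\<lambda>x. (\<phi> x)\<^sup>2 + 2 * fst x * \<phi> x * pd e1 \<phi> x"
  have cont: "continuous_on UNIV ?d"
    by (intro continuous_intros smooth2_pd(3,4)[OF s])
  have jet: "sq_integrable (lebesgue_on \<Omega>) (jet \<phi>)"
    by (rule sq_integrable_jet[OF assms(1-3)])
  have [measurable]: "\<phi> \<in> borel_measurable (lebesgue_on \<Omega>)" "pd e1 \<phi> \<in> borel_measurable (lebesgue_on \<Omega>)"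
    "(\<lambda>x. fst x :: real) \<in> borel_measurable (lebesgue_on \<Omega>)"
    using assms(1)
    by (auto intro!: continuous_imp_measurable_on_sets_lebesgue continuous_on_fst continuous_on_id
        smooth2_pd(3,4)[OF s])
  have sq: "sq_integrable (lebesgue_on \<Omega>) \<phi>" "sq_integrable (lebesgue_on \<Omega>) (pd e1 \<phi>)"
    by (rule sq_integrable_bound[OF jet, where K = 1],
        auto simp: jet_def norm_Pair real_le_rsqrt intro!: real_le_rsqrt)+
  have sqx: "sq_integrable (lebesgue_on \<Omega>) (\<lambda>x. 2 * fst x * \<phi> x)"
  proof (rule sq_integrable_bound[OF sq(1), where K = "2 * R"])
    show "norm (2 * fst x * \<phi> x) \<le> 2 * R * norm (\<phi> x)" if "x \<in> space (lebesgue_on \<Omega>)" for x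
      using R[of x] norm_fst_le[of "fst x" "snd x"] that by (auto simp: abs_mult intro!: mult_right_mono)
  qed measurable
  have int: "integrable (lebesgue_on \<Omega>) (\<lambda>x. (\<phi> x)\<^sup>2)" "integrable (lebesgue_on \<Omega>) (\<lambda>x. (pd e1 \<phi> x)\<^sup>2)"
    "integrable (lebesgue_on \<Omega>) (\<lambda>x. 2 * fst x * \<phi> x * pd e1 \<phi> x)"
    using sq sq_integrable_inner[OF sqx sq(2)] by (auto simp: sq_integrable_def)
  have "(LINT x|lborel. ?d x) = (LINT x|lborel. fst x * (\<phi> x * pd e1 \<phi> x + pd e1 \<phi> x * \<phi> x) + fst e1 * (\<phi> x * \<phi> x))"
    by (intro Bochner_Integration.integral_cong) (auto simp: e1_def power2_eq_square algebra_simps)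
  also have "\<dots> = 0"
  proof (rule integral_derivative_compact_support[where f = "\<lambda>x. fst x * (\<phi> x * \<phi> x)" and K = K
        and f' = "\<lambda>x v. fst x * (\<phi> x * pd v \<phi> x + pd v \<phi> x * \<phi> x) + fst v * (\<phi> x * \<phi> x)"])
    show "((\<lambda>x. fst x * (\<phi> x * \<phi> x)) has_derivative
        (\<lambda>v. fst x * (\<phi> x * pd v \<phi> x + pd v \<phi> x * \<phi> x) + fst v * (\<phi> x * \<phi> x))) (at x)" for x
      by (intro has_derivative_mult has_derivative_fst has_derivative_ident smooth2_pd(1)[OF s])
    show "continuous_on UNIV (\<lambda>x. fst x * (\<phi> x * pd e1 \<phi> x + pd e1 \<phi> x * \<phi> x) + fst e1 * (\<phi> x * \<phi> x))"
      by (intro continuous_intros smooth2_pd(3,4)[OF s])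
  qed (use K in auto)
  also have "(LINT x|lborel. ?d x) = (LINT x|lebesgue_on \<Omega>. ?d x)"
  proof (rule integral_lebesgue_on_eq_lborel[symmetric])
    show "?d x = 0" if "x \<notin> \<Omega>" for x
    proof -
      have "x \<notin> K" using that K(2) by blast
      then show ?thesis by (simp add: K)
    qed
  qed (use cont assms(1) in \<open>auto intro: borel_measurable_continuous_onI\<close>)
  finally have "(LINT x|lebesgue_on \<Omega>. ?d x) = 0" .
  then have "(LINT x|lebesgue_on \<Omega>. (\<phi> x)\<^sup>2) = (LINT x|lebesgue_on \<Omega>. - (2 * fst x * \<phi> x * pd e1 \<phi> x))"
    using int by simp
  \<comment> \<open>Young's inequality, read off from the square of \<phi> + 2 x_1 D_1 \<phi>. Half
    of the left side is absorbed at the end, which doubles 2 R^2 to 4 R^2.\<close>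
  also have "\<dots> \<le> (LINT x|lebesgue_on \<Omega>. (\<phi> x)\<^sup>2 / 2 + 2 * R\<^sup>2 * (pd e1 \<phi> x)\<^sup>2)"
  proof (intro integral_mono)
    fix x assume "x \<in> space (lebesgue_on \<Omega>)"
    then have "\<bar>fst x\<bar> \<le> R"
      using R[of x] norm_fst_le[of "fst x" "snd x"] by simp
    then have "(fst x)\<^sup>2 \<le> R\<^sup>2"
      by (metis abs_ge_zero power2_abs power_mono)
    then have "(fst x)\<^sup>2 * (pd e1 \<phi> x)\<^sup>2 \<le> R\<^sup>2 * (pd e1 \<phi> x)\<^sup>2"
      by (intro mult_right_mono) auto
    moreover have "0 \<le> (\<phi> x + 2 * (fst x * pd e1 \<phi> x))\<^sup>2"
      by simp
    ultimately show "- (2 * fst x * \<phi> x * pd e1 \<phi> x) \<le> (\<phi> x)\<^sup>2 / 2 + 2 * R\<^sup>2 * (pd e1 \<phi> x)\<^sup>2"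
      by (simp add: power2_sum power_mult_distrib mult_ac)
  qed (use int in auto)
  also have "\<dots> = (LINT x|lebesgue_on \<Omega>. (\<phi> x)\<^sup>2) / 2 + 2 * R\<^sup>2 * (LINT x|lebesgue_on \<Omega>. (pd e1 \<phi> x)\<^sup>2)"
    using int by simp
  finally show ?thesis by simp
qed

text \<open>The fundamental lemma of the calculus of variations. Bumps converge to indicators of
  boxes, so g has zero integral over every box whose closed version lies in \<Omega>; this forces g
  = 0 almost everywhere in each such box, and countably many of them cover \<Omega>.\<close>

lemma AE_0_if_orthogonal_test_funs:
  assumes \<Omega>: "open \<Omega>" "bounded \<Omega>" and g: "sq_integrable (lebesgue_on \<Omega>) g"
    and orth: "\<And>\<phi>. test_fun \<Omega> \<phi> \<Longrightarrow> (LINT x|lebesgue_on \<Omega>. g x * \<phi> x) = 0"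
  shows "AE x in lebesgue_on \<Omega>. g x = (0::real)"
proof -
  have g_int: "integrable (lebesgue_on \<Omega>) g"
    by (intro sq_integrable_integrable finite_measure_lebesgue_on \<Omega> g)
  have zero: "(LINT x|lebesgue_on \<Omega>. g x * indicator (box a b) x) = 0" if "cbox a b \<subseteq> \<Omega>" for a b
  proof -
    have "(\<lambda>n. LINT x|lebesgue_on \<Omega>. g x * box_bump n a b x) \<longlonglongrightarrow> (LINT x|lebesgue_on \<Omega>. g x * indicator (box a b) x)"
    proof (rule integral_dominated_convergence[where w = "\<lambda>x. norm (g x)"])
      show "(\<lambda>x. g x * box_bump n a b x) \<in> borel_measurable (lebesgue_on \<Omega>)" for n
        using g \<Omega>(1)
        by (intro borel_measurable_times sq_integrable_measurable
            continuous_imp_measurable_on_sets_lebesgue smooth2_pd(3)[OF smooth2_box_bump]) simp_all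
      show "AE x in lebesgue_on \<Omega>. norm (g x * box_bump n a b x) \<le> norm (g x)" for n
        using box_bump_bounds[of n a b] by (auto simp: abs_mult intro!: mult_left_le)
      show "AE x in lebesgue_on \<Omega>. (\<lambda>n. g x * box_bump n a b x) \<longlonglongrightarrow> g x * indicator (box a b) x"
        by (intro AE_I2 tendsto_mult tendsto_const box_bump_tendsto)
      show "(\<lambda>x. g x * indicator (box a b) x) \<in> borel_measurable (lebesgue_on \<Omega>)"
        using \<Omega>(1) by (intro borel_measurable_times sq_integrable_measurable[OF g]
            measurable_restrict_space1[of "indicator (box a b)"] borel_measurable_indicator) simp
    qed (use g_int in auto)
    moreover have "(LINT x|lebesgue_on \<Omega>. g x * box_bump n a b x) = 0" for n
      by (intro orth test_fun_box_bump that)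
    ultimately show ?thesis
      by (simp add: LIMSEQ_const_iff)
  qed
  have lg: "integrable lebesgue (\<lambda>x. indicator \<Omega> x *\<^sub>R g x)"
    using g_int \<Omega>(1) by (subst (asm) integrable_restrict_space) auto
  \<comment> \<open>A Borel representative of g extended by 0: the statement on boxes concerns
    \<open>lborel\<close>, while g is only Lebesgue measurable.\<close>
  obtain g' where g': "g' \<in> borel_measurable lborel" "AE x in lborel. indicator \<Omega> x *\<^sub>R g x = g' x"
    using completion_ex_borel_measurable_real[OF borel_measurable_integrable[OF lg]] by blast
  note g'_meas [measurable] = g'(1)
  have lg_meas: "(\<lambda>x. indicator \<Omega> x *\<^sub>R g x) \<in> borel_measurable lebesgue"
    using lg by auto
  have AE': "AE x in lebesgue. indicator \<Omega> x *\<^sub>R g x = g' x"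
    using g'(2) by (rule AE_completion)
  have "integrable lebesgue g'"
    using integrable_cong_AE[OF lg_meas _ AE'] lg g'(1) measurable_completion by blast
  then have g'_int: "integrable lborel g'"
    by (simp add: integrable_completion)
  have zero': "(LINT x:box a b|lborel. g' x) = 0" if "cbox a b \<subseteq> \<Omega>" for a b
  proof -
    have "(LINT x:box a b|lborel. g' x) = (LINT x|lebesgue. indicator (box a b) x *\<^sub>R g' x)"
      unfolding set_lebesgue_integral_def by (intro integral_completion[symmetric]) measurable
    also have "\<dots> = (LINT x|lebesgue. indicator (box a b) x *\<^sub>R (indicator \<Omega> x *\<^sub>R g x))"
    proof (rule integral_cong_AE)
      show "(\<lambda>x. indicator (box a b) x *\<^sub>R g' x) \<in> borel_measurable lebesgue"
        by (intro measurable_completion) measurable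
      show "(\<lambda>x. indicator (box a b) x *\<^sub>R (indicator \<Omega> x *\<^sub>R g x)) \<in> borel_measurable lebesgue"
        by (rule borel_measurable_scaleR[OF _ lg_meas]) (simp add: borel_measurable_indicator)
      show "AE x in lebesgue. indicator (box a b) x *\<^sub>R g' x = indicator (box a b) x *\<^sub>R (indicator \<Omega> x *\<^sub>R g x)"
        using AE' by eventually_elim simp
    qed
    also have "\<dots> = (LINT x|lebesgue. indicator \<Omega> x *\<^sub>R (g x * indicator (box a b) x))"
      by (simp add: mult_ac)
    also have "\<dots> = (LINT x|lebesgue_on \<Omega>. g x * indicator (box a b) x)"
      using \<Omega>(1) by (intro integral_restrict_space[symmetric]) auto
    finally show ?thesis
      using zero[OF that] by simp
  qed
  \<comment> \<open>After cutting g' off to one box, its integral over any second box is an integral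
    over the intersection. That is again a box, and its closed version stays in the first one, hence
    in \<Omega>.\<close>
  have AE_box: "AE x in lborel. x \<in> box a b \<longrightarrow> g' x = 0" if sub: "cbox a b \<subseteq> \<Omega>" for a b
  proof -
    have "AE x in lborel. indicator (box a b) x *\<^sub>R g' x = 0"
    proof (rule integral_zero_boxes_imp_AE_0)
      show "integrable lborel (\<lambda>x. indicator (box a b) x *\<^sub>R g' x)"
        by (intro integrable_mult_indicator g'_int) auto
      show "(LINT x|lborel. indicator (box a b) x *\<^sub>R g' x) = 0"
        using zero'[OF sub] by (simp add: set_lebesgue_integral_def)
      show "(LINT x:box c d|lborel. indicator (box a b) x *\<^sub>R g' x) = 0" for c d
      proof -
        obtain p q where pq: "box c d \<inter> box a b = box p q" "cbox p q \<subseteq> cbox a b"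
        proof (cases "box c d \<inter> box a b = {}")
          case True
          have "cbox (1, 1) (0, 0) = ({} :: pt set)"
            by (simp add: cbox_Pair_eq)
          moreover from this have "box (1, 1) (0, 0) = ({} :: pt set)"
            using box_subset_cbox by blast
          ultimately show ?thesis
            using True that[of "(1, 1)" "(0, 0)"] by simp
        next
          case False
          define p q where "p = (\<Sum>i\<in>Basis. max (c \<bullet> i) (a \<bullet> i) *\<^sub>R i)" and "q = (\<Sum>i\<in>Basis. min (d \<bullet> i) (b \<bullet> i) *\<^sub>R i)"
          have "box c d \<inter> box a b = box p q"
            by (simp add: box_Int_box p_def q_def)
          moreover have "cbox p q \<subseteq> cbox a b"
            by (auto simp: p_def q_def mem_box)
          ultimately show ?thesis using that by blast
        qed
        have "(LINT x:box c d|lborel. indicator (box a b) x *\<^sub>R g' x) = (LINT x:box p q|lborel. g' x)"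
          unfolding set_lebesgue_integral_def pq(1)[symmetric]
          by (simp add: indicator_inter_arith mult_ac)
        then show ?thesis
          using zero'[of p q] pq(2) sub by auto
      qed
    qed
    then show ?thesis
      by eventually_elim auto
  qed
  have "AE x in lborel. x \<in> \<Omega> \<longrightarrow> g' x = 0"
  proof -
    \<comment> \<open>Rational corners keep the family countable, so that the exceptional null sets
      of all its boxes form one null set.\<close>
    define I where "I = {(a, b) \<in> (\<rat> \<times> \<rat>) \<times> (\<rat> \<times> \<rat>). cbox a b \<subseteq> \<Omega>}"
    have "countable I"
      unfolding I_def
      by (rule countable_subset[of _ "(\<rat> \<times> \<rat>) \<times> (\<rat> \<times> \<rat>)"]) (auto simp: countable_rat)
    have cover: "\<exists>(a, b) \<in> I. x \<in> box a b" if "x \<in> \<Omega>" for x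
    proof -
      obtain e where e: "e > 0" "cball x e \<subseteq> \<Omega>"
        using \<open>x \<in> \<Omega>\<close> \<Omega>(1) open_contains_cball by blast
      obtain a b where ab: "x \<in> box a b" "\<forall>i\<in>Basis. a \<bullet> i \<in> \<rat> \<and> b \<bullet> i \<in> \<rat>" "box a b \<subseteq> ball x e"
        using rational_boxes[OF e(1), of x] by blast
      have "cbox a b = closure (box a b)"
        using ab(1) by (intro closure_box[symmetric]) auto
      also have "\<dots> \<subseteq> cball x e"
        using ab(3) ball_subset_cball by (intro closure_minimal) auto
      finally have "(a, b) \<in> I"
        using ab(2) e(2) by (cases a; cases b) (auto simp: I_def Basis_prod_def)
      then show ?thesis using ab(1) by blast
    qed
    have "AE x in lborel. \<forall>(a, b)\<in>I. x \<in> box a b \<longrightarrow> g' x = 0"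
      using \<open>countable I\<close> by (subst AE_ball_countable) (auto simp: I_def intro!: AE_box)
    then show ?thesis
      by eventually_elim (use cover in fast)
  qed
  then have "AE x in lebesgue. x \<in> \<Omega> \<longrightarrow> g' x = 0"
    by (rule AE_completion)
  with AE' have "AE x in lebesgue. x \<in> \<Omega> \<longrightarrow> g x = 0"
    by eventually_elim auto
  then show ?thesis
    using \<Omega>(1) by (subst AE_restrict_space_iff) auto
qed

text \<open>Serves to identify the function picked by \<open>wpd\<close> with any explicitly known
  weak derivative, up to a null set.\<close>

lemma weak_deriv_unique:
  assumes \<Omega>: "open \<Omega>" "bounded \<Omega>" and L2: "L2 \<Omega> w" "L2 \<Omega> w'"
    and weak: "weak_deriv \<Omega> v u w" "weak_deriv \<Omega> v u w'"
  shows "AE x in lebesgue_on \<Omega>. w x = w' x"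
proof -
  have sq: "sq_integrable (lebesgue_on \<Omega>) w" "sq_integrable (lebesgue_on \<Omega>) w'"
    using L2 by (simp_all add: L2_def sq_integrable_def)
  have "AE x in lebesgue_on \<Omega>. w x - w' x = 0"
  proof (rule AE_0_if_orthogonal_test_funs[OF \<Omega> sq_integrable_diff[OF sq]])
    fix \<phi> assume \<phi>: "test_fun \<Omega> \<phi>"
    have "sq_integrable (lebesgue_on \<Omega>) \<phi>"
      by (rule sq_integrable_bound[OF sq_integrable_jet[OF \<Omega> \<phi>], where K = 1])
        (use \<Omega>(1) smooth2_pd(3)[OF test_fun_smooth2[OF \<phi>]] in \<open>auto simp: jet_def norm_Pair
          intro!: real_le_rsqrt continuous_imp_measurable_on_sets_lebesgue\<close>)
    then show "(LINT x|lebesgue_on \<Omega>. (w x - w' x) * \<phi> x) = 0"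
      using weak \<phi> sq_integrable_inner[OF sq(1)] sq_integrable_inner[OF sq(2)]
      by (simp add: weak_deriv_def left_diff_distrib)
  qed
  then show ?thesis by simp
qed

section \<open>Jets of Sobolev functions\<close>

lemma sq_integrable_fst:
  assumes U: "sq_integrable M U"
  shows "sq_integrable M (\<lambda>x. fst (U x))" and "l2norm M (\<lambda>x. fst (U x)) \<le> l2norm M U"
proof -
  have le: "norm (fst (U x)) \<le> 1 * norm (U x)" for x
    using norm_fst_le[of "fst (U x)" "snd (U x)"] by simp
  have meas: "(\<lambda>x. fst (U x)) \<in> borel_measurable M"
    by (rule borel_measurable_continuous_on[OF continuous_on_fst[OF continuous_on_id] sq_integrable_measurable[OF U]])
  show "sq_integrable M (\<lambda>x. fst (U x))"
    by (rule sq_integrable_bound(1)[OF U meas le])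
  have "l2norm M (\<lambda>x. fst (U x)) \<le> 1 * l2norm M U"
    by (rule sq_integrable_bound(2)[OF U meas le zero_le_one])
  then show "l2norm M (\<lambda>x. fst (U x)) \<le> l2norm M U" by simp
qed

lemma sq_integrable_snd:
  assumes U: "sq_integrable M U"
  shows "sq_integrable M (\<lambda>x. snd (U x))" and "l2norm M (\<lambda>x. snd (U x)) \<le> l2norm M U"
proof -
  have le: "norm (snd (U x)) \<le> 1 * norm (U x)" for x
    using norm_snd_le[of "snd (U x)" "fst (U x)"] by simp
  have meas: "(\<lambda>x. snd (U x)) \<in> borel_measurable M"
    by (rule borel_measurable_continuous_on[OF continuous_on_snd[OF continuous_on_id] sq_integrable_measurable[OF U]])
  show "sq_integrable M (\<lambda>x. snd (U x))"
    by (rule sq_integrable_bound(1)[OF U meas le])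
  have "l2norm M (\<lambda>x. snd (U x)) \<le> 1 * l2norm M U"
    by (rule sq_integrable_bound(2)[OF U meas le zero_le_one])
  then show "l2norm M (\<lambda>x. snd (U x)) \<le> l2norm M U" by simp
qed

lemma sq_integrable_Pair:
  assumes f: "sq_integrable M f" and g: "sq_integrable M g"
  shows "sq_integrable M (\<lambda>x. (f x, g x))"
    and "(l2norm M (\<lambda>x. (f x, g x)))\<^sup>2 = (l2norm M f)\<^sup>2 + (l2norm M g)\<^sup>2"
proof -
  have eq: "(norm (f x, g x))\<^sup>2 = (norm (f x))\<^sup>2 + (norm (g x))\<^sup>2" for x
    by (simp add: norm_Pair)
  have int: "integrable M (\<lambda>x. (norm (f x))\<^sup>2)" "integrable M (\<lambda>x. (norm (g x))\<^sup>2)"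
    using f g by (simp_all add: sq_integrable_def)
  have "(\<lambda>x. (f x, g x)) \<in> borel_measurable M"
    by (rule borel_measurable_Pair[OF sq_integrable_measurable[OF f] sq_integrable_measurable[OF g]])
  then show "sq_integrable M (\<lambda>x. (f x, g x))"
    unfolding sq_integrable_def eq using int by (intro conjI Bochner_Integration.integrable_add)
  show "(l2norm M (\<lambda>x. (f x, g x)))\<^sup>2 = (l2norm M f)\<^sup>2 + (l2norm M g)\<^sup>2"
    unfolding l2norm_power2 eq by (rule Bochner_Integration.integral_add[OF int])
qed

lemma l2norm_fst_tendsto_0:
  assumes "\<And>n. sq_integrable M (U n)" "sq_integrable M V" "(\<lambda>n. l2norm M (\<lambda>x. U n x - V x)) \<longlonglongrightarrow> 0"
  shows "(\<lambda>n. l2norm M (\<lambda>x. fst (U n x) - fst (V x))) \<longlonglongrightarrow> 0"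
  by (rule Lim_null_comparison[OF _ assms(3)])
    (use sq_integrable_fst(2)[OF sq_integrable_diff[OF assms(1,2)]] in simp)

lemma l2norm_snd_tendsto_0:
  assumes "\<And>n. sq_integrable M (U n)" "sq_integrable M V" "(\<lambda>n. l2norm M (\<lambda>x. U n x - V x)) \<longlonglongrightarrow> 0"
  shows "(\<lambda>n. l2norm M (\<lambda>x. snd (U n x) - snd (V x))) \<longlonglongrightarrow> 0"
  by (rule Lim_null_comparison[OF _ assms(3)])
    (use sq_integrable_snd(2)[OF sq_integrable_diff[OF assms(1,2)]] in simp)

lemma L2_iff_sq_integrable: "L2 \<Omega> u \<longleftrightarrow> sq_integrable (lebesgue_on \<Omega>) u"
  by (simp add: L2_def sq_integrable_def)

definition wjet :: "pt set \<Rightarrow> (pt \<Rightarrow> real) \<Rightarrow> pt \<Rightarrow> real \<times> real \<times> real" where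
  "wjet \<Omega> u x = (u x, wpd \<Omega> e1 u x, wpd \<Omega> e2 u x)"

text \<open>The jets \<open>(u, D\<^sub>1 u, D\<^sub>2 u)\<close> of \<open>H\<^sup>1\<^sub>0\<close> functions, as a closed subspace of \<open>L\<^sup>2\<close>: unlike
  \<open>H10\<close>, membership does not involve the choice operator behind \<open>wpd\<close>.\<close>
definition jet_closure :: "pt set \<Rightarrow> (pt \<Rightarrow> real \<times> real \<times> real) set" where
  "jet_closure \<Omega> = {U. sq_integrable (lebesgue_on \<Omega>) U \<and>
    (\<exists>\<phi>. (\<forall>n. test_fun \<Omega> (\<phi> n)) \<and> (\<lambda>n. l2norm (lebesgue_on \<Omega>) (\<lambda>x. jet (\<phi> n) x - U x)) \<longlonglongrightarrow> 0)}"

lemma jet_closure_sq_integrable: "U \<in> jet_closure \<Omega> \<Longrightarrow> sq_integrable (lebesgue_on \<Omega>) U"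
  by (simp add: jet_closure_def)

lemma H10_integrand_eq:
  "(\<phi> x - u x)\<^sup>2 + (pd e1 \<phi> x - wpd \<Omega> e1 u x)\<^sup>2 + (pd e2 \<phi> x - wpd \<Omega> e2 u x)\<^sup>2
    = (norm (jet \<phi> x - wjet \<Omega> u x))\<^sup>2"
  by (simp add: jet_def wjet_def norm_Pair)

text \<open>Turns the approximation clause of \<open>H10\<close>, which is phrased with squared
  distances, into L^2 convergence of jets.\<close>

lemma H10_limit_iff:
  "((\<lambda>n. (LINT x|lebesgue_on \<Omega>. (\<phi> n x - u x)\<^sup>2 + (pd e1 (\<phi> n) x - wpd \<Omega> e1 u x)\<^sup>2
      + (pd e2 (\<phi> n) x - wpd \<Omega> e2 u x)\<^sup>2)) \<longlonglongrightarrow> 0)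
    \<longleftrightarrow> (\<lambda>n. l2norm (lebesgue_on \<Omega>) (\<lambda>x. jet (\<phi> n) x - wjet \<Omega> u x)) \<longlonglongrightarrow> 0"
proof -
  let ?l = "\<lambda>n. l2norm (lebesgue_on \<Omega>) (\<lambda>x. jet (\<phi> n) x - wjet \<Omega> u x)"
  have "(\<lambda>n. (?l n)\<^sup>2) \<longlonglongrightarrow> 0 \<longleftrightarrow> ?l \<longlonglongrightarrow> 0"
  proof
    assume "(\<lambda>n. (?l n)\<^sup>2) \<longlonglongrightarrow> 0"
    then have "(\<lambda>n. sqrt ((?l n)\<^sup>2)) \<longlonglongrightarrow> sqrt 0"
      by (intro tendsto_real_sqrt)
    then show "?l \<longlonglongrightarrow> 0" by simp
  next
    assume "?l \<longlonglongrightarrow> 0"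
    then have "(\<lambda>n. (?l n)\<^sup>2) \<longlonglongrightarrow> 0\<^sup>2"
      by (intro tendsto_power)
    then show "(\<lambda>n. (?l n)\<^sup>2) \<longlonglongrightarrow> 0" by simp
  qed
  then show ?thesis
    by (simp only: H10_integrand_eq l2norm_power2)
qed

lemma wpd_L2_weak_deriv:
  assumes "L2 \<Omega> w" "weak_deriv \<Omega> v u w"
  shows "L2 \<Omega> (wpd \<Omega> v u)" "weak_deriv \<Omega> v u (wpd \<Omega> v u)"
proof -
  have "L2 \<Omega> (wpd \<Omega> v u) \<and> weak_deriv \<Omega> v u (wpd \<Omega> v u)"
    unfolding wpd_def using assms by (intro someI[of "\<lambda>w. L2 \<Omega> w \<and> weak_deriv \<Omega> v u w" w]) simp
  then show "L2 \<Omega> (wpd \<Omega> v u)" "weak_deriv \<Omega> v u (wpd \<Omega> v u)"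
    by simp_all
qed

lemma H1_wjet_sq_integrable:
  assumes "H1 \<Omega> u" shows "sq_integrable (lebesgue_on \<Omega>) (wjet \<Omega> u)"
proof -
  obtain w1 w2 where "L2 \<Omega> u" "L2 \<Omega> w1" "L2 \<Omega> w2" "weak_deriv \<Omega> e1 u w1" "weak_deriv \<Omega> e2 u w2"
    using assms by (auto simp: H1_def)
  then show ?thesis
    unfolding wjet_def[abs_def] using wpd_L2_weak_deriv(1)
    by (intro sq_integrable_Pair) (auto simp: L2_iff_sq_integrable[symmetric])
qed

lemma H10_wjet: "H10 \<Omega> u \<Longrightarrow> wjet \<Omega> u \<in> jet_closure \<Omega>"
  unfolding H10_def H10_limit_iff jet_closure_def using H1_wjet_sq_integrable by blast

section \<open>The space of jets: linearity, closedness, weak derivatives, Poincare\<close>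

context
  fixes \<Omega> :: "pt set"
  assumes \<Omega>: "open \<Omega>" "bounded \<Omega>"
begin

lemmas sq_jet = sq_integrable_jet[OF \<Omega>]

lemma jet_closure_lincomb:
  assumes U: "U \<in> jet_closure \<Omega>" and V: "V \<in> jet_closure \<Omega>"
  shows "(\<lambda>x. a *\<^sub>R U x + b *\<^sub>R V x) \<in> jet_closure \<Omega>"
proof -
  let ?l = "l2norm (lebesgue_on \<Omega>)"
  have sq: "sq_integrable (lebesgue_on \<Omega>) U" "sq_integrable (lebesgue_on \<Omega>) V"
    using U V by (simp_all add: jet_closure_sq_integrable)
  obtain \<phi> where \<phi>: "\<And>n. test_fun \<Omega> (\<phi> n)" "(\<lambda>n. ?l (\<lambda>x. jet (\<phi> n) x - U x)) \<longlonglongrightarrow> 0"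
    using U unfolding jet_closure_def by blast
  obtain \<psi> where \<psi>: "\<And>n. test_fun \<Omega> (\<psi> n)" "(\<lambda>n. ?l (\<lambda>x. jet (\<psi> n) x - V x)) \<longlonglongrightarrow> 0"
    using V unfolding jet_closure_def by blast
  define \<xi> where "\<xi> n x = a * \<phi> n x + b * \<psi> n x" for n x
  have jet: "jet (\<xi> n) x = a *\<^sub>R jet (\<phi> n) x + b *\<^sub>R jet (\<psi> n) x" for n x
    unfolding \<xi>_def[abs_def] by (intro jet_lincomb test_fun_smooth2[OF \<phi>(1)] test_fun_smooth2[OF \<psi>(1)])
  have "test_fun \<Omega> (\<xi> n)" for n
    unfolding \<xi>_def[abs_def] by (intro test_fun_lincomb \<phi> \<psi>)
  moreover have "(\<lambda>n. ?l (\<lambda>x. jet (\<xi> n) x - (a *\<^sub>R U x + b *\<^sub>R V x))) \<longlonglongrightarrow> 0"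
  proof (rule Lim_null_comparison)
    have "?l (\<lambda>x. jet (\<xi> n) x - (a *\<^sub>R U x + b *\<^sub>R V x))
        \<le> \<bar>a\<bar> * ?l (\<lambda>x. jet (\<phi> n) x - U x) + \<bar>b\<bar> * ?l (\<lambda>x. jet (\<psi> n) x - V x)" for n
    proof -
      have "(\<lambda>x. jet (\<xi> n) x - (a *\<^sub>R U x + b *\<^sub>R V x))
          = (\<lambda>x. a *\<^sub>R (jet (\<phi> n) x - U x) + b *\<^sub>R (jet (\<psi> n) x - V x))"
        by (simp add: jet algebra_simps)
      then show ?thesis
        unfolding l2norm_scaleR[symmetric]
        by (simp only:) (intro l2norm_triangle sq_integrable_scaleR sq_integrable_diff sq sq_jet \<phi> \<psi>)
    qed
    then show "\<forall>\<^sub>F n in sequentially. norm (?l (\<lambda>x. jet (\<xi> n) x - (a *\<^sub>R U x + b *\<^sub>R V x)))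
        \<le> \<bar>a\<bar> * ?l (\<lambda>x. jet (\<phi> n) x - U x) + \<bar>b\<bar> * ?l (\<lambda>x. jet (\<psi> n) x - V x)"
      by simp
    show "(\<lambda>n. \<bar>a\<bar> * ?l (\<lambda>x. jet (\<phi> n) x - U x) + \<bar>b\<bar> * ?l (\<lambda>x. jet (\<psi> n) x - V x)) \<longlonglongrightarrow> 0"
      by (intro tendsto_add_zero tendsto_mult_right_zero \<phi> \<psi>)
  qed
  moreover have "sq_integrable (lebesgue_on \<Omega>) (\<lambda>x. a *\<^sub>R U x + b *\<^sub>R V x)"
    by (intro sq_integrable_add sq_integrable_scaleR sq)
  ultimately show ?thesis
    unfolding jet_closure_def by blast
qed

text \<open>Diagonal choice: test functions whose jets are within 1 / (n + 1) of U n approximate the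
  limit as well.\<close>

lemma jet_closure_closed:
  assumes U: "\<And>n. U n \<in> jet_closure \<Omega>" and V: "sq_integrable (lebesgue_on \<Omega>) V"
    and lim: "(\<lambda>n. l2norm (lebesgue_on \<Omega>) (\<lambda>x. U n x - V x)) \<longlonglongrightarrow> 0"
  shows "V \<in> jet_closure \<Omega>"
proof -
  let ?l = "l2norm (lebesgue_on \<Omega>)"
  have "\<exists>\<phi>. test_fun \<Omega> \<phi> \<and> ?l (\<lambda>x. jet \<phi> x - U n x) < 1 / real (Suc n)" for n
  proof -
    obtain \<phi> where \<phi>: "\<And>k. test_fun \<Omega> (\<phi> k)" "(\<lambda>k. ?l (\<lambda>x. jet (\<phi> k) x - U n x)) \<longlonglongrightarrow> 0"
      using U[of n] unfolding jet_closure_def by blast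
    have "\<forall>\<^sub>F k in sequentially. ?l (\<lambda>x. jet (\<phi> k) x - U n x) < 1 / real (Suc n)"
      using \<phi>(2) by (rule order_tendstoD) simp
    then obtain k where "?l (\<lambda>x. jet (\<phi> k) x - U n x) < 1 / real (Suc n)"
      using eventually_happens'[OF sequentially_bot] by blast
    then show ?thesis using \<phi>(1) by blast
  qed
  then obtain \<phi> where \<phi>: "\<And>n. test_fun \<Omega> (\<phi> n)" "\<And>n. ?l (\<lambda>x. jet (\<phi> n) x - U n x) < 1 / real (Suc n)"
    by metis
  have "(\<lambda>n. ?l (\<lambda>x. jet (\<phi> n) x - V x)) \<longlonglongrightarrow> 0"
  proof (rule Lim_null_comparison)
    have "?l (\<lambda>x. jet (\<phi> n) x - V x) \<le> 1 / real (Suc n) + ?l (\<lambda>x. U n x - V x)" for n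
      using l2norm_triangle_diff[OF sq_jet[OF \<phi>(1)] jet_closure_sq_integrable[OF U] V, of n n] \<phi>(2)[of n]
      by linarith
    then show "\<forall>\<^sub>F n in sequentially. norm (?l (\<lambda>x. jet (\<phi> n) x - V x)) \<le> 1 / real (Suc n) + ?l (\<lambda>x. U n x - V x)"
      by simp
    show "(\<lambda>n. 1 / real (Suc n) + ?l (\<lambda>x. U n x - V x)) \<longlonglongrightarrow> 0"
      by (intro tendsto_add_zero lim LIMSEQ_Suc[OF lim_1_over_n])
  qed
  then show ?thesis
    unfolding jet_closure_def using V \<phi>(1) by blast
qed

text \<open>Integration by parts survives the limit because each side pairs an L^2 convergent
  sequence with a fixed square-integrable function.\<close>

lemma weak_deriv_limit:
  assumes \<phi>: "\<And>n. test_fun \<Omega> (\<phi> n)"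
    and sq: "\<And>n. sq_integrable (lebesgue_on \<Omega>) (\<phi> n)" "\<And>n. sq_integrable (lebesgue_on \<Omega>) (pd v (\<phi> n))"
      "\<And>\<psi>. test_fun \<Omega> \<psi> \<Longrightarrow> sq_integrable (lebesgue_on \<Omega>) (pd v \<psi>)"
      "sq_integrable (lebesgue_on \<Omega>) u" "sq_integrable (lebesgue_on \<Omega>) w"
    and lim: "(\<lambda>n. l2norm (lebesgue_on \<Omega>) (\<lambda>x. \<phi> n x - u x)) \<longlonglongrightarrow> 0"
      "(\<lambda>n. l2norm (lebesgue_on \<Omega>) (\<lambda>x. pd v (\<phi> n) x - w x)) \<longlonglongrightarrow> 0"
  shows "weak_deriv \<Omega> v u w"
  unfolding weak_deriv_def
proof (intro allI impI)
  fix \<psi> assume \<psi>: "test_fun \<Omega> \<psi>"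
  have \<psi>_sq: "sq_integrable (lebesgue_on \<Omega>) \<psi>" "sq_integrable (lebesgue_on \<Omega>) (pd v \<psi>)"
    using sq_integrable_fst(1)[OF sq_jet[OF \<psi>]] sq(3)[OF \<psi>] by (simp_all add: jet_def)
  have "(\<lambda>n. LINT x|lebesgue_on \<Omega>. \<phi> n x * pd v \<psi> x) \<longlonglongrightarrow> (LINT x|lebesgue_on \<Omega>. u x * pd v \<psi> x)"
    using tendsto_l2_inner[OF sq(1) sq(4) lim(1) \<psi>_sq(2)] by simp
  moreover have "(LINT x|lebesgue_on \<Omega>. \<phi> n x * pd v \<psi> x) = - (LINT x|lebesgue_on \<Omega>. pd v (\<phi> n) x * \<psi> x)" for n
    using sq_integrable_inner[OF sq(1) \<psi>_sq(2)] sq_integrable_inner[OF sq(2) \<psi>_sq(1)]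
    by (intro test_fun_integration_by_parts \<Omega> \<phi> \<psi>) simp_all
  moreover have "(\<lambda>n. - (LINT x|lebesgue_on \<Omega>. pd v (\<phi> n) x * \<psi> x)) \<longlonglongrightarrow> - (LINT x|lebesgue_on \<Omega>. w x * \<psi> x)"
    using tendsto_l2_inner[OF sq(2) sq(5) lim(2) \<psi>_sq(1)] by (intro tendsto_minus) simp
  ultimately show "(LINT x|lebesgue_on \<Omega>. u x * pd v \<psi> x) = - (LINT x|lebesgue_on \<Omega>. w x * \<psi> x)"
    by (simp add: LIMSEQ_unique)
qed

lemma jet_closure_weak_deriv:
  assumes U: "U \<in> jet_closure \<Omega>"
  shows "weak_deriv \<Omega> e1 (\<lambda>x. fst (U x)) (\<lambda>x. fst (snd (U x)))"
    and "weak_deriv \<Omega> e2 (\<lambda>x. fst (U x)) (\<lambda>x. snd (snd (U x)))"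
proof -
  let ?M = "lebesgue_on \<Omega>"
  have sqU: "sq_integrable ?M U"
    by (rule jet_closure_sq_integrable[OF U])
  obtain \<phi> where \<phi>: "\<And>n. test_fun \<Omega> (\<phi> n)" "(\<lambda>n. l2norm ?M (\<lambda>x. jet (\<phi> n) x - U x)) \<longlonglongrightarrow> 0"
    using U unfolding jet_closure_def by blast
  note sqU' = sq_integrable_snd(1)[OF sqU]
  have sqj: "sq_integrable ?M (jet (\<phi> n))" for n
    by (rule sq_jet[OF \<phi>(1)])
  note sqj' = sq_integrable_snd(1)[OF sqj]
  have sq: "sq_integrable ?M \<psi>" "sq_integrable ?M (pd e1 \<psi>)" "sq_integrable ?M (pd e2 \<psi>)"
    if "test_fun \<Omega> \<psi>" for \<psi>
    using sq_integrable_fst(1)[OF sq_jet[OF that]] sq_integrable_fst(1)[OF sq_integrable_snd(1)[OF sq_jet[OF that]]]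
      sq_integrable_snd(1)[OF sq_integrable_snd(1)[OF sq_jet[OF that]]] by (simp_all add: jet_def)
  note lim = l2norm_snd_tendsto_0[OF sqj sqU \<phi>(2)]
  have lim0: "(\<lambda>n. l2norm ?M (\<lambda>x. \<phi> n x - fst (U x))) \<longlonglongrightarrow> 0"
    using l2norm_fst_tendsto_0[OF sqj sqU \<phi>(2)] by (simp add: jet_def)
  have lim1: "(\<lambda>n. l2norm ?M (\<lambda>x. pd e1 (\<phi> n) x - fst (snd (U x)))) \<longlonglongrightarrow> 0"
    using l2norm_fst_tendsto_0[OF sqj' sqU' lim] by (simp add: jet_def)
  have lim2: "(\<lambda>n. l2norm ?M (\<lambda>x. pd e2 (\<phi> n) x - snd (snd (U x)))) \<longlonglongrightarrow> 0"
    using l2norm_snd_tendsto_0[OF sqj' sqU' lim] by (simp add: jet_def)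
  show "weak_deriv \<Omega> e1 (\<lambda>x. fst (U x)) (\<lambda>x. fst (snd (U x)))"
    by (rule weak_deriv_limit[OF \<phi>(1) sq(1)[OF \<phi>(1)] sq(2)[OF \<phi>(1)] sq(2) sq_integrable_fst(1)[OF sqU]
          sq_integrable_fst(1)[OF sqU'] lim0 lim1])
  show "weak_deriv \<Omega> e2 (\<lambda>x. fst (U x)) (\<lambda>x. snd (snd (U x)))"
    by (rule weak_deriv_limit[OF \<phi>(1) sq(1)[OF \<phi>(1)] sq(3)[OF \<phi>(1)] sq(3) sq_integrable_fst(1)[OF sqU]
          sq_integrable_snd(1)[OF sqU'] lim0 lim2])
qed

text \<open>Converse of \<open>H10_wjet\<close>: a limit of jets is, up to a null set, the jet of
  its own first component. Limits of the derivatives are weak derivatives, and by uniqueness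
  \<open>wpd\<close> must agree with them.\<close>

lemma jet_closure_H10:
  assumes U: "U \<in> jet_closure \<Omega>"
  shows "H10 \<Omega> (\<lambda>x. fst (U x))" and "AE x in lebesgue_on \<Omega>. wjet \<Omega> (\<lambda>x. fst (U x)) x = U x"
proof -
  let ?M = "lebesgue_on \<Omega>" and ?u = "\<lambda>x. fst (U x)"
  have sqU: "sq_integrable ?M U"
    by (rule jet_closure_sq_integrable[OF U])
  note L2 = sq_integrable_fst(1)[OF sqU, folded L2_iff_sq_integrable]
    sq_integrable_fst(1)[OF sq_integrable_snd(1)[OF sqU], folded L2_iff_sq_integrable]
    sq_integrable_snd(1)[OF sq_integrable_snd(1)[OF sqU], folded L2_iff_sq_integrable]
  note weak = jet_closure_weak_deriv[OF U]
  have H1: "H1 \<Omega> ?u"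
    unfolding H1_def using L2 weak by blast
  have "AE x in ?M. wpd \<Omega> e1 ?u x = fst (snd (U x))"
    by (rule weak_deriv_unique[OF \<Omega> wpd_L2_weak_deriv(1)[OF L2(2) weak(1)] L2(2)
          wpd_L2_weak_deriv(2)[OF L2(2) weak(1)] weak(1)])
  moreover have "AE x in ?M. wpd \<Omega> e2 ?u x = snd (snd (U x))"
    by (rule weak_deriv_unique[OF \<Omega> wpd_L2_weak_deriv(1)[OF L2(3) weak(2)] L2(3)
          wpd_L2_weak_deriv(2)[OF L2(3) weak(2)] weak(2)])
  ultimately show AE: "AE x in ?M. wjet \<Omega> ?u x = U x"
    by eventually_elim (simp add: wjet_def prod_eq_iff)
  obtain \<phi> where \<phi>: "\<And>n. test_fun \<Omega> (\<phi> n)" "(\<lambda>n. l2norm ?M (\<lambda>x. jet (\<phi> n) x - U x)) \<longlonglongrightarrow> 0"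
    using U unfolding jet_closure_def by blast
  have "l2norm ?M (\<lambda>x. jet (\<phi> n) x - U x) = l2norm ?M (\<lambda>x. jet (\<phi> n) x - wjet \<Omega> ?u x)" for n
  proof (rule l2norm_cong_AE)
    show "(\<lambda>x. jet (\<phi> n) x - U x) \<in> borel_measurable ?M"
      "(\<lambda>x. jet (\<phi> n) x - wjet \<Omega> ?u x) \<in> borel_measurable ?M"
      by (intro sq_integrable_measurable sq_integrable_diff sq_jet \<phi> sqU H1_wjet_sq_integrable[OF H1])+
    show "AE x in ?M. jet (\<phi> n) x - U x = jet (\<phi> n) x - wjet \<Omega> ?u x"
      using AE by eventually_elim simp
  qed
  then have "(\<lambda>n. l2norm ?M (\<lambda>x. jet (\<phi> n) x - wjet \<Omega> ?u x)) \<longlonglongrightarrow> 0"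
    using \<phi>(2) by simp
  then show "H10 \<Omega> ?u"
    unfolding H10_def H10_limit_iff using H1 \<phi>(1) by blast
qed

lemma jet_closure_Poincare:
  assumes U: "U \<in> jet_closure \<Omega>" and R: "\<And>x. x \<in> \<Omega> \<Longrightarrow> norm x \<le> R" "0 \<le> R"
  shows "l2norm (lebesgue_on \<Omega>) (\<lambda>x. fst (U x)) \<le> 2 * R * l2norm (lebesgue_on \<Omega>) (\<lambda>x. snd (U x))"
proof -
  let ?M = "lebesgue_on \<Omega>"
  let ?l = "l2norm ?M"
  have sqU: "sq_integrable ?M U"
    by (rule jet_closure_sq_integrable[OF U])
  obtain \<phi> where \<phi>: "\<And>n. test_fun \<Omega> (\<phi> n)" "(\<lambda>n. ?l (\<lambda>x. jet (\<phi> n) x - U x)) \<longlonglongrightarrow> 0"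
    using U unfolding jet_closure_def by blast
  have sqj: "sq_integrable ?M (jet (\<phi> n))" for n
    by (rule sq_jet[OF \<phi>(1)])
  note sqU1 = sq_integrable_fst(1)[OF sqU] and sqU2 = sq_integrable_snd(1)[OF sqU]
    and sqj1 = sq_integrable_fst(1)[OF sqj] and sqj2 = sq_integrable_snd(1)[OF sqj]
  have le: "?l (\<lambda>x. fst (jet (\<phi> n) x)) \<le> 2 * R * ?l (\<lambda>x. snd (jet (\<phi> n) x))" for n
  proof -
    have "(?l (\<lambda>x. fst (jet (\<phi> n) x)))\<^sup>2 \<le> (2 * R)\<^sup>2 * (?l (\<lambda>x. fst (snd (jet (\<phi> n) x))))\<^sup>2"
      using test_fun_Poincare[OF \<Omega> \<phi>(1) R(1)] by (simp add: l2norm_power2 jet_def power_mult_distrib)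
    also have "\<dots> \<le> (2 * R)\<^sup>2 * (?l (\<lambda>x. snd (jet (\<phi> n) x)))\<^sup>2"
      by (intro mult_left_mono power_mono sq_integrable_fst(2) sqj2) auto
    finally have "(?l (\<lambda>x. fst (jet (\<phi> n) x)))\<^sup>2 \<le> (2 * R * ?l (\<lambda>x. snd (jet (\<phi> n) x)))\<^sup>2"
      by (simp only: power_mult_distrib)
    then show ?thesis
      by (rule power2_le_imp_le) (use R(2) in simp)
  qed
  \<comment> \<open>Replacing U by a test function costs the distance once for the values and 2 R
    times for the gradients.\<close>
  have bound: "?l (\<lambda>x. fst (U x)) \<le> (1 + 2 * R) * ?l (\<lambda>x. jet (\<phi> n) x - U x) + 2 * R * ?l (\<lambda>x. snd (U x))" for n
  proof -
    let ?e = "?l (\<lambda>x. jet (\<phi> n) x - U x)"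
    have "?l (\<lambda>x. fst (U x)) \<le> ?l (\<lambda>x. fst (jet (\<phi> n) x)) + ?l (\<lambda>x. fst (U x) - fst (jet (\<phi> n) x))"
      using l2norm_triangle[OF sqj1[of n] sq_integrable_diff[OF sqU1 sqj1[of n]]] by simp
    moreover have "?l (\<lambda>x. fst (U x) - fst (jet (\<phi> n) x)) \<le> ?e"
      using sq_integrable_fst(2)[OF sq_integrable_diff[OF sqj sqU], of n]
      by (subst l2norm_minus_commute) simp
    moreover have "?l (\<lambda>x. snd (jet (\<phi> n) x)) \<le> ?l (\<lambda>x. snd (U x)) + ?l (\<lambda>x. snd (jet (\<phi> n) x) - snd (U x))"
      using l2norm_triangle[OF sqU2 sq_integrable_diff[OF sqj2[of n] sqU2]] by simp
    moreover have "?l (\<lambda>x. snd (jet (\<phi> n) x) - snd (U x)) \<le> ?e"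
      using sq_integrable_snd(2)[OF sq_integrable_diff[OF sqj sqU], of n] by simp
    ultimately have "?l (\<lambda>x. fst (U x)) \<le> 2 * R * ?l (\<lambda>x. snd (jet (\<phi> n) x)) + ?e"
      "?l (\<lambda>x. snd (jet (\<phi> n) x)) \<le> ?l (\<lambda>x. snd (U x)) + ?e"
      using le[of n] by linarith+
    moreover have "2 * R * ?l (\<lambda>x. snd (jet (\<phi> n) x)) \<le> 2 * R * (?l (\<lambda>x. snd (U x)) + ?e)"
      using calculation(2) R(2) by (intro mult_left_mono) auto
    ultimately show ?thesis
      by (simp add: algebra_simps)
  qed
  have "(\<lambda>n. (1 + 2 * R) * ?l (\<lambda>x. jet (\<phi> n) x - U x) + 2 * R * ?l (\<lambda>x. snd (U x)))
      \<longlonglongrightarrow> (1 + 2 * R) * 0 + 2 * R * ?l (\<lambda>x. snd (U x))"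
    by (intro tendsto_intros \<phi>)
  then have "?l (\<lambda>x. fst (U x)) \<le> (1 + 2 * R) * 0 + 2 * R * ?l (\<lambda>x. snd (U x))"
    by (rule LIMSEQ_le_const) (use bound in blast)
  then show ?thesis by simp
qed

end

section \<open>The variational inequality\<close>

text \<open>A minimizing sequence of the energy is Cauchy by the parallelogram identity, and the
  first variation at its limit is the variational inequality.\<close>
lemma convex_variational_inequality:
  fixes C W :: "('a \<Rightarrow> 'b::euclidean_space) set"
  assumes M: "finite_measure M"
    and W_sq: "\<And>U. U \<in> W \<Longrightarrow> sq_integrable M U"
    and W_lin: "\<And>U V a b. U \<in> W \<Longrightarrow> V \<in> W \<Longrightarrow> (\<lambda>x. a *\<^sub>R U x + b *\<^sub>R V x) \<in> W"
    and C: "C \<subseteq> W" "C \<noteq> {}"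
    and C_convex: "\<And>U V t. U \<in> C \<Longrightarrow> V \<in> C \<Longrightarrow> 0 \<le> t \<Longrightarrow> t \<le> 1 \<Longrightarrow> (\<lambda>x. (1 - t) *\<^sub>R U x + t *\<^sub>R V x) \<in> C"
    and C_closed: "\<And>U V. (\<And>n. U n \<in> C) \<Longrightarrow> sq_integrable M V \<Longrightarrow>
      (\<lambda>n. l2norm M (\<lambda>x. U n x - V x)) \<longlonglongrightarrow> 0 \<Longrightarrow> V \<in> C"
    and B_lin: "\<And>U V Z a b. U \<in> W \<Longrightarrow> V \<in> W \<Longrightarrow> Z \<in> W \<Longrightarrow>
      B Z (\<lambda>x. a *\<^sub>R U x + b *\<^sub>R V x) = a * B Z U + b * B Z V"
    and B_sym: "\<And>U V. U \<in> W \<Longrightarrow> V \<in> W \<Longrightarrow> B U V = B V U"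
    and B_bound: "\<And>U V. U \<in> W \<Longrightarrow> V \<in> W \<Longrightarrow> \<bar>B U V\<bar> \<le> K * l2norm M U * l2norm M V"
    and c: "c > 0" "\<And>U. U \<in> W \<Longrightarrow> c * (l2norm M U)\<^sup>2 \<le> B U U"
    and l_lin: "\<And>U V a b. U \<in> W \<Longrightarrow> V \<in> W \<Longrightarrow> l (\<lambda>x. a *\<^sub>R U x + b *\<^sub>R V x) = a * l U + b * l V"
    and l_bound: "\<And>U. U \<in> W \<Longrightarrow> \<bar>l U\<bar> \<le> N * l2norm M U"
  obtains Q where "Q \<in> C" "\<And>V. V \<in> C \<Longrightarrow> l (\<lambda>x. V x - Q x) \<le> B Q (\<lambda>x. V x - Q x)"
proof -
  have CW: "U \<in> W" if "U \<in> C" for U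
    using that C by blast
  have B_lin2: "B (\<lambda>x. a *\<^sub>R U x + b *\<^sub>R V x) (\<lambda>x. a *\<^sub>R U x + b *\<^sub>R V x)
      = a\<^sup>2 * B U U + 2 * a * b * B U V + b\<^sup>2 * B V V" if "U \<in> W" "V \<in> W" for U V a b
    using that by (simp add: B_lin W_lin B_sym[of "\<lambda>x. a *\<^sub>R U x + b *\<^sub>R V x"] B_sym[of V U]
        power2_eq_square algebra_simps)
  have diff_W: "(\<lambda>x. V x - U x) \<in> W" and l_diff: "l (\<lambda>x. V x - U x) = l V - l U"
    and B_diff2: "B (\<lambda>x. V x - U x) (\<lambda>x. V x - U x) = B U U - 2 * B U V + B V V"
    if "U \<in> W" "V \<in> W" for U V
    using W_lin[OF that, of "-1" 1] l_lin[OF that, of "-1" 1] B_lin2[OF that, of "-1" 1] by simp_all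
  have B_diff: "B Z (\<lambda>x. V x - U x) = B Z V - B Z U" if "U \<in> W" "V \<in> W" "Z \<in> W" for U V Z
    using B_lin[OF that, of "-1" 1] by simp
  \<comment> \<open>The functional to be minimized over C; its derivative at U in direction D is B U
    D - l D.\<close>
  define J where "J U = B U U / 2 - l U" for U
  have J_conv: "J (\<lambda>x. (1 - t) *\<^sub>R U x + t *\<^sub>R V x)
      = J U + t * (B U V - B U U - l V + l U) + t\<^sup>2 / 2 * (B U U - 2 * B U V + B V V)"
    if "U \<in> W" "V \<in> W" for U V t
    unfolding J_def B_lin2[OF that] l_lin[OF that] by (simp add: power2_eq_square field_simps)
  have J_lower: "- (N\<^sup>2 / (2 * c)) \<le> J U" if "U \<in> W" for U
  proof -
    \<comment> \<open>Completing the square in c/2 ||U||^2 - N ||U||, the lower bound that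
      coercivity gives for J.\<close>
    have "0 \<le> (c * l2norm M U - N)\<^sup>2 / (2 * c)"
      using c(1) by simp
    also have "\<dots> = c * (l2norm M U)\<^sup>2 / 2 - N * l2norm M U + N\<^sup>2 / (2 * c)"
      using c(1) by (simp add: power2_diff power_mult_distrib field_simps power2_eq_square)
    also have "\<dots> \<le> J U + N\<^sup>2 / (2 * c)"
      using c(2)[OF that] l_bound[OF that] by (simp add: J_def)
    finally show ?thesis by simp
  qed
  define m where "m = Inf (J ` C)"
  have bdd: "bdd_below (J ` C)"
    using J_lower CW by (intro bdd_belowI2[of _ "- (N\<^sup>2 / (2 * c))"]) blast
  have m_le: "m \<le> J U" if "U \<in> C" for U
    unfolding m_def using bdd that by (intro cINF_lower)
  have "\<exists>U\<in>C. J U < m + 1 / real (Suc n)" for n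
    using cInf_less_iff[of "J ` C" "m + 1 / real (Suc n)"] bdd C(2) by (auto simp: m_def)
  then obtain U where U: "\<And>n. U n \<in> C" "\<And>n. J (U n) < m + 1 / real (Suc n)"
    by metis
  have UW: "U n \<in> W" for n
    using CW U by blast
  have Cauchy: "c / 4 * (l2norm M (\<lambda>x. U j x - U i x))\<^sup>2 \<le> 1 / real (Suc i) + 1 / real (Suc j)" for i j
  proof -
    \<comment> \<open>The midpoint belongs to C, so its value is at least m; on the other hand it
      lies below the average of the two values by B(D, D) / 8, where D is the difference.\<close>
    have "m \<le> J (\<lambda>x. (1 - 1/2) *\<^sub>R U i x + (1/2) *\<^sub>R U j x)"
      by (intro m_le C_convex U) auto
    also have "\<dots> = (J (U i) + J (U j)) / 2 - (B (U i) (U i) - 2 * B (U i) (U j) + B (U j) (U j)) / 8"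
      unfolding J_conv[OF UW UW] by (simp add: J_def power2_eq_square field_simps)
    finally have "B (\<lambda>x. U j x - U i x) (\<lambda>x. U j x - U i x) / 4 \<le> J (U i) + J (U j) - 2 * m"
      unfolding B_diff2[OF UW UW] by (simp add: field_simps)
    moreover have "c * (l2norm M (\<lambda>x. U j x - U i x))\<^sup>2 \<le> B (\<lambda>x. U j x - U i x) (\<lambda>x. U j x - U i x)"
      by (intro c diff_W UW)
    ultimately show ?thesis
      using U(2)[of i] U(2)[of j] by linarith
  qed
  obtain Q where Q_sq: "sq_integrable M Q" and Q_lim: "(\<lambda>n. l2norm M (\<lambda>x. U n x - Q x)) \<longlonglongrightarrow> 0"
  proof (rule l2_complete[OF M])
    show "sq_integrable M (U n)" for n
      by (rule W_sq[OF UW])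
    fix e :: real assume "e > 0"
    \<comment> \<open>Two reciprocals below c/8 e^2 add up to less than the c/4 e^2 that the Cauchy
      estimate has to beat.\<close>
    then have "c / 8 * e\<^sup>2 > 0"
      using c(1) by simp
    then obtain n0 where n0: "1 / real (Suc n0) < c / 8 * e\<^sup>2"
      by (rule nat_approx_posE)
    have "l2norm M (\<lambda>x. U i x - U j x) < e" if "i \<ge> n0" "j \<ge> n0" for i j
    proof -
      have "1 / real (Suc i) \<le> 1 / real (Suc n0)" "1 / real (Suc j) \<le> 1 / real (Suc n0)"
        using that by (simp_all add: frac_le)
      then have "c / 4 * (l2norm M (\<lambda>x. U i x - U j x))\<^sup>2 < c / 4 * e\<^sup>2"
        using Cauchy[of i j] n0 by linarith
      then have "(l2norm M (\<lambda>x. U i x - U j x))\<^sup>2 < e\<^sup>2"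
        using c(1) by simp
      then show ?thesis
        by (rule power2_less_imp_less) (use \<open>e > 0\<close> in simp)
    qed
    then show "\<exists>N. \<forall>i\<ge>N. \<forall>j\<ge>N. l2norm M (\<lambda>x. U i x - U j x) < e"
      by blast
  qed (rule that)
  have QC: "Q \<in> C"
    by (rule C_closed[OF U(1) Q_sq Q_lim])
  then have QW: "Q \<in> W"
    by (rule CW)
  have "J Q \<le> m"
  proof (rule LIMSEQ_le_const)
    let ?d = "\<lambda>n. l2norm M (\<lambda>x. U n x - Q x)"
    show "(\<lambda>n. m + 1 / real (Suc n) + (K * l2norm M Q * ?d n + N * ?d n)) \<longlonglongrightarrow> m"
    proof (rule tendsto_eq_rhs)
      show "(\<lambda>n. m + 1 / real (Suc n) + (K * l2norm M Q * ?d n + N * ?d n))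
          \<longlonglongrightarrow> m + 0 + (K * l2norm M Q * 0 + N * 0)"
        by (intro tendsto_intros Q_lim LIMSEQ_Suc[OF lim_1_over_n])
    qed simp
    have "J Q \<le> m + 1 / real (Suc n) + (K * l2norm M Q * ?d n + N * ?d n)" for n
    proof -
      let ?D = "\<lambda>x. U n x - Q x"
      have DW: "?D \<in> W"
        by (rule diff_W[OF QW UW])
      \<comment> \<open>Exact expansion around Q. The quadratic remainder is nonnegative and the
        linear terms are bounded by the distance to Q, so only lower semicontinuity of J is
        obtained, which is enough.\<close>
      have "J (U n) = J Q + B Q ?D - l ?D + B ?D ?D / 2"
        unfolding B_diff[OF QW UW QW] B_diff2[OF QW UW] l_diff[OF QW UW]
        by (simp add: J_def field_simps)
      moreover have "0 \<le> B ?D ?D"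
        using c(2)[OF DW] c(1) by (meson less_imp_le mult_nonneg_nonneg order_trans zero_le_power2)
      ultimately show ?thesis
        using U(2)[of n] B_bound[OF QW DW] l_bound[OF DW] by linarith
    qed
    then show "\<exists>N'. \<forall>n\<ge>N'. J Q \<le> m + 1 / real (Suc n) + (K * l2norm M Q * ?d n + N * ?d n)"
      by blast
  qed
  have "l (\<lambda>x. V x - Q x) \<le> B Q (\<lambda>x. V x - Q x)" if "V \<in> C" for V
  proof -
    have VW: "V \<in> W"
      by (rule CW[OF that])
    define X Y where "X = B Q V - B Q Q - l V + l Q" and "Y = B Q Q - 2 * B Q V + B V V"
    \<comment> \<open>First variation along the segment from Q to V: J changes by t (X + t Y / 2).
      Dividing by t and letting t = 1 / (n + 1) tend to 0 leaves X \<ge> 0.\<close>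
    have "0 \<le> X + 1 / real (Suc n) * (Y / 2)" for n
    proof -
      define t where "t = 1 / real (Suc n)"
      have t: "0 < t" "t \<le> 1"
        by (simp_all add: t_def)
      have "J Q \<le> J (\<lambda>x. (1 - t) *\<^sub>R Q x + t *\<^sub>R V x)"
        using \<open>J Q \<le> m\<close> m_le[OF C_convex[OF QC that, of t]] t by simp
      also have "\<dots> = J Q + t * (X + t * (Y / 2))"
        unfolding J_conv[OF QW VW] X_def[symmetric] Y_def[symmetric]
        by (simp add: power2_eq_square algebra_simps)
      finally have "0 \<le> t * (X + t * (Y / 2))"
        by simp
      then have "0 \<le> X + t * (Y / 2)"
        using mult_le_cancel_left_pos[OF t(1), of 0 "X + t * (Y / 2)"] by simp
      then show ?thesis
        unfolding t_def .
    qed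
    then have ev: "\<exists>N. \<forall>n\<ge>N. 0 \<le> X + 1 / real (Suc n) * (Y / 2)"
      by blast
    have "(\<lambda>n. X + 1 / real (Suc n) * (Y / 2)) \<longlonglongrightarrow> X + 0 * (Y / 2)"
      by (intro tendsto_intros LIMSEQ_Suc[OF lim_1_over_n])
    from LIMSEQ_le_const[OF this ev] have "0 \<le> X"
      by simp
    then show ?thesis
      unfolding B_diff[OF QW VW QW] l_diff[OF QW VW] X_def by simp
  qed
  then show thesis
    using that[OF QC] by blast
qed

section \<open>Energy, load and obstacle condition on jets\<close>

definition energy_form :: "pt set \<Rightarrow> (pt \<Rightarrow> real) \<Rightarrow> (pt \<Rightarrow> real \<times> real \<times> real) \<Rightarrow> (pt \<Rightarrow> real \<times> real \<times> real) \<Rightarrow> real" where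
  "energy_form \<Omega> a U V = (LINT x|lebesgue_on \<Omega>. a x * (snd (U x) \<bullet> snd (V x)))"

text \<open>Linear in U, so the whole right side of the variational inequality is this form at a
  difference of jets.\<close>

definition load_form :: "pt set \<Rightarrow> (pt \<Rightarrow> real) \<Rightarrow> real \<Rightarrow> (pt \<Rightarrow> real \<times> real \<times> real) \<Rightarrow> real" where
  "load_form \<Omega> h \<gamma> U = (LINT x|lebesgue_on \<Omega>. h x * fst (snd (U x))) - \<gamma> * (LINT x|lebesgue_on \<Omega>. fst (U x))"

text \<open>The counterpart of \<open>Kset\<close> on jets, where the minimization can take place
  without reference to \<open>wpd\<close>.\<close>

definition jet_cone :: "pt set \<Rightarrow> (pt \<Rightarrow> real \<times> real \<times> real) set" where
  "jet_cone \<Omega> = {U \<in> jet_closure \<Omega>. AE x in lebesgue_on \<Omega>. 0 \<le> fst (U x)}"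

lemma sq_integrable_weighted:
  fixes f :: "'a \<Rightarrow> 'b::euclidean_space"
  assumes a: "a \<in> borel_measurable M" "\<And>x. x \<in> space M \<Longrightarrow> \<bar>a x\<bar> \<le> A" and f: "sq_integrable M f"
  shows "sq_integrable M (\<lambda>x. a x *\<^sub>R f x)" and "0 \<le> A \<Longrightarrow> l2norm M (\<lambda>x. a x *\<^sub>R f x) \<le> A * l2norm M f"
proof -
  have meas: "(\<lambda>x. a x *\<^sub>R f x) \<in> borel_measurable M"
    by (rule borel_measurable_scaleR[OF a(1) sq_integrable_measurable[OF f]])
  have le: "norm (a x *\<^sub>R f x) \<le> A * norm (f x)" if "x \<in> space M" for x
    using a(2)[OF that] by (simp add: mult_right_mono)
  show "sq_integrable M (\<lambda>x. a x *\<^sub>R f x)"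
    by (rule sq_integrable_bound(1)[OF f meas le])
  show "l2norm M (\<lambda>x. a x *\<^sub>R f x) \<le> A * l2norm M f" if "0 \<le> A"
    by (rule sq_integrable_bound(2)[OF f meas le that])
qed

lemma abs_integral_le_l2norm:
  fixes f :: "'a \<Rightarrow> real"
  assumes "finite_measure M" "sq_integrable M f"
  shows "\<bar>LINT x|M. f x\<bar> \<le> l2norm M (\<lambda>_. 1::real) * l2norm M f"
  using l2norm_Cauchy_Schwarz[OF assms(2) sq_integrable_const[OF assms(1), of "1::real"]] by (simp add: mult.commute)

text \<open>Follows from x^3 - y^3 = (x^2 + x y + y^2) (x - y). It measures how far the weight moves
  when \<beta> does.\<close>

lemma abs_diff_power3_le:
  fixes x y :: real
  assumes "0 \<le> x" "x \<le> b" "0 \<le> y" "y \<le> b"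
  shows "\<bar>x ^ 3 - y ^ 3\<bar> \<le> 3 * b\<^sup>2 * \<bar>x - y\<bar>"
proof -
  have "x\<^sup>2 \<le> b\<^sup>2" "y\<^sup>2 \<le> b\<^sup>2" "x * y \<le> b * b"
    using assms by (auto intro: power_mono mult_mono)
  then have "\<bar>x\<^sup>2 + x * y + y\<^sup>2\<bar> \<le> 3 * b\<^sup>2"
    using assms by (simp add: power2_eq_square)
  then have "\<bar>x\<^sup>2 + x * y + y\<^sup>2\<bar> * \<bar>x - y\<bar> \<le> 3 * b\<^sup>2 * \<bar>x - y\<bar>"
    by (rule mult_right_mono) simp
  moreover have "x ^ 3 - y ^ 3 = (x\<^sup>2 + x * y + y\<^sup>2) * (x - y)"
    by (simp add: power2_eq_square power3_eq_cube algebra_simps)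
  ultimately show ?thesis
    by (simp add: abs_mult)
qed

section \<open>Bounds and existence for fixed parameters\<close>

context
  fixes \<Omega> :: "pt set" and h0 :: "pt \<Rightarrow> real" and H R :: real
  assumes \<Omega>: "open \<Omega>" "bounded \<Omega>"
    and h0_meas: "h0 \<in> borel_measurable (lebesgue_on \<Omega>)"
    and h0_bounds: "\<And>x. x \<in> \<Omega> \<Longrightarrow> 0 \<le> h0 x" "\<And>x. x \<in> \<Omega> \<Longrightarrow> h0 x \<le> H" and H: "0 \<le> H"
    and R: "\<And>x. x \<in> \<Omega> \<Longrightarrow> norm x \<le> R" "0 \<le> R"
begin

private abbreviation (input) "M \<equiv> lebesgue_on \<Omega>"
private abbreviation (input) "a\<^sub>c \<beta> \<equiv> \<lambda>x. (h0 x + \<beta>) ^ 3"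

lemmas fin_M = finite_measure_lebesgue_on[OF \<Omega>]

lemma coeff_measurable: "a\<^sub>c \<beta> \<in> borel_measurable M"
  using h0_meas by measurable

lemma coeff_bounds:
  assumes "x \<in> \<Omega>" "0 < \<beta>"
  shows "\<beta> ^ 3 \<le> a\<^sub>c \<beta> x" "a\<^sub>c \<beta> x \<le> (H + \<beta>) ^ 3" "\<bar>a\<^sub>c \<beta> x\<bar> \<le> (H + \<beta>) ^ 3"
proof -
  show "\<beta> ^ 3 \<le> a\<^sub>c \<beta> x" and *: "a\<^sub>c \<beta> x \<le> (H + \<beta>) ^ 3"
    using h0_bounds[OF assms(1)] assms(2) by (intro power_mono; simp)+
  show "\<bar>a\<^sub>c \<beta> x\<bar> \<le> (H + \<beta>) ^ 3"
    using * h0_bounds(1)[OF assms(1)] assms(2) by simp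
qed

text \<open>The weight is arbitrary because the lemma is applied both to the coefficient and to the
  difference of two coefficients.\<close>

lemma weighted_inner:
  assumes a: "a \<in> borel_measurable M" "\<And>x. x \<in> \<Omega> \<Longrightarrow> \<bar>a x\<bar> \<le> A" "0 \<le> A"
    and U: "sq_integrable M U" and V: "sq_integrable M V"
  shows "integrable M (\<lambda>x. a x * (snd (U x) \<bullet> snd (V x)))"
    and "\<bar>LINT x|M. a x * (snd (U x) \<bullet> snd (V x))\<bar> \<le> A * l2norm M (\<lambda>x. snd (U x)) * l2norm M (\<lambda>x. snd (V x))"
proof -
  have a': "\<bar>a x\<bar> \<le> A" if "x \<in> space M" for x
    using a(2) that by simp
  have sq: "sq_integrable M (\<lambda>x. a x *\<^sub>R snd (U x))"
    by (rule sq_integrable_weighted(1)[OF a(1) a' sq_integrable_snd(1)[OF U]])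
  show "integrable M (\<lambda>x. a x * (snd (U x) \<bullet> snd (V x)))"
    using sq_integrable_inner[OF sq sq_integrable_snd(1)[OF V]] by simp
  have "\<bar>LINT x|M. a x * (snd (U x) \<bullet> snd (V x))\<bar> \<le> l2norm M (\<lambda>x. a x *\<^sub>R snd (U x)) * l2norm M (\<lambda>x. snd (V x))"
    using l2norm_Cauchy_Schwarz[OF sq sq_integrable_snd(1)[OF V]] by simp
  also have "\<dots> \<le> A * l2norm M (\<lambda>x. snd (U x)) * l2norm M (\<lambda>x. snd (V x))"
    by (intro mult_right_mono sq_integrable_weighted(2)[OF a(1) a' sq_integrable_snd(1)[OF U] a(3)])
      (simp_all add: l2norm_nonneg)
  finally show "\<bar>LINT x|M. a x * (snd (U x) \<bullet> snd (V x))\<bar> \<le> A * l2norm M (\<lambda>x. snd (U x)) * l2norm M (\<lambda>x. snd (V x))" .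
qed

lemma energy_integrable:
  assumes "0 < \<beta>" "sq_integrable M U" "sq_integrable M V"
  shows "integrable M (\<lambda>x. a\<^sub>c \<beta> x * (snd (U x) \<bullet> snd (V x)))"
  by (rule weighted_inner(1)[OF coeff_measurable coeff_bounds(3)]) (use assms H in auto)

text \<open>Nonnegativity of h_0 leaves \<beta>^3 as a lower bound of the weight.\<close>

lemma energy_coercive:
  assumes "0 < \<beta>" "sq_integrable M U"
  shows "\<beta> ^ 3 * (l2norm M (\<lambda>x. snd (U x)))\<^sup>2 \<le> energy_form \<Omega> (a\<^sub>c \<beta>) U U"
proof -
  have "\<beta> ^ 3 * (l2norm M (\<lambda>x. snd (U x)))\<^sup>2 = (LINT x|M. \<beta> ^ 3 * (norm (snd (U x)))\<^sup>2)"
    by (simp add: l2norm_power2)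
  also have "\<dots> \<le> energy_form \<Omega> (a\<^sub>c \<beta>) U U"
    unfolding energy_form_def
  proof (rule integral_mono)
    show "integrable M (\<lambda>x. \<beta> ^ 3 * (norm (snd (U x)))\<^sup>2)"
      using sq_integrable_snd(1)[OF assms(2)] by (simp add: sq_integrable_def)
    show "integrable M (\<lambda>x. a\<^sub>c \<beta> x * (snd (U x) \<bullet> snd (U x)))"
      by (rule energy_integrable[OF assms(1,2,2)])
    show "\<beta> ^ 3 * (norm (snd (U x)))\<^sup>2 \<le> a\<^sub>c \<beta> x * (snd (U x) \<bullet> snd (U x))" if "x \<in> space M" for x
      using coeff_bounds(1)[OF _ assms(1)] that
      by (simp only: power2_norm_eq_inner) (intro mult_right_mono, auto)
  qed
  finally show ?thesis .
qed

lemma load_integrable: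
  fixes U :: "pt \<Rightarrow> real \<times> real \<times> real"
  assumes "sq_integrable M U"
  shows "integrable M (\<lambda>x. h0 x * fst (snd (U x)))" "integrable M (\<lambda>x. fst (U x))"
    and "\<bar>LINT x|M. h0 x * fst (snd (U x))\<bar> \<le> l2norm M (\<lambda>_. 1::real) * (H * l2norm M (\<lambda>x. snd (U x)))"
proof -
  note sq = sq_integrable_fst(1)[OF sq_integrable_snd(1)[OF assms]]
  have b: "\<bar>h0 x\<bar> \<le> H" if "x \<in> space M" for x
    using h0_bounds[of x] that by simp
  have sqh: "sq_integrable M (\<lambda>x. h0 x * fst (snd (U x)))"
    using sq_integrable_weighted(1)[OF h0_meas b sq] by simp
  show "integrable M (\<lambda>x. h0 x * fst (snd (U x)))" "integrable M (\<lambda>x. fst (U x))"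
    by (rule sq_integrable_integrable[OF fin_M sqh],
        rule sq_integrable_integrable[OF fin_M sq_integrable_fst(1)[OF assms]])
  have "\<bar>LINT x|M. h0 x * fst (snd (U x))\<bar> \<le> l2norm M (\<lambda>_. 1::real) * l2norm M (\<lambda>x. h0 x * fst (snd (U x)))"
    by (rule abs_integral_le_l2norm[OF fin_M sqh])
  also have "l2norm M (\<lambda>x. h0 x * fst (snd (U x))) \<le> H * l2norm M (\<lambda>x. fst (snd (U x)))"
    using sq_integrable_weighted(2)[OF h0_meas b sq H] by simp
  also have "l2norm M (\<lambda>x. fst (snd (U x))) \<le> l2norm M (\<lambda>x. snd (U x))"
    by (rule sq_integrable_fst(2)[OF sq_integrable_snd(1)[OF assms]])
  finally show "\<bar>LINT x|M. h0 x * fst (snd (U x))\<bar> \<le> l2norm M (\<lambda>_. 1::real) * (H * l2norm M (\<lambda>x. snd (U x)))"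
    using H by (simp add: mult_left_mono)
qed

text \<open>Cauchy-Schwarz against the function 1, followed by Poincare. It serves twice: for the
  \<gamma> term of the load and for the mean of q that defines G.\<close>

lemma mean_bound:
  assumes "U \<in> jet_closure \<Omega>"
  shows "\<bar>LINT x|M. fst (U x)\<bar> \<le> l2norm M (\<lambda>_. 1::real) * (2 * R * l2norm M (\<lambda>x. snd (U x)))"
proof -
  have "\<bar>LINT x|M. fst (U x)\<bar> \<le> l2norm M (\<lambda>_. 1::real) * l2norm M (\<lambda>x. fst (U x))"
    by (intro abs_integral_le_l2norm fin_M sq_integrable_fst(1) jet_closure_sq_integrable[OF assms])
  also have "\<dots> \<le> l2norm M (\<lambda>_. 1::real) * (2 * R * l2norm M (\<lambda>x. snd (U x)))"
    by (intro mult_left_mono jet_closure_Poincare[OF \<Omega> assms R]) simp_all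
  finally show ?thesis .
qed

lemma load_bound:
  assumes U: "U \<in> jet_closure \<Omega>"
  shows "\<bar>load_form \<Omega> h0 \<gamma> U\<bar> \<le> l2norm M (\<lambda>_. 1::real) * (H + 2 * R * \<bar>\<gamma>\<bar>) * l2norm M (\<lambda>x. snd (U x))"
proof -
  have "\<bar>load_form \<Omega> h0 \<gamma> U\<bar> \<le> \<bar>LINT x|M. h0 x * fst (snd (U x))\<bar> + \<bar>\<gamma>\<bar> * \<bar>LINT x|M. fst (U x)\<bar>"
    unfolding load_form_def abs_mult[symmetric] by (rule abs_triangle_ineq4)
  also have "\<dots> \<le> l2norm M (\<lambda>_. 1::real) * (H * l2norm M (\<lambda>x. snd (U x)))
      + \<bar>\<gamma>\<bar> * (l2norm M (\<lambda>_. 1::real) * (2 * R * l2norm M (\<lambda>x. snd (U x))))"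
    by (intro add_mono mult_left_mono load_integrable(3) mean_bound U jet_closure_sq_integrable) simp
  finally show ?thesis
    by (simp add: algebra_simps)
qed

text \<open>Since \<open>wpd\<close> is determined only up to null sets, jets that agree almost
  everywhere have to be interchangeable in the forms.\<close>

lemma energy_cong_AE:
  assumes "0 < \<beta>" "sq_integrable M U" "sq_integrable M V" "sq_integrable M U'" "sq_integrable M V'"
    and AE: "AE x in M. U x = U' x" "AE x in M. V x = V' x"
  shows "energy_form \<Omega> (a\<^sub>c \<beta>) U V = energy_form \<Omega> (a\<^sub>c \<beta>) U' V'"
  unfolding energy_form_def
proof (rule integral_cong_AE)
  show "AE x in M. a\<^sub>c \<beta> x * (snd (U x) \<bullet> snd (V x)) = a\<^sub>c \<beta> x * (snd (U' x) \<bullet> snd (V' x))"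
    using AE by eventually_elim simp
qed (use energy_integrable assms in blast)+

lemma load_cong_AE:
  assumes "sq_integrable M U" "sq_integrable M U'" and AE: "AE x in M. U x = U' x"
  shows "load_form \<Omega> h0 \<gamma> U = load_form \<Omega> h0 \<gamma> U'"
proof -
  have "(LINT x|M. h0 x * fst (snd (U x))) = (LINT x|M. h0 x * fst (snd (U' x)))"
  proof (rule integral_cong_AE)
    show "AE x in M. h0 x * fst (snd (U x)) = h0 x * fst (snd (U' x))"
      using AE by eventually_elim simp
  qed (use load_integrable assms in blast)+
  moreover have "(LINT x|M. fst (U x)) = (LINT x|M. fst (U' x))"
  proof (rule integral_cong_AE)
    show "AE x in M. fst (U x) = fst (U' x)"
      using AE by eventually_elim simp
  qed (use load_integrable assms in blast)+
  ultimately show ?thesis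
    by (simp add: load_form_def)
qed

lemma jet_cone_sq_integrable: "U \<in> jet_cone \<Omega> \<Longrightarrow> sq_integrable M U"
  by (simp add: jet_cone_def jet_closure_sq_integrable)

lemma Kset_wjet: "\<phi> \<in> Kset \<Omega> \<Longrightarrow> wjet \<Omega> \<phi> \<in> jet_cone \<Omega>"
  by (simp add: Kset_def jet_cone_def H10_wjet) (simp add: wjet_def)

lemma jet_cone_Kset:
  assumes "U \<in> jet_cone \<Omega>"
  shows "(\<lambda>x. fst (U x)) \<in> Kset \<Omega>" and "AE x in M. wjet \<Omega> (\<lambda>x. fst (U x)) x = U x"
  using assms jet_closure_H10[OF \<Omega>, of U] by (simp_all add: Kset_def jet_cone_def)

lemma VI_sol_iff:
  "VI_sol \<Omega> h0 \<beta> \<gamma> q \<longleftrightarrow> q \<in> Kset \<Omega> \<and> (\<forall>\<phi>\<in>Kset \<Omega>.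
    load_form \<Omega> h0 \<gamma> (\<lambda>x. wjet \<Omega> \<phi> x - wjet \<Omega> q x)
      \<le> energy_form \<Omega> (a\<^sub>c \<beta>) (wjet \<Omega> q) (\<lambda>x. wjet \<Omega> \<phi> x - wjet \<Omega> q x))"
proof -
  have "energy_form \<Omega> (a\<^sub>c \<beta>) (wjet \<Omega> q) (\<lambda>x. wjet \<Omega> \<phi> x - wjet \<Omega> q x)
      = (LINT x|M. (h0 x + \<beta>) ^ 3 * (wpd \<Omega> e1 q x * (wpd \<Omega> e1 \<phi> x - wpd \<Omega> e1 q x)
        + wpd \<Omega> e2 q x * (wpd \<Omega> e2 \<phi> x - wpd \<Omega> e2 q x)))" for \<phi>
    unfolding energy_form_def wjet_def diff_Pair snd_conv inner_Pair inner_real_def ..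
  moreover have "load_form \<Omega> h0 \<gamma> (\<lambda>x. wjet \<Omega> \<phi> x - wjet \<Omega> q x)
      = (LINT x|M. h0 x * (wpd \<Omega> e1 \<phi> x - wpd \<Omega> e1 q x)) - \<gamma> * (LINT x|M. \<phi> x - q x)" for \<phi>
    unfolding load_form_def wjet_def diff_Pair snd_conv fst_conv ..
  ultimately show ?thesis
    by (simp only: VI_sol_def)
qed

lemma VI_sol_Kset: "VI_sol \<Omega> h0 \<beta> \<gamma> q \<Longrightarrow> q \<in> Kset \<Omega>"
  unfolding VI_sol_def by (rule conjunct1)

text \<open>Frees the competitor from the choice operator. In particular the literal zero jet
  becomes admissible, whereas the \<open>wjet\<close> of the zero function is known to vanish only
  almost everywhere.\<close>

lemma VI_sol_jet_cone:
  assumes \<beta>: "0 < \<beta>" and sol: "VI_sol \<Omega> h0 \<beta> \<gamma> q" and V: "V \<in> jet_cone \<Omega>"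
  shows "load_form \<Omega> h0 \<gamma> (\<lambda>x. V x - wjet \<Omega> q x)
      \<le> energy_form \<Omega> (a\<^sub>c \<beta>) (wjet \<Omega> q) (\<lambda>x. V x - wjet \<Omega> q x)"
proof -
  let ?\<phi> = "\<lambda>x. fst (V x)"
  let ?D = "\<lambda>x. V x - wjet \<Omega> q x" and ?D' = "\<lambda>x. wjet \<Omega> ?\<phi> x - wjet \<Omega> q x"
  have sq: "sq_integrable M (wjet \<Omega> q)"
    by (rule jet_cone_sq_integrable[OF Kset_wjet[OF VI_sol_Kset[OF sol]]])
  have \<phi>: "?\<phi> \<in> Kset \<Omega>"
    by (rule jet_cone_Kset(1)[OF V])
  have D: "sq_integrable M ?D" "sq_integrable M ?D'"
    by (rule sq_integrable_diff[OF jet_cone_sq_integrable[OF V] sq],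
        rule sq_integrable_diff[OF jet_cone_sq_integrable[OF Kset_wjet[OF \<phi>]] sq])
  have AE: "AE x in M. ?D x = ?D' x"
    using jet_cone_Kset(2)[OF V] by eventually_elim simp
  have "load_form \<Omega> h0 \<gamma> ?D' \<le> energy_form \<Omega> (a\<^sub>c \<beta>) (wjet \<Omega> q) ?D'"
    using sol[unfolded VI_sol_iff] \<phi> by (elim conjE bspec)
  moreover have "load_form \<Omega> h0 \<gamma> ?D = load_form \<Omega> h0 \<gamma> ?D'"
    by (rule load_cong_AE[OF D AE])
  moreover have "energy_form \<Omega> (a\<^sub>c \<beta>) (wjet \<Omega> q) ?D = energy_form \<Omega> (a\<^sub>c \<beta>) (wjet \<Omega> q) ?D'"
    by (rule energy_cong_AE[OF \<beta> sq D(1) sq D(2) AE_I2[OF refl] AE])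
  ultimately show ?thesis
    by (simp only:)
qed

lemma zero_jet_cone: "(\<lambda>_. 0) \<in> jet_cone \<Omega>"
proof -
  have "test_fun \<Omega> (\<lambda>_. 0)"
  proof -
    have "bump_algebra (\<lambda>_. 0)" by (rule bump_algebra.const)
    then show ?thesis by (simp add: test_fun_def bump_algebra_smooth2)
  qed
  then have "jet (\<lambda>_. 0) \<in> jet_closure \<Omega>"
    unfolding jet_closure_def using sq_integrable_jet[OF \<Omega>]
    by (intro CollectI conjI exI[of _ "\<lambda>_ _. 0"]) (simp_all add: l2norm_def)
  \<comment> \<open>Coefficients 0 produce the literal zero jet and spare computing the derivatives
    of a constant.\<close>
  from jet_closure_lincomb[OF \<Omega> this this, of 0 0] have "(\<lambda>_. 0) \<in> jet_closure \<Omega>"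
    by simp
  then show ?thesis
    unfolding jet_cone_def by simp
qed

lemma VI_sol_exists:
  assumes \<beta>: "0 < \<beta>"
  shows "\<exists>q. VI_sol \<Omega> h0 \<beta> \<gamma> q"
proof -
  let ?B = "energy_form \<Omega> (a\<^sub>c \<beta>)" and ?l = "load_form \<Omega> h0 \<gamma>" and ?W = "jet_closure \<Omega>"
  let ?N = "l2norm M (\<lambda>_. 1::real) * (H + 2 * R * \<bar>\<gamma>\<bar>)"
  note sq = jet_closure_sq_integrable
  obtain Q where Q: "Q \<in> jet_cone \<Omega>" and VI: "\<And>V. V \<in> jet_cone \<Omega> \<Longrightarrow> ?l (\<lambda>x. V x - Q x) \<le> ?B Q (\<lambda>x. V x - Q x)"
  \<comment> \<open>Coercivity on the full jet costs the factor 4 R^2 + 1: by Poincare the squared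
    norm of the value is at most 4 R^2 times that of the gradient. K bounds the weight from above,
    and N is the constant of \<open>load_bound\<close>.\<close>
  proof (rule convex_variational_inequality[where M = M and W = ?W and C = "jet_cone \<Omega>" and B = ?B and l = ?l
        and c = "\<beta> ^ 3 / (4 * R\<^sup>2 + 1)" and K = "(H + \<beta>) ^ 3" and N = ?N])
    show "finite_measure M" by (rule fin_M)
    show "sq_integrable M U" if "U \<in> ?W" for U
      by (rule sq[OF that])
    show "(\<lambda>x. a *\<^sub>R U x + b *\<^sub>R V x) \<in> ?W" if "U \<in> ?W" "V \<in> ?W" for U V a b
      by (rule jet_closure_lincomb[OF \<Omega> that])
    show "jet_cone \<Omega> \<subseteq> ?W"
      by (auto simp: jet_cone_def)
    show "jet_cone \<Omega> \<noteq> {}"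
      using zero_jet_cone by blast
    show "(\<lambda>x. (1 - t) *\<^sub>R U x + t *\<^sub>R V x) \<in> jet_cone \<Omega>"
      if U: "U \<in> jet_cone \<Omega>" and V: "V \<in> jet_cone \<Omega>" and t: "0 \<le> t" "t \<le> 1" for U V t
    proof -
      have "AE x in M. 0 \<le> fst (U x)" "AE x in M. 0 \<le> fst (V x)"
        using U V by (simp_all add: jet_cone_def)
      then have "AE x in M. 0 \<le> fst ((1 - t) *\<^sub>R U x + t *\<^sub>R V x)"
        by eventually_elim (use t in simp)
      then show ?thesis
        using jet_closure_lincomb[OF \<Omega>, of U V "1 - t" t] U V by (simp add: jet_cone_def)
    qed
    show "V \<in> jet_cone \<Omega>" if U: "\<And>n. U n \<in> jet_cone \<Omega>" and V: "sq_integrable M V"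
      and lim: "(\<lambda>n. l2norm M (\<lambda>x. U n x - V x)) \<longlonglongrightarrow> 0" for U V
    proof -
      have UW: "U n \<in> ?W" and pos: "AE x in M. 0 \<le> fst (U n x)" for n
        using U[of n] by (simp_all add: jet_cone_def)
      have "AE x in M. 0 \<le> fst (V x)"
        by (rule AE_nonneg_l2_limit[OF sq_integrable_fst(1)[OF sq[OF UW]] pos sq_integrable_fst(1)[OF V]
              l2norm_fst_tendsto_0[OF sq[OF UW] V lim]])
      then show ?thesis
        using jet_closure_closed[OF \<Omega> UW V lim] by (simp add: jet_cone_def)
    qed
    show "?B Z (\<lambda>x. a *\<^sub>R U x + b *\<^sub>R V x) = a * ?B Z U + b * ?B Z V"
      if "U \<in> ?W" "V \<in> ?W" "Z \<in> ?W" for U V Z a b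
    proof -
      have "?B Z (\<lambda>x. a *\<^sub>R U x + b *\<^sub>R V x)
          = (LINT x|M. a * (a\<^sub>c \<beta> x * (snd (Z x) \<bullet> snd (U x))) + b * (a\<^sub>c \<beta> x * (snd (Z x) \<bullet> snd (V x))))"
        unfolding energy_form_def
        by (intro Bochner_Integration.integral_cong refl) (simp add: inner_add_right distrib_left mult.left_commute)
      also have "\<dots> = a * ?B Z U + b * ?B Z V"
        using energy_integrable[OF \<beta> sq sq] that by (simp add: energy_form_def)
      finally show ?thesis .
    qed
    show "?B U V = ?B V U" for U V
      by (simp add: energy_form_def inner_commute)
    show "\<bar>?B U V\<bar> \<le> (H + \<beta>) ^ 3 * l2norm M U * l2norm M V" if "U \<in> ?W" "V \<in> ?W" for U V
    proof -
      have "\<bar>?B U V\<bar> \<le> (H + \<beta>) ^ 3 * l2norm M (\<lambda>x. snd (U x)) * l2norm M (\<lambda>x. snd (V x))"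
        unfolding energy_form_def
        by (rule weighted_inner(2)[OF coeff_measurable coeff_bounds(3)]) (use \<beta> H sq that in auto)
      also have "\<dots> \<le> (H + \<beta>) ^ 3 * l2norm M U * l2norm M V"
        using \<beta> H by (intro mult_mono mult_left_mono sq_integrable_snd(2) sq that) auto
      finally show ?thesis .
    qed
    show "0 < \<beta> ^ 3 / (4 * R\<^sup>2 + 1)"
      using \<beta> by (simp add: add_nonneg_pos)
    show "\<beta> ^ 3 / (4 * R\<^sup>2 + 1) * (l2norm M U)\<^sup>2 \<le> ?B U U" if U: "U \<in> ?W" for U
    proof -
      have "(l2norm M U)\<^sup>2 = (l2norm M (\<lambda>x. fst (U x)))\<^sup>2 + (l2norm M (\<lambda>x. snd (U x)))\<^sup>2"
        using sq_integrable_Pair(2)[OF sq_integrable_fst(1)[OF sq[OF U]] sq_integrable_snd(1)[OF sq[OF U]]] by simp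
      also have "(l2norm M (\<lambda>x. fst (U x)))\<^sup>2 \<le> (2 * R * l2norm M (\<lambda>x. snd (U x)))\<^sup>2"
        by (intro power_mono jet_closure_Poincare[OF \<Omega> U R]) simp_all
      finally have "(l2norm M U)\<^sup>2 \<le> (4 * R\<^sup>2 + 1) * (l2norm M (\<lambda>x. snd (U x)))\<^sup>2"
        by (simp add: power_mult_distrib algebra_simps)
      then have "\<beta> ^ 3 / (4 * R\<^sup>2 + 1) * (l2norm M U)\<^sup>2
          \<le> \<beta> ^ 3 / (4 * R\<^sup>2 + 1) * ((4 * R\<^sup>2 + 1) * (l2norm M (\<lambda>x. snd (U x)))\<^sup>2)"
        using \<beta> by (intro mult_left_mono) auto
      also have "\<dots> = \<beta> ^ 3 * (l2norm M (\<lambda>x. snd (U x)))\<^sup>2"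
        using add_nonneg_pos[of "4 * R\<^sup>2" 1] by simp
      also have "\<dots> \<le> ?B U U"
        by (rule energy_coercive[OF \<beta> sq[OF U]])
      finally show ?thesis .
    qed
    show "?l (\<lambda>x. a *\<^sub>R U x + b *\<^sub>R V x) = a * ?l U + b * ?l V" if "U \<in> ?W" "V \<in> ?W" for U V a b
    proof -
      have "(LINT x|M. h0 x * fst (snd (a *\<^sub>R U x + b *\<^sub>R V x)))
          = (LINT x|M. a * (h0 x * fst (snd (U x))) + b * (h0 x * fst (snd (V x))))"
        by (intro Bochner_Integration.integral_cong refl) (simp add: algebra_simps)
      then show ?thesis
        using load_integrable[OF sq] that by (simp add: load_form_def algebra_simps)
    qed
    show "\<bar>?l U\<bar> \<le> ?N * l2norm M U" if U: "U \<in> ?W" for U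
    proof -
      have "\<bar>?l U\<bar> \<le> ?N * l2norm M (\<lambda>x. snd (U x))"
        by (rule load_bound[OF U])
      also have "\<dots> \<le> ?N * l2norm M U"
        using H R(2) by (intro mult_left_mono sq_integrable_snd(2) sq U) auto
      finally show ?thesis .
    qed
  qed (rule that)
  \<comment> \<open>The minimizer is a jet and its first component the solution. The chosen weak
    derivatives of that function match Q only almost everywhere, so the inequality has to be
    transferred.\<close>
  let ?q = "\<lambda>x. fst (Q x)"
  have q: "?q \<in> Kset \<Omega>" and AE: "AE x in M. wjet \<Omega> ?q x = Q x"
    using jet_cone_Kset[OF Q] by simp_all
  note sqQ = jet_cone_sq_integrable[OF Q] and sqq = jet_cone_sq_integrable[OF Kset_wjet[OF q]]
  have "VI_sol \<Omega> h0 \<beta> \<gamma> ?q"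
    unfolding VI_sol_iff
  proof (intro conjI ballI q)
    fix \<phi> assume \<phi>: "\<phi> \<in> Kset \<Omega>"
    note sq\<phi> = jet_cone_sq_integrable[OF Kset_wjet[OF \<phi>]]
    let ?D = "\<lambda>x. wjet \<Omega> \<phi> x - Q x" and ?D' = "\<lambda>x. wjet \<Omega> \<phi> x - wjet \<Omega> ?q x"
    have D: "sq_integrable M ?D'" "sq_integrable M ?D"
      by (intro sq_integrable_diff sq\<phi> sqQ sqq)+
    have AE': "AE x in M. ?D' x = ?D x"
      using AE by eventually_elim simp
    show "?l ?D' \<le> ?B (wjet \<Omega> ?q) ?D'"
      using VI[OF Kset_wjet[OF \<phi>]] load_cong_AE[OF D AE'] energy_cong_AE[OF \<beta> sqq D(1) sqQ D(2) AE AE'] by simp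
  qed
  then show ?thesis by blast
qed

section \<open>Dependence of the solution and of its mean on the parameters\<close>

lemma VI_sol_energy_bound:
  assumes \<beta>: "0 < \<beta>" and sol: "VI_sol \<Omega> h0 \<beta> \<gamma> q"
  shows "\<beta> ^ 3 * l2norm M (\<lambda>x. snd (wjet \<Omega> q x)) \<le> l2norm M (\<lambda>_. 1::real) * (H + 2 * R * \<bar>\<gamma>\<bar>)"
proof -
  let ?d = "l2norm M (\<lambda>x. snd (wjet \<Omega> q x))"
  have q: "wjet \<Omega> q \<in> jet_cone \<Omega>"
    by (rule Kset_wjet[OF VI_sol_Kset[OF sol]])
  then have qW: "wjet \<Omega> q \<in> jet_closure \<Omega>"
    by (simp add: jet_cone_def)
  \<comment> \<open>Testing with the zero jet. The energy is at least quadratic and the load at most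
    linear in the gradient norm, so one factor cancels.\<close>
  have "energy_form \<Omega> (a\<^sub>c \<beta>) (wjet \<Omega> q) (wjet \<Omega> q) \<le> load_form \<Omega> h0 \<gamma> (wjet \<Omega> q)"
    using VI_sol_jet_cone[OF \<beta> sol zero_jet_cone] by (simp add: energy_form_def load_form_def)
  then have "\<beta> ^ 3 * ?d\<^sup>2 \<le> l2norm M (\<lambda>_. 1::real) * (H + 2 * R * \<bar>\<gamma>\<bar>) * ?d"
    using energy_coercive[OF \<beta> jet_closure_sq_integrable[OF qW]] load_bound[OF qW, of \<gamma>] by linarith
  then have *: "(\<beta> ^ 3 * ?d) * ?d \<le> (l2norm M (\<lambda>_. 1::real) * (H + 2 * R * \<bar>\<gamma>\<bar>)) * ?d"
    by (simp add: power2_eq_square mult.assoc)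
  show ?thesis
  proof (cases "?d = 0")
    case True
    then show ?thesis using H R(2) by simp
  next
    case False
    then have "?d > 0"
      using l2norm_nonneg[of M "\<lambda>x. snd (wjet \<Omega> q x)"] by linarith
    then show ?thesis using * by simp
  qed
qed

text \<open>Each solution is an admissible competitor in the inequality of the other one.\<close>
lemma VI_sol_stability:
  assumes \<beta>: "0 < \<beta>\<^sub>1" "0 < \<beta>\<^sub>2" "\<beta>\<^sub>1 \<le> b" "\<beta>\<^sub>2 \<le> b"
    and sol: "VI_sol \<Omega> h0 \<beta>\<^sub>1 \<gamma>\<^sub>1 q\<^sub>1" "VI_sol \<Omega> h0 \<beta>\<^sub>2 \<gamma>\<^sub>2 q\<^sub>2"
  shows "\<beta>\<^sub>1 ^ 3 * l2norm M (\<lambda>x. snd (wjet \<Omega> q\<^sub>2 x - wjet \<Omega> q\<^sub>1 x))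
    \<le> 3 * (H + b)\<^sup>2 * \<bar>\<beta>\<^sub>1 - \<beta>\<^sub>2\<bar> * l2norm M (\<lambda>x. snd (wjet \<Omega> q\<^sub>2 x))
      + l2norm M (\<lambda>_. 1::real) * (2 * R) * \<bar>\<gamma>\<^sub>1 - \<gamma>\<^sub>2\<bar>"
proof -
  let ?U = "wjet \<Omega> q\<^sub>1" and ?V = "wjet \<Omega> q\<^sub>2" and ?a = "\<lambda>x. a\<^sub>c \<beta>\<^sub>1 x - a\<^sub>c \<beta>\<^sub>2 x"
  let ?D = "\<lambda>x. ?V x - ?U x" and ?E = "\<lambda>x. ?U x - ?V x"
  let ?d = "l2norm M (\<lambda>x. snd (?D x))"
  have U: "?U \<in> jet_cone \<Omega>" and V: "?V \<in> jet_cone \<Omega>"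
    by (rule Kset_wjet[OF VI_sol_Kset[OF sol(1)]], rule Kset_wjet[OF VI_sol_Kset[OF sol(2)]])
  have UW: "?U \<in> jet_closure \<Omega>" and VW: "?V \<in> jet_closure \<Omega>"
    using U V by (simp_all add: jet_cone_def)
  have DW: "?D \<in> jet_closure \<Omega>"
    using jet_closure_lincomb[OF \<Omega> VW UW, of 1 "-1"] by simp
  note sqU = jet_closure_sq_integrable[OF UW] and sqV = jet_closure_sq_integrable[OF VW]
    and sqD = jet_closure_sq_integrable[OF DW]
  have neg: "load_form \<Omega> h0 \<gamma> ?E = - load_form \<Omega> h0 \<gamma> ?D"
    "energy_form \<Omega> a Z ?E = - energy_form \<Omega> a Z ?D" for \<gamma> a Z
  proof -
    have E: "?E x = - ?D x" for x by simp
    show "load_form \<Omega> h0 \<gamma> ?E = - load_form \<Omega> h0 \<gamma> ?D"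
      "energy_form \<Omega> a Z ?E = - energy_form \<Omega> a Z ?D"
      unfolding load_form_def energy_form_def E snd_uminus fst_uminus inner_minus_right
        mult_minus_right Bochner_Integration.integral_minus by (simp_all add: algebra_simps)
  qed
  have "load_form \<Omega> h0 \<gamma>\<^sub>1 ?D \<le> energy_form \<Omega> (a\<^sub>c \<beta>\<^sub>1) ?U ?D"
    by (rule VI_sol_jet_cone[OF \<beta>(1) sol(1) V])
  moreover have "- load_form \<Omega> h0 \<gamma>\<^sub>2 ?D \<le> - energy_form \<Omega> (a\<^sub>c \<beta>\<^sub>2) ?V ?D"
    using VI_sol_jet_cone[OF \<beta>(2) sol(2) U] unfolding neg .
  \<comment> \<open>The h_0 term is common to both parameter pairs and cancels; only the mean of D
    remains.\<close>
  moreover have "load_form \<Omega> h0 \<gamma>\<^sub>1 ?D - load_form \<Omega> h0 \<gamma>\<^sub>2 ?D = (\<gamma>\<^sub>2 - \<gamma>\<^sub>1) * (LINT x|M. fst (?D x))"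
    by (simp add: load_form_def algebra_simps)
  moreover have "energy_form \<Omega> (a\<^sub>c \<beta>\<^sub>1) ?D ?D = energy_form \<Omega> (a\<^sub>c \<beta>\<^sub>1) ?V ?D - energy_form \<Omega> (a\<^sub>c \<beta>\<^sub>1) ?U ?D"
  proof -
    have "energy_form \<Omega> (a\<^sub>c \<beta>\<^sub>1) ?D ?D
        = (LINT x|M. a\<^sub>c \<beta>\<^sub>1 x * (snd (?V x) \<bullet> snd (?D x)) - a\<^sub>c \<beta>\<^sub>1 x * (snd (?U x) \<bullet> snd (?D x)))"
      unfolding energy_form_def
      by (intro Bochner_Integration.integral_cong refl) (simp add: inner_diff_left right_diff_distrib)
    then show ?thesis
      using energy_integrable[OF \<beta>(1) sqV sqD] energy_integrable[OF \<beta>(1) sqU sqD] by (simp add: energy_form_def)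
  qed
  \<comment> \<open>Inserting the energy of V and D with the first weight puts the change of weight
    onto V alone, the solution for the second pair, whose gradient has an a priori bound.\<close>
  moreover have "energy_form \<Omega> (a\<^sub>c \<beta>\<^sub>1) ?V ?D - energy_form \<Omega> (a\<^sub>c \<beta>\<^sub>2) ?V ?D
      = (LINT x|M. ?a x * (snd (?V x) \<bullet> snd (?D x)))"
    unfolding left_diff_distrib energy_form_def
    using energy_integrable[OF \<beta>(1) sqV sqD] energy_integrable[OF \<beta>(2) sqV sqD] by simp
  moreover have "\<bar>LINT x|M. ?a x * (snd (?V x) \<bullet> snd (?D x))\<bar>
      \<le> (3 * (H + b)\<^sup>2 * \<bar>\<beta>\<^sub>1 - \<beta>\<^sub>2\<bar>) * l2norm M (\<lambda>x. snd (?V x)) * ?d"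
  proof (rule weighted_inner(2)[OF _ _ _ sqV sqD])
    show "?a \<in> borel_measurable M"
      by (intro borel_measurable_diff coeff_measurable)
    show "\<bar>?a x\<bar> \<le> 3 * (H + b)\<^sup>2 * \<bar>\<beta>\<^sub>1 - \<beta>\<^sub>2\<bar>" if "x \<in> \<Omega>" for x
      using abs_diff_power3_le[of "h0 x + \<beta>\<^sub>1" "H + b" "h0 x + \<beta>\<^sub>2"] h0_bounds[OF that] \<beta> by simp
  qed simp
  moreover have "\<bar>(\<gamma>\<^sub>2 - \<gamma>\<^sub>1) * (LINT x|M. fst (?D x))\<bar> \<le> \<bar>\<gamma>\<^sub>1 - \<gamma>\<^sub>2\<bar> * (l2norm M (\<lambda>_. 1::real) * (2 * R * ?d))"
    unfolding abs_mult abs_minus_commute[of \<gamma>\<^sub>2] by (intro mult_left_mono mean_bound DW) simp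
  moreover have "\<beta>\<^sub>1 ^ 3 * ?d\<^sup>2 \<le> energy_form \<Omega> (a\<^sub>c \<beta>\<^sub>1) ?D ?D"
    by (rule energy_coercive[OF \<beta>(1) sqD])
  ultimately have "\<beta>\<^sub>1 ^ 3 * ?d\<^sup>2 \<le> (3 * (H + b)\<^sup>2 * \<bar>\<beta>\<^sub>1 - \<beta>\<^sub>2\<bar>) * l2norm M (\<lambda>x. snd (?V x)) * ?d
      + \<bar>\<gamma>\<^sub>1 - \<gamma>\<^sub>2\<bar> * (l2norm M (\<lambda>_. 1::real) * (2 * R * ?d))"
    by linarith
  then have *: "(\<beta>\<^sub>1 ^ 3 * ?d) * ?d \<le> (3 * (H + b)\<^sup>2 * \<bar>\<beta>\<^sub>1 - \<beta>\<^sub>2\<bar> * l2norm M (\<lambda>x. snd (?V x))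
      + l2norm M (\<lambda>_. 1::real) * (2 * R) * \<bar>\<gamma>\<^sub>1 - \<gamma>\<^sub>2\<bar>) * ?d"
    by (simp add: power2_eq_square algebra_simps)
  show ?thesis
  proof (cases "?d = 0")
    case True
    then show ?thesis using R(2) by simp
  next
    case False
    then have "?d > 0"
      using l2norm_nonneg[of M "\<lambda>x. snd (?D x)"] by linarith
    then show ?thesis using * by (simp only: mult_le_cancel_right_pos)
  qed
qed

text \<open>The prefactor turns the distance of gradients into a distance of means and divides by
  the coercivity constant. The second power of \<open>\<beta>\<^sub>0\<close>, inside the
  parentheses, stems from the a priori bound on the gradient of the second solution.\<close>

lemma Gfun_diff_bound:
  assumes \<beta>: "0 < \<beta>\<^sub>0" "\<beta>\<^sub>0 \<le> \<beta>\<^sub>1" "\<beta>\<^sub>0 \<le> \<beta>\<^sub>2" "\<beta>\<^sub>1 \<le> b" "\<beta>\<^sub>2 \<le> b" and \<gamma>: "\<bar>\<gamma>\<^sub>2\<bar> \<le> g"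
  shows "\<bar>Gfun \<Omega> h0 F \<beta>\<^sub>1 \<gamma>\<^sub>1 - Gfun \<Omega> h0 F \<beta>\<^sub>2 \<gamma>\<^sub>2\<bar>
    \<le> l2norm M (\<lambda>_. 1::real) * (2 * R) / \<beta>\<^sub>0 ^ 3 *
      (3 * (H + b)\<^sup>2 * (l2norm M (\<lambda>_. 1::real) * (H + 2 * R * g) / \<beta>\<^sub>0 ^ 3) * \<bar>\<beta>\<^sub>1 - \<beta>\<^sub>2\<bar>
        + l2norm M (\<lambda>_. 1::real) * (2 * R) * \<bar>\<gamma>\<^sub>1 - \<gamma>\<^sub>2\<bar>)"
proof -
  define q\<^sub>1 q\<^sub>2 where "q\<^sub>1 = (SOME q. VI_sol \<Omega> h0 \<beta>\<^sub>1 \<gamma>\<^sub>1 q)" and "q\<^sub>2 = (SOME q. VI_sol \<Omega> h0 \<beta>\<^sub>2 \<gamma>\<^sub>2 q)"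
  define \<omega> where "\<omega> = l2norm M (\<lambda>_. 1::real)"
  have \<omega>: "0 \<le> \<omega>" by (simp add: \<omega>_def)
  have pos: "0 < \<beta>\<^sub>1" "0 < \<beta>\<^sub>2"
    using \<beta> by linarith+
  \<comment> \<open>Existence is all that \<open>SOME\<close> requires; the estimates hold for
    whichever solutions it selects.\<close>
  have sol: "VI_sol \<Omega> h0 \<beta>\<^sub>1 \<gamma>\<^sub>1 q\<^sub>1" "VI_sol \<Omega> h0 \<beta>\<^sub>2 \<gamma>\<^sub>2 q\<^sub>2"
    unfolding q\<^sub>1_def q\<^sub>2_def by (rule someI_ex[OF VI_sol_exists[OF pos(1)]], rule someI_ex[OF VI_sol_exists[OF pos(2)]])
  let ?U = "wjet \<Omega> q\<^sub>1" and ?V = "wjet \<Omega> q\<^sub>2"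
  let ?D = "\<lambda>x. ?V x - ?U x"
  let ?d = "l2norm M (\<lambda>x. snd (?D x))" and ?v = "l2norm M (\<lambda>x. snd (?V x))"
  have UW: "?U \<in> jet_closure \<Omega>" and VW: "?V \<in> jet_closure \<Omega>"
    using Kset_wjet[OF VI_sol_Kset[OF sol(1)]] Kset_wjet[OF VI_sol_Kset[OF sol(2)]]
    by (simp_all add: jet_cone_def)
  have DW: "?D \<in> jet_closure \<Omega>"
    using jet_closure_lincomb[OF \<Omega> VW UW, of 1 "-1"] by simp
  have cube: "\<beta>\<^sub>0 ^ 3 \<le> \<beta>\<^sub>1 ^ 3" "\<beta>\<^sub>0 ^ 3 \<le> \<beta>\<^sub>2 ^ 3" "0 < \<beta>\<^sub>0 ^ 3"
    using \<beta> by (simp_all add: power_mono)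
  have "\<beta>\<^sub>0 ^ 3 * ?v \<le> \<beta>\<^sub>2 ^ 3 * ?v"
    by (intro mult_right_mono cube) simp
  also have "\<dots> \<le> \<omega> * (H + 2 * R * \<bar>\<gamma>\<^sub>2\<bar>)"
    unfolding \<omega>_def by (rule VI_sol_energy_bound[OF pos(2) sol(2)])
  also have "\<dots> \<le> \<omega> * (H + 2 * R * g)"
    using \<gamma> R(2) by (intro mult_left_mono add_left_mono \<omega>) auto
  finally have v: "?v \<le> \<omega> * (H + 2 * R * g) / \<beta>\<^sub>0 ^ 3"
    using cube(3) by (simp add: pos_le_divide_eq mult.commute)
  have "\<beta>\<^sub>0 ^ 3 * ?d \<le> \<beta>\<^sub>1 ^ 3 * ?d"
    by (intro mult_right_mono cube) simp
  also have "\<dots> \<le> 3 * (H + b)\<^sup>2 * \<bar>\<beta>\<^sub>1 - \<beta>\<^sub>2\<bar> * ?v + \<omega> * (2 * R) * \<bar>\<gamma>\<^sub>1 - \<gamma>\<^sub>2\<bar>"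
    unfolding \<omega>_def by (rule VI_sol_stability[OF pos \<beta>(4,5) sol])
  also have "\<dots> \<le> 3 * (H + b)\<^sup>2 * \<bar>\<beta>\<^sub>1 - \<beta>\<^sub>2\<bar> * (\<omega> * (H + 2 * R * g) / \<beta>\<^sub>0 ^ 3) + \<omega> * (2 * R) * \<bar>\<gamma>\<^sub>1 - \<gamma>\<^sub>2\<bar>"
    by (intro add_right_mono mult_left_mono v) simp
  finally have d: "?d \<le> (3 * (H + b)\<^sup>2 * (\<omega> * (H + 2 * R * g) / \<beta>\<^sub>0 ^ 3) * \<bar>\<beta>\<^sub>1 - \<beta>\<^sub>2\<bar>
      + \<omega> * (2 * R) * \<bar>\<gamma>\<^sub>1 - \<gamma>\<^sub>2\<bar>) / \<beta>\<^sub>0 ^ 3"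
    using cube(3) by (simp add: pos_le_divide_eq mult_ac)
  have "Gfun \<Omega> h0 F \<beta>\<^sub>2 \<gamma>\<^sub>2 - Gfun \<Omega> h0 F \<beta>\<^sub>1 \<gamma>\<^sub>1 = (LINT x|M. fst (?V x)) - (LINT x|M. fst (?U x))"
    unfolding Gfun_def q\<^sub>1_def[symmetric] q\<^sub>2_def[symmetric] wjet_def fst_conv by simp
  also have "\<dots> = (LINT x|M. fst (?D x))"
    using load_integrable(2)[OF jet_closure_sq_integrable[OF VW]] load_integrable(2)[OF jet_closure_sq_integrable[OF UW]]
    by simp
  finally have "\<bar>Gfun \<Omega> h0 F \<beta>\<^sub>1 \<gamma>\<^sub>1 - Gfun \<Omega> h0 F \<beta>\<^sub>2 \<gamma>\<^sub>2\<bar> = \<bar>LINT x|M. fst (?D x)\<bar>"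
    by linarith
  also have "\<dots> \<le> \<omega> * (2 * R) * ?d"
    using mean_bound[OF DW] by (simp add: \<omega>_def mult.assoc)
  also have "\<dots> \<le> \<omega> * (2 * R) * ((3 * (H + b)\<^sup>2 * (\<omega> * (H + 2 * R * g) / \<beta>\<^sub>0 ^ 3) * \<bar>\<beta>\<^sub>1 - \<beta>\<^sub>2\<bar>
      + \<omega> * (2 * R) * \<bar>\<gamma>\<^sub>1 - \<gamma>\<^sub>2\<bar>) / \<beta>\<^sub>0 ^ 3)"
    using R(2) by (intro mult_left_mono d mult_nonneg_nonneg \<omega>) auto
  finally show ?thesis
    by (simp add: \<omega>_def)
qed

lemma Gfun_locally_lipschitz:
  "locally_lipschitz_on ({0<..} \<times> UNIV) (\<lambda>(\<beta>, \<gamma>). Gfun \<Omega> h0 F \<beta> \<gamma>)"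
  unfolding locally_lipschitz_on_def
proof
  fix z :: pt assume "z \<in> {0<..} \<times> UNIV"
  then obtain \<beta> \<gamma> where z: "z = (\<beta>, \<gamma>)" and \<beta>: "0 < \<beta>"
    by auto
  define \<omega> where "\<omega> = l2norm M (\<lambda>_. 1::real)"
  \<comment> \<open>The constants of \<open>Gfun_diff_bound\<close> on a ball of radius \<beta> / 2,
    where \<beta> / 2 and 2 \<beta> bound the first coordinate and |\<gamma>| + \<beta> bounds the
    modulus of the second.\<close>
  define c\<^sub>0 c\<^sub>1 c\<^sub>2 where "c\<^sub>0 = \<omega> * (2 * R) / (\<beta> / 2) ^ 3"
    and "c\<^sub>1 = 3 * (H + 2 * \<beta>)\<^sup>2 * (\<omega> * (H + 2 * R * (\<bar>\<gamma>\<bar> + \<beta>)) / (\<beta> / 2) ^ 3)" and "c\<^sub>2 = \<omega> * (2 * R)"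
  have nonneg: "0 \<le> c\<^sub>0" "0 \<le> c\<^sub>1" "0 \<le> c\<^sub>2"
    using R(2) H \<beta> by (simp_all add: c\<^sub>0_def c\<^sub>1_def c\<^sub>2_def \<omega>_def)
  have "(c\<^sub>0 * (c\<^sub>1 + c\<^sub>2))-lipschitz_on (ball z (\<beta> / 2) \<inter> {0<..} \<times> UNIV) (\<lambda>(\<beta>, \<gamma>). Gfun \<Omega> h0 F \<beta> \<gamma>)"
  proof (rule lipschitz_onI)
    fix x y assume x: "x \<in> ball z (\<beta> / 2) \<inter> {0<..} \<times> UNIV" and y: "y \<in> ball z (\<beta> / 2) \<inter> {0<..} \<times> UNIV"
    obtain \<beta>\<^sub>1 \<gamma>\<^sub>1 where x_eq: "x = (\<beta>\<^sub>1, \<gamma>\<^sub>1)" by (cases x)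
    obtain \<beta>\<^sub>2 \<gamma>\<^sub>2 where y_eq: "y = (\<beta>\<^sub>2, \<gamma>\<^sub>2)" by (cases y)
    have "\<bar>\<beta> - \<beta>\<^sub>1\<bar> < \<beta> / 2" "\<bar>\<beta> - \<beta>\<^sub>2\<bar> < \<beta> / 2" "\<bar>\<gamma> - \<gamma>\<^sub>2\<bar> < \<beta> / 2"
      using x y dist_fst_le[of z x] dist_fst_le[of z y] dist_snd_le[of z y]
      by (simp_all add: z x_eq y_eq dist_real_def)
    then have b: "\<beta> / 2 \<le> \<beta>\<^sub>1" "\<beta> / 2 \<le> \<beta>\<^sub>2" "\<beta>\<^sub>1 \<le> 2 * \<beta>" "\<beta>\<^sub>2 \<le> 2 * \<beta>" "\<bar>\<gamma>\<^sub>2\<bar> \<le> \<bar>\<gamma>\<bar> + \<beta>"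
      by linarith+
    have "dist (Gfun \<Omega> h0 F \<beta>\<^sub>1 \<gamma>\<^sub>1) (Gfun \<Omega> h0 F \<beta>\<^sub>2 \<gamma>\<^sub>2) \<le> c\<^sub>0 * (c\<^sub>1 * \<bar>\<beta>\<^sub>1 - \<beta>\<^sub>2\<bar> + c\<^sub>2 * \<bar>\<gamma>\<^sub>1 - \<gamma>\<^sub>2\<bar>)"
      unfolding dist_real_def c\<^sub>0_def c\<^sub>1_def c\<^sub>2_def \<omega>_def
      by (rule Gfun_diff_bound[OF _ b]) (use \<beta> in simp)
    also have "\<dots> \<le> c\<^sub>0 * (c\<^sub>1 * dist x y + c\<^sub>2 * dist x y)"
    proof -
      have "\<bar>\<beta>\<^sub>1 - \<beta>\<^sub>2\<bar> \<le> dist x y" "\<bar>\<gamma>\<^sub>1 - \<gamma>\<^sub>2\<bar> \<le> dist x y"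
        using dist_fst_le[of x y] dist_snd_le[of x y] unfolding x_eq y_eq fst_conv snd_conv dist_real_def .
      then show ?thesis
        by (intro mult_left_mono[OF _ nonneg(1)] add_mono mult_left_mono[OF _ nonneg(2)] mult_left_mono[OF _ nonneg(3)])
    qed
    finally show "dist (case x of (\<beta>, \<gamma>) \<Rightarrow> Gfun \<Omega> h0 F \<beta> \<gamma>) (case y of (\<beta>, \<gamma>) \<Rightarrow> Gfun \<Omega> h0 F \<beta> \<gamma>)
        \<le> c\<^sub>0 * (c\<^sub>1 + c\<^sub>2) * dist x y"
      unfolding x_eq y_eq prod.case distrib_left distrib_right mult.assoc .
  qed (use nonneg in simp)
  then show "\<exists>r>0. \<exists>L. L-lipschitz_on (ball z r \<inter> {0<..} \<times> UNIV) (\<lambda>(\<beta>, \<gamma>). Gfun \<Omega> h0 F \<beta> \<gamma>)"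
    using half_gt_zero[OF \<beta>] by blast
qed

end

section \<open>Local solutions of Lipschitz differential equations\<close>

text \<open>The solution is the fixed point of the integral operator, which contracts the sup
  distance by the factor L T.\<close>

lemma lipschitz_ode_exists:
  fixes F :: "'a::euclidean_space \<Rightarrow> 'a"
  assumes F: "L-lipschitz_on UNIV F" and T: "0 \<le> T" "L * T < 1"
  obtains z where "z 0 = z0" "\<And>t. t \<in> {0..T} \<Longrightarrow> (z has_vector_derivative F (z t)) (at t within {0..T})"
proof -
  have L: "0 \<le> L"
    using F by (rule lipschitz_on_nonneg)
  \<comment> \<open>The type of bounded continuous functions has the whole line as domain, so time
    is clamped to [0, T] and the fixed point is constant outside.\<close>
  define c where "c t = max 0 (min T t)" for t :: real
  have c_range: "0 \<le> c t" "c t \<le> T" for t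
    using T(1) by (auto simp: c_def)
  have c_cont: "continuous_on UNIV c"
    unfolding c_def by (intro continuous_intros)
  have c_id: "c t = t" if "t \<in> {0..T}" for t
    using that by (auto simp: c_def)
  define I where "I g t = z0 + integral {0..c t} (\<lambda>s. F (apply_bcontfun g s))" for g t
  have F_cont: "continuous_on S (\<lambda>s. F (apply_bcontfun g s))" for g S
    using lipschitz_on_continuous_on[OF F] by (rule continuous_on_compose2) auto
  have I_cont': "continuous_on {0..T} (\<lambda>t. integral {0..t} (\<lambda>s. F (apply_bcontfun g s)))" for g
    by (intro indefinite_integral_continuous_1 integrable_continuous_real F_cont)
  have I_bcont: "I g \<in> bcontfun" for g
  proof -
    have "continuous_on UNIV (\<lambda>t. integral {0..c t} (\<lambda>s. F (apply_bcontfun g s)))"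
      by (rule continuous_on_compose2[OF I_cont' c_cont]) (use c_range in auto)
    then have "continuous_on UNIV (I g)"
      unfolding I_def by (intro continuous_on_add continuous_on_const)
    moreover have "bounded (range (I g))"
    proof -
      have "compact ((\<lambda>t. z0 + integral {0..t} (\<lambda>s. F (apply_bcontfun g s))) ` {0..T})"
        by (intro compact_continuous_image continuous_on_add continuous_on_const I_cont' compact_Icc)
      moreover have "range (I g) \<subseteq> (\<lambda>t. z0 + integral {0..t} (\<lambda>s. F (apply_bcontfun g s))) ` {0..T}"
        using c_range by (auto simp: I_def)
      ultimately show ?thesis
        by (meson bounded_subset compact_imp_bounded)
    qed
    ultimately show ?thesis
      by (simp add: bcontfun_def)
  qed
  have "\<exists>!g. Bcontfun (I g) = g"
  proof (rule banach_fix_type)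
    show "0 \<le> L * T" "L * T < 1"
      using L T by auto
    show "\<forall>f g. dist (Bcontfun (I f)) (Bcontfun (I g)) \<le> L * T * dist f g"
    proof (intro allI dist_bound)
      fix f g :: "real \<Rightarrow>\<^sub>C 'a" and t
      have "dist (apply_bcontfun (Bcontfun (I f)) t) (apply_bcontfun (Bcontfun (I g)) t) = norm (I f t - I g t)"
        by (simp add: Bcontfun_inverse[OF I_bcont] dist_norm)
      also have "I f t - I g t = integral {0..c t} (\<lambda>s. F (apply_bcontfun f s) - F (apply_bcontfun g s))"
        unfolding I_def using integral_diff[OF integrable_continuous_real[OF F_cont] integrable_continuous_real[OF F_cont]]
        by simp
      also have "norm \<dots> \<le> L * dist f g * (c t - 0)"
      proof (rule integral_bound)
        show "continuous_on {0..c t} (\<lambda>s. F (apply_bcontfun f s) - F (apply_bcontfun g s))"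
          by (intro continuous_on_diff F_cont)
        show "norm (F (apply_bcontfun f s) - F (apply_bcontfun g s)) \<le> L * dist f g" for s
        proof -
          have "norm (F (apply_bcontfun f s) - F (apply_bcontfun g s)) \<le> L * dist (apply_bcontfun f s) (apply_bcontfun g s)"
            using lipschitz_onD[OF F] by (simp add: dist_norm)
          also have "\<dots> \<le> L * dist f g"
            by (intro mult_left_mono dist_bounded L)
          finally show ?thesis .
        qed
      qed (rule c_range)
      also have "\<dots> \<le> L * dist f g * T"
        using c_range[of t] L by (intro mult_left_mono) auto
      finally show "dist (apply_bcontfun (Bcontfun (I f)) t) (apply_bcontfun (Bcontfun (I g)) t) \<le> L * T * dist f g"
        by (simp add: mult_ac)
    qed
  qed
  then obtain g where g: "Bcontfun (I g) = g"
    by blast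
  define z where "z = apply_bcontfun g"
  have z_eq: "z t = I g t" for t
    unfolding z_def by (subst g[symmetric]) (simp add: Bcontfun_inverse[OF I_bcont])
  show thesis
  proof
    have "c 0 = 0"
      using T(1) by (simp add: c_def)
    then show "z 0 = z0"
      by (simp add: z_eq I_def)
    fix t assume t: "t \<in> {0..T}"
    have "((\<lambda>t. integral {0..t} (\<lambda>s. F (apply_bcontfun g s))) has_vector_derivative F (apply_bcontfun g t)) (at t within {0..T})"
      by (rule integral_has_vector_derivative[OF F_cont t])
    from has_vector_derivative_add[OF has_vector_derivative_const[of z0] this]
    have "((\<lambda>t. z0 + integral {0..t} (\<lambda>s. F (apply_bcontfun g s))) has_vector_derivative F (z t)) (at t within {0..T})"
      by (simp add: z_def)
    then show "(z has_vector_derivative F (z t)) (at t within {0..T})"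
      by (rule has_vector_derivative_transform[OF t, rotated]) (simp add: z_eq I_def c_id)
  qed
qed

text \<open>Gronwall's argument: the squared distance grows at rate at most 2 L, so after
  multiplication by exp (- 2 L t) it cannot increase, and it starts at 0.\<close>

lemma lipschitz_ode_unique:
  fixes F :: "'a::euclidean_space \<Rightarrow> 'a"
  assumes F: "L-lipschitz_on S F" and start: "u 0 = v 0"
    and u: "\<And>t. t \<in> {0..T} \<Longrightarrow> (u has_vector_derivative F (u t)) (at t within {0..T})" "\<And>t. t \<in> {0..T} \<Longrightarrow> u t \<in> S"
    and v: "\<And>t. t \<in> {0..T} \<Longrightarrow> (v has_vector_derivative F (v t)) (at t within {0..T})" "\<And>t. t \<in> {0..T} \<Longrightarrow> v t \<in> S"
    and t: "t \<in> {0..T}"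
  shows "u t = v t"
proof -
  define D where "D s = (u s - v s) \<bullet> (u s - v s)" for s
  define E where "E s = exp (- (2 * L) * s) * D s" for s
  define E' where "E' s = exp (- (2 * L) * s) * (2 * ((F (u s) - F (v s)) \<bullet> (u s - v s)) - 2 * L * D s)" for s
  have deriv: "(E has_derivative (\<lambda>h. h * E' s)) (at s within {0..t})" if "s \<in> {0..t}" for s
  proof -
    have sT: "s \<in> {0..T}" "{0..t} \<subseteq> {0..T}"
      using that t by auto
    have "((\<lambda>s. u s - v s) has_derivative (\<lambda>h. h *\<^sub>R (F (u s) - F (v s)))) (at s within {0..t})"
      using has_vector_derivative_diff[OF u(1)[OF sT(1)] v(1)[OF sT(1)]] sT(2)
      unfolding has_vector_derivative_def by (rule has_derivative_subset)
    from has_derivative_inner[OF this this]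
    have "(D has_derivative (\<lambda>h. (u s - v s) \<bullet> (h *\<^sub>R (F (u s) - F (v s))) + (h *\<^sub>R (F (u s) - F (v s))) \<bullet> (u s - v s))) (at s within {0..t})"
      unfolding D_def .
    moreover have "((\<lambda>s. exp (- (2 * L) * s)) has_derivative (\<lambda>h. exp (- (2 * L) * s) * (- (2 * L) * h))) (at s within {0..t})"
      by (auto intro!: derivative_eq_intros)
    ultimately have "(E has_derivative (\<lambda>h. exp (- (2 * L) * s) * ((u s - v s) \<bullet> (h *\<^sub>R (F (u s) - F (v s)))
        + (h *\<^sub>R (F (u s) - F (v s))) \<bullet> (u s - v s)) + exp (- (2 * L) * s) * (- (2 * L) * h) * D s)) (at s within {0..t})"
      unfolding E_def by (intro has_derivative_mult)
    then show ?thesis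
      by (rule has_derivative_eq_rhs) (simp add: E'_def fun_eq_iff inner_commute algebra_simps)
  qed
  have "0 \<le> t" using t by simp
  obtain s where s: "s \<in> {0..t}" "E t - E 0 = (t - 0) * E' s"
    using mvt_very_simple[OF \<open>0 \<le> t\<close>, of E "\<lambda>s h. h * E' s"] deriv by auto
  have "E' s \<le> 0"
  proof -
    have sT: "s \<in> {0..T}" using s(1) t by simp
    have "(F (u s) - F (v s)) \<bullet> (u s - v s) \<le> norm (F (u s) - F (v s)) * norm (u s - v s)"
      by (rule norm_cauchy_schwarz)
    also have "\<dots> \<le> L * norm (u s - v s) * norm (u s - v s)"
      using lipschitz_onD[OF F u(2)[OF sT] v(2)[OF sT]] by (intro mult_right_mono) (auto simp: dist_norm)
    also have "\<dots> = L * D s"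
      by (simp add: D_def power2_norm_eq_inner[symmetric] power2_eq_square)
    finally show ?thesis
      unfolding E'_def by (intro mult_nonneg_nonpos) auto
  qed
  from mult_nonneg_nonpos[OF \<open>0 \<le> t\<close> this] have "E t \<le> E 0"
    using s(2) by simp
  also have "E 0 = 0"
    by (simp add: E_def D_def start)
  finally have "D t \<le> 0"
    by (simp add: E_def mult_le_0_iff)
  then show ?thesis
    using inner_gt_zero_iff[of "u t - v t"] by (auto simp: D_def not_less[symmetric])
qed

text \<open>The bound on f is available only inside the ball, hence the first exit time s: until
  then the speed is at most B, so at time s the solution has moved by at most B T < r and is still
  inside.\<close>

lemma ode_solution_in_ball:
  fixes f :: "'a::euclidean_space \<Rightarrow> 'a"
  assumes f: "\<And>x. x \<in> ball z0 r \<Longrightarrow> norm (f x) \<le> B" and T: "B * T < r" "0 \<le> B"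
    and z: "z 0 = z0" "\<And>t. t \<in> {0..T} \<Longrightarrow> (z has_vector_derivative f (z t)) (at t within {0..T})"
    and t: "t \<in> {0..T}"
  shows "z t \<in> ball z0 r"
proof (rule ccontr)
  assume "z t \<notin> ball z0 r"
  define S where "S = {0..T} \<inter> z -` (- ball z0 r)"
  have z_cont: "continuous_on {0..T} z"
    unfolding continuous_on_eq_continuous_within
    using has_vector_derivative_continuous[OF z(2)] by blast
  have "closed S"
    unfolding S_def by (rule continuous_closed_preimage[OF z_cont]) (auto simp: closed_Compl)
  have "0 \<le> T" "B * T \<ge> 0"
    using t T by auto
  then have "r > 0" using T(1) by linarith
  have "S \<noteq> {}" "bdd_below S"
    using t \<open>z t \<notin> ball z0 r\<close> by (auto simp: S_def)
  define s where "s = Inf S"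
  have sS: "s \<in> S"
    unfolding s_def by (rule closed_contains_Inf) fact+
  have before: "z x \<in> ball z0 r" if "0 \<le> x" "x < s" for x
  proof (rule ccontr)
    assume "z x \<notin> ball z0 r"
    then have "x \<in> S"
      using that sS by (auto simp: S_def)
    then have "s \<le> x"
      unfolding s_def by (rule cInf_lower) fact
    then show False using that by simp
  qed
  have "s \<noteq> 0"
    using sS z(1) \<open>r > 0\<close> by (auto simp: S_def)
  then have s: "0 < s" "s \<le> T"
    using sS by (auto simp: S_def)
  obtain x where x: "x \<in> {0<..<s}" "norm (z s - z 0) \<le> norm ((s - 0) *\<^sub>R f (z x))"
  proof -
    have "(z has_derivative (\<lambda>h. h *\<^sub>R f (z x))) (at x)" if "0 < x" "x < s" for x
    proof -
      have "(z has_vector_derivative f (z x)) (at x within {0..T})"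
        using that s by (intro z(2)) auto
      then have "(z has_vector_derivative f (z x)) (at x within {0<..<s})"
        by (rule has_vector_derivative_within_subset) (use s in auto)
      then show ?thesis
        using that by (simp add: has_vector_derivative_def at_within_open[of x "{0<..<s}"])
    qed
    moreover have "continuous_on {0..s} z"
      using z_cont by (rule continuous_on_subset) (use s in auto)
    ultimately show thesis
      using mvt_general[OF s(1), of z "\<lambda>x h. h *\<^sub>R f (z x)"] that by blast
  qed
  have "norm (z s - z 0) \<le> s * B"
    using x f[OF before[of x]] s by (simp add: order_trans[OF x(2)] mult_left_mono)
  also have "\<dots> \<le> B * T"
    using s T(2) by (simp add: mult.commute mult_left_mono)
  finally have "z s \<in> ball z0 r"
    using T(1) z(1) by (simp add: dist_norm norm_minus_commute)
  then show False
    using sS by (simp add: S_def)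
qed

lemma local_picard_lindeloef:
  fixes f :: "'a::euclidean_space \<Rightarrow> 'a"
  assumes r: "r > 0" and f: "L-lipschitz_on (cball z0 r) f"
  obtains T z where "T > 0" "z 0 = z0"
    "\<And>t. t \<in> {0..T} \<Longrightarrow> (z has_vector_derivative f (z t)) (at t within {0..T})"
    "\<And>t. t \<in> {0..T} \<Longrightarrow> z t \<in> ball z0 r"
    "\<And>T' w t. \<lbrakk>T' \<le> T; w 0 = z0; \<And>t. t \<in> {0..T'} \<Longrightarrow> (w has_vector_derivative f (w t)) (at t within {0..T'}); t \<in> {0..T'}\<rbrakk>
      \<Longrightarrow> w t = z t"
proof -
  have L: "0 \<le> L"
    using f by (rule lipschitz_on_nonneg)
  obtain B where B: "\<And>x. x \<in> cball z0 r \<Longrightarrow> norm (f x) \<le> B" "B > 0"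
    using compact_imp_bounded[OF compact_continuous_image[OF lipschitz_on_continuous_on[OF f] compact_cball]]
    unfolding bounded_pos by blast
  \<comment> \<open>Nearest-point projection onto the convex ball is 1-Lipschitz, so F extends f to
    the whole space with the same constant L and is bounded by B everywhere.\<close>
  define F where "F x = f (closest_point (cball z0 r) x)" for x
  have cp: "closest_point (cball z0 r) x \<in> cball z0 r" for x
    using r by (intro closest_point_in_set) auto
  have F_eq: "F x = f x" if "x \<in> cball z0 r" for x
    using closest_point_self[OF that] by (simp add: F_def)
  have F_lip: "L-lipschitz_on UNIV F"
  proof (rule lipschitz_onI)
    fix x y
    have "dist (F x) (F y) \<le> L * dist (closest_point (cball z0 r) x) (closest_point (cball z0 r) y)"
      unfolding F_def by (rule lipschitz_onD[OF f cp cp])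
    also have "\<dots> \<le> L * dist x y"
      using r by (intro mult_left_mono closest_point_lipschitz L) auto
    finally show "dist (F x) (F y) \<le> L * dist x y" .
  qed (rule L)
  \<comment> \<open>The first term keeps solutions inside the ball, where F and f agree; the second
    makes L T < 1, with L + 1 instead of L in case L = 0.\<close>
  define T where "T = min (r / (2 * B)) (1 / (2 * (L + 1)))"
  have T: "T > 0"
    using r B(2) L by (simp add: T_def)
  have "B * T \<le> B * (r / (2 * B))"
    using B(2) by (intro mult_left_mono) (auto simp: T_def)
  also have "\<dots> < r"
    using B(2) r by simp
  finally have BT: "B * T < r" .
  have "L * T \<le> L * (1 / (2 * (L + 1)))"
    using L by (intro mult_left_mono) (auto simp: T_def)
  also have "\<dots> < 1"
    using L by (simp add: field_simps)
  finally have LT: "L * T < 1" .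
  obtain z where z: "z 0 = z0" "\<And>t. t \<in> {0..T} \<Longrightarrow> (z has_vector_derivative F (z t)) (at t within {0..T})"
    using lipschitz_ode_exists[OF F_lip less_imp_le[OF T] LT] by metis
  have bF: "norm (F x) \<le> B" for x
    unfolding F_def by (rule B(1)[OF cp])
  have z_ball: "z t \<in> ball z0 r" if "t \<in> {0..T}" for t
    by (rule ode_solution_in_ball[OF bF BT less_imp_le[OF B(2)] z that])
  have z_deriv: "(z has_vector_derivative f (z t)) (at t within {0..T})" if "t \<in> {0..T}" for t
    using z(2)[OF that] F_eq[of "z t"] z_ball[OF that] by simp
  \<comment> \<open>The competitor w is not assumed to stay in the ball. The speed bound traps it
    there, and only then does the Lipschitz condition apply to it.\<close>
  have unique: "w t = z t"
    if T': "T' \<le> T" and w: "w 0 = z0" "\<And>t. t \<in> {0..T'} \<Longrightarrow> (w has_vector_derivative f (w t)) (at t within {0..T'})"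
      and t: "t \<in> {0..T'}" for T' w t
  proof (rule lipschitz_ode_unique[OF f _ w(2) _ _ _ t])
    show "w 0 = z 0"
      using w(1) z(1) by simp
    have "B * T' \<le> B * T"
      using T' B(2) by simp
    then have BT': "B * T' < r"
      using BT by linarith
    have "norm (f x) \<le> B" if "x \<in> ball z0 r" for x
      using B(1)[of x] that by simp
    from ode_solution_in_ball[OF this BT' less_imp_le[OF B(2)] w]
    show "w s \<in> cball z0 r" if "s \<in> {0..T'}" for s
      using that ball_subset_cball by blast
    fix s assume s: "s \<in> {0..T'}"
    then have sT: "s \<in> {0..T}" "{0..T'} \<subseteq> {0..T}"
      using T' by auto
    show "(z has_vector_derivative f (z s)) (at s within {0..T'})"
      by (rule has_vector_derivative_within_subset[OF z_deriv[OF sT(1)] sT(2)])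
    show "z s \<in> cball z0 r"
      using z_ball[OF sT(1)] ball_subset_cball by blast
  qed
  show thesis
  proof (rule that[of T z])
    show "w t = z t"
      if "T' \<le> T" "w 0 = z0" "\<And>t. t \<in> {0..T'} \<Longrightarrow> (w has_vector_derivative f (w t)) (at t within {0..T'})"
        "t \<in> {0..T'}" for T' w t
      by (rule unique[OF that])
  qed (fact T z(1) z_deriv z_ball)+
qed

section \<open>The second-order problem as a planar first-order system\<close>

lemma ode_sol_iff:
  "ode_sol G a b T \<eta> \<eta>' \<longleftrightarrow> (\<eta> 0, \<eta>' 0) = (a, b) \<and> (\<forall>t\<in>{0..T}. \<eta> t > 0 \<and>
    ((\<lambda>t. (\<eta> t, \<eta>' t)) has_vector_derivative (\<eta>' t, G (\<eta> t) (\<eta>' t))) (at t within {0..T}))"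
proof -
  have "((\<lambda>t. (\<eta> t, \<eta>' t)) has_vector_derivative (p, q)) (at t within S) \<longleftrightarrow>
      (\<eta> has_real_derivative p) (at t within S) \<and> (\<eta>' has_real_derivative q) (at t within S)" for p q t S
  proof
    assume "((\<lambda>t. (\<eta> t, \<eta>' t)) has_vector_derivative (p, q)) (at t within S)"
    from bounded_linear.has_vector_derivative[OF bounded_linear_fst this]
      bounded_linear.has_vector_derivative[OF bounded_linear_snd this]
    show "(\<eta> has_real_derivative p) (at t within S) \<and> (\<eta>' has_real_derivative q) (at t within S)"
      by (simp add: has_real_derivative_iff_has_vector_derivative)
  next
    assume "(\<eta> has_real_derivative p) (at t within S) \<and> (\<eta>' has_real_derivative q) (at t within S)"
    then show "((\<lambda>t. (\<eta> t, \<eta>' t)) has_vector_derivative (p, q)) (at t within S)"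
      by (simp add: has_real_derivative_iff_has_vector_derivative has_vector_derivative_Pair)
  qed
  then show ?thesis
    by (auto simp: ode_sol_def)
qed

lemma cauchy_problem_local:
  assumes G: "locally_lipschitz_on ({0<..} \<times> UNIV) (\<lambda>(\<beta>, \<gamma>). G \<beta> \<gamma>)" and a: "a > 0"
  shows "\<exists>T > 0. \<exists>\<eta> \<eta>'. ode_sol G a b T \<eta> \<eta>' \<and>
    (\<forall>T' \<in> {0<..T}. \<forall>\<zeta> \<zeta>'. ode_sol G a b T' \<zeta> \<zeta>' \<longrightarrow> (\<forall>t\<in>{0..T'}. \<zeta> t = \<eta> t))"
proof -
  obtain r\<^sub>0 L where r\<^sub>0: "r\<^sub>0 > 0" and lip: "L-lipschitz_on (ball (a, b) r\<^sub>0 \<inter> {0<..} \<times> UNIV) (\<lambda>(\<beta>, \<gamma>). G \<beta> \<gamma>)"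
    using G a unfolding locally_lipschitz_on_def by (metis SigmaI UNIV_I greaterThan_iff)
  \<comment> \<open>The bound a / 2 keeps the closed ball in the open right half plane, which gives
    positivity of the solution; \<open>r\<^sub>0 / 2\<close> makes the closed ball fit into the open
    one.\<close>
  define r where "r = min (r\<^sub>0 / 2) (a / 2)"
  have r: "r > 0" "r < r\<^sub>0" "r < a"
    using r\<^sub>0 a by (auto simp: r_def)
  have sub: "x \<in> ball (a, b) r\<^sub>0 \<inter> {0<..} \<times> UNIV" if "x \<in> cball (a, b) r" for x
  proof -
    have "dist a (fst x) \<le> r"
      using dist_fst_le[of "(a, b)" x] that by simp
    then have "0 < fst x"
      using r by (simp add: dist_real_def)
    then show ?thesis
      using that r by (simp add: mem_Times_iff)
  qed
  define f where "f x = (snd x, G (fst x) (snd x))" for x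
  \<comment> \<open>The component \<eta>' of the vector field contributes 1 and G contributes
    L.\<close>
  have "(1 + L)-lipschitz_on (cball (a, b) r) f"
  proof (rule lipschitz_onI)
    fix x y assume xy: "x \<in> cball (a, b) r" "y \<in> cball (a, b) r"
    have "dist (f x) (f y) \<le> dist (snd x) (snd y) + dist (G (fst x) (snd x)) (G (fst y) (snd y))"
      unfolding f_def dist_Pair_Pair by (rule sqrt_sum_squares_le_sum) simp_all
    also have "dist (snd x) (snd y) \<le> dist x y"
      by (rule dist_snd_le)
    also have "dist (G (fst x) (snd x)) (G (fst y) (snd y)) \<le> L * dist x y"
      using lipschitz_onD[OF lip sub[OF xy(1)] sub[OF xy(2)]] by (simp add: case_prod_unfold)
    finally show "dist (f x) (f y) \<le> (1 + L) * dist x y"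
      by (simp add: distrib_right)
  qed (use lipschitz_on_nonneg[OF lip] in simp)
  then obtain T z where T: "T > 0" and z: "z 0 = (a, b)"
      "\<And>t. t \<in> {0..T} \<Longrightarrow> (z has_vector_derivative f (z t)) (at t within {0..T})"
      "\<And>t. t \<in> {0..T} \<Longrightarrow> z t \<in> ball (a, b) r"
    and unique: "\<And>T' w t. \<lbrakk>T' \<le> T; w 0 = (a, b);
      \<And>t. t \<in> {0..T'} \<Longrightarrow> (w has_vector_derivative f (w t)) (at t within {0..T'}); t \<in> {0..T'}\<rbrakk> \<Longrightarrow> w t = z t"
    by (rule local_picard_lindeloef[OF r(1)]) blast
  let ?\<eta> = "\<lambda>t. fst (z t)" and ?\<eta>' = "\<lambda>t. snd (z t)"
  have "ode_sol G a b T ?\<eta> ?\<eta>'"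
    unfolding ode_sol_iff
  proof (intro conjI ballI)
    show "(?\<eta> 0, ?\<eta>' 0) = (a, b)"
      by (simp add: z(1))
    fix t assume t: "t \<in> {0..T}"
    have "z t \<in> cball (a, b) r"
      using z(3)[OF t] ball_subset_cball by blast
    from sub[OF this] show "0 < ?\<eta> t"
      by (simp add: mem_Times_iff)
    show "((\<lambda>t. (?\<eta> t, ?\<eta>' t)) has_vector_derivative (?\<eta>' t, G (?\<eta> t) (?\<eta>' t))) (at t within {0..T})"
      using z(2)[OF t] by (simp add: f_def)
  qed
  moreover have "\<zeta> t = ?\<eta> t" if T': "T' \<in> {0<..T}" and sol: "ode_sol G a b T' \<zeta> \<zeta>'" and t: "t \<in> {0..T'}" for T' \<zeta> \<zeta>' t
  proof -
    have "(\<zeta> t, \<zeta>' t) = z t"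
    proof (rule unique[of T' "\<lambda>t. (\<zeta> t, \<zeta>' t)", OF _ _ _ t])
      show "T' \<le> T" using T' by simp
      show "(\<zeta> 0, \<zeta>' 0) = (a, b)"
        using sol[unfolded ode_sol_iff] by (rule conjunct1)
      show "((\<lambda>t. (\<zeta> t, \<zeta>' t)) has_vector_derivative f (\<zeta> s, \<zeta>' s)) (at s within {0..T'})" if "s \<in> {0..T'}" for s
        using conjunct2[OF sol[unfolded ode_sol_iff]] that by (simp add: f_def)
    qed
    then show ?thesis
      by (metis fst_conv)
  qed
  ultimately show ?thesis
    using T by (intro exI[of _ T] conjI exI[of _ ?\<eta>] exI[of _ ?\<eta>']) blast+
qed

section \<open>Local Lipschitz continuity and the Cauchy problem\<close>

theorem theorem2p1:
  fixes \<Omega> :: "(real \<times> real) set" and h0 :: "real \<times> real \<Rightarrow> real" and F :: real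
  assumes "open \<Omega>" and "bounded \<Omega>" and "C1_boundary \<Omega>" and "(0, 0) \<in> \<Omega>"
    and "C1_closure \<Omega> h0" and "\<forall>x\<in>closure \<Omega>. h0 x \<ge> 0" and "h0 (0, 0) = 0"
    and "F > 0"
  shows "locally_lipschitz_on ({0<..} \<times> UNIV) (\<lambda>(\<beta>, \<gamma>). Gfun \<Omega> h0 F \<beta> \<gamma>)
    \<and> (\<forall>\<eta>0 > 0. \<forall>\<eta>1. \<exists>T > 0. \<exists>\<eta> \<eta>'. ode_sol (Gfun \<Omega> h0 F) \<eta>0 \<eta>1 T \<eta> \<eta>' \<and>
          (\<forall>T' \<in> {0<..T}. \<forall>\<zeta> \<zeta>'. ode_sol (Gfun \<Omega> h0 F) \<eta>0 \<eta>1 T' \<zeta> \<zeta>' \<longrightarrow>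
              (\<forall>t\<in>{0..T'}. \<zeta> t = \<eta> t)))"
proof -
  \<comment> \<open>Continuity up to the boundary and compactness of the closure provide the upper
    bound of the weight.\<close>
  obtain H where H: "\<And>x. x \<in> closure \<Omega> \<Longrightarrow> \<bar>h0 x\<bar> \<le> H" "H > 0"
  proof -
    have "compact (closure \<Omega>)" "continuous_on (closure \<Omega>) h0"
      using assms(2,5) by (simp_all add: compact_closure C1_closure_def)
    then have "bounded (h0 ` closure \<Omega>)"
      by (intro compact_imp_bounded compact_continuous_image)
    then show thesis
      using that unfolding bounded_pos real_norm_def by blast
  qed
  obtain R where R: "\<And>x. x \<in> \<Omega> \<Longrightarrow> norm x \<le> R" "R > 0"
    using assms(2) unfolding bounded_pos by blast
  have h0_meas: "h0 \<in> borel_measurable (lebesgue_on \<Omega>)"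
  proof (rule continuous_imp_measurable_on_sets_lebesgue)
    show "continuous_on \<Omega> h0"
      using assms(5) closure_subset unfolding C1_closure_def by (blast intro: continuous_on_subset)
  qed (simp add: assms(1))
  have h0_bounds: "0 \<le> h0 x" "h0 x \<le> H" if "x \<in> \<Omega>" for x
  proof -
    have x: "x \<in> closure \<Omega>"
      using that closure_subset by blast
    show "0 \<le> h0 x"
      using assms(6) x by blast
    show "h0 x \<le> H"
      using H(1)[OF x] by simp
  qed
  have lip: "locally_lipschitz_on ({0<..} \<times> UNIV) (\<lambda>(\<beta>, \<gamma>). Gfun \<Omega> h0 F \<beta> \<gamma>)"
    by (rule Gfun_locally_lipschitz[OF assms(1,2) h0_meas h0_bounds less_imp_le[OF H(2)] R(1) less_imp_le[OF R(2)]])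
  show ?thesis
    using lip cauchy_problem_local[OF lip] by blast
qed

end
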